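(* The Faà di Bruno bialgebra in two variables $\mathcal F^2$ is isomorphic to the homotopy cardinality of the incidence bialgebra of the simplicial groupoid $\mathcal B\,\mathsf{Sym}_2$. More generally, for every $k\ge1$, the Faà di Bruno bialgebra in $k$ variables $\mathcal F^k$ is isomorphic to the homotopy cardinality of the incidence bialgebra of $\mathcal B\,\mathsf{Sym}_k$.
   Context: Monads and operads. $\mathbf{Grpd}$ is the category of groupoids. $\mathsf{S}^{\mathrm r}$ is the monad on $\mathbf{Grpd}$ sending $A$ to $\bigsqcup_{n\ge1}A^n/\!/\mathfrak S_n$: objects nonempty tuples $(a_1,\dots,a_n)$; morphisms generated by componentwise morphisms and, for $\sigma\in\mathfrak S_n$, isomorphisms $(a_1,\dots,a_n)\to(a_{\sigma(1)},\dots,a_{\sigma(n)})$; unit $a\mapsto (a)$, multiplication $\mu$ concatenation of tuples of tuples. An $\mathsf S^{\mathrm r}$-operad $Q$ consists of groupoids $Q_0$ (colours), $Q_1$ (operations), functors $s\colon Q_1\to\mathsf S^{\mathrm r}Q_0$ (inputs), $t\colon Q_1\to Q_0$ (output), a composition $m\colon\mathsf S^{\mathrm r}Q_1\times_{\mathsf S^{\mathrm r}Q_0}Q_1\to Q_1$ (the $Q_1$ factor being the root) and units $e$, satisfying the usual compatibility, associativity and unit laws. For $k\ge1$, $\mathsf{Sym}_k$ is the terminal $\mathsf S^{\mathrm r}$-operad on the discrete set of colours $K=\{1,\dots,k\}$: $Q_0=K$, $Q_1=\mathsf S^{\mathrm r}K\times K$, $s,t$ the projections, composition induced by $\mu$ (one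 operation for each nonempty tuple of input colours and output colour, with symmetric group actions). Bar construction. For an $\mathsf S^{\mathrm r}$-operad $Q$ put $Q_n:=\mathsf S^{\mathrm r}Q_{n-1}\times_{\mathsf S^{\mathrm r}Q_0}Q_1$ for $n\ge2$ ($n$-level trees of composable operations). $\mathcal BQ$ is the simplicial groupoid with $\mathcal B_nQ=\mathsf S^{\mathrm r}Q_n$; $d_0$ discards the top (leafward) level keeping outputs ($\mathsf S^{\mathrm r}t$ for $n=1$), $d_n$ discards the root level and flattens via $\mu$ ($\mu\circ\mathsf S^{\mathrm r}s$ for $n=1$), inner faces compose adjacent levels via $m$, degeneracies insert units. Incidence bialgebra. For a groupoid $G$, $|G|=\sum_{[x]}1/|\mathrm{Aut}(x)|$. For $X=\mathcal BQ$, $\mathbb Q_{\pi_0X_1}$ has basis $\delta_a$; $\Delta(\delta_f)=\sum_{a,b}\frac{|\Phi_{f;a,b}|}{|\mathrm{Aut}(a)||\mathrm{Aut}(b)|}\delta_a\otimes\delta_b$ with $\Phi_{f;a,b}$ the homotopy fibre over $(a,b)$ of $(d_2,d_0)$ restricted to the homotopy fibre of $d_1\colon X_2\to X_1$ over $f$; $\epsilon(\delta_f)=$ cardinality of the homotopy fibre of $s_0$ over $f$; product $\delta_a\delta_b=\delta_{a+b}$ by juxtaposition of configurations (unit adjoined). Faà di Bruno bialgebra in $k$ variables. Let $\mathbb Q[[y_1,\dots,y_k]]_+$ be power series without constant term, written $F=\sum_{n\in\mathbb N^k\setminus 0}F_{n}\,y^{n}/n!$ with $y^n=\prod y_j^{n_j}$,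 $n!=\prod n_j!$. $k$-tuples of such series form a monoid under substitution $(G^1,\dots,G^k)\circ(F^1,\dots,F^k)=(G^1(F^1,\dots,F^k),\dots,G^k(F^1,\dots,F^k))$. $\mathcal F^k$ is the polynomial algebra on the maps $A^i_n(F^1,\dots,F^k)=F^i_n$ ($1\le i\le k$, $n\in\mathbb N^k\setminus0$), with comultiplication $\Delta(A^i_n)(\mathbf F,\mathbf G)=A^i_n(\mathbf G\circ\mathbf F)$ and counit $\epsilon(A^i_n)=A^i_n(y_1,\dots,y_k)$. For $k=2$, with variables $x,y$, this is $\mathcal F^2$. *)

theory Defs
  imports Complex_Main "HOL-Library.Poly_Mapping" "HOL-Library.Product_Plus"
begin

section \<open>Groupoids, functors, homotopy fibres, homotopy cardinality\<close>

text \<open>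
  Morphisms are given by hom-sets, so one value may serve as a morphism between several pairs of
  objects; composition \<open>Comp G g f\<close> is \<open>g\<close> after \<open>f\<close>. Only the data of a groupoid (functor, operad,
  simplicial groupoid) is recorded; the laws play no role in the constructions below.
\<close>

record ('o, 'm) groupoid =
  Obj :: "'o set"
  Hom :: "'o \<Rightarrow> 'o \<Rightarrow> 'm set"
  Comp :: "'m \<Rightarrow> 'm \<Rightarrow> 'm"
  Idn :: "'o \<Rightarrow> 'm"

record ('o, 'm, 'p, 'n) gfun =
  fobj :: "'o \<Rightarrow> 'p"
  fmor :: "'m \<Rightarrow> 'n"

definition gcomp :: "('p, 'n, 'r, 'l) gfun \<Rightarrow> ('o, 'm, 'p, 'n) gfun \<Rightarrow> ('o, 'm, 'r, 'l) gfun"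
  (infixl \<open>\<circ>\<^sub>G\<close> 55) where
  "F \<circ>\<^sub>G E = \<lparr>fobj = fobj F \<circ> fobj E, fmor = fmor F \<circ> fmor E\<rparr>"

definition gpair :: "('o, 'm, 'p, 'n) gfun \<Rightarrow> ('o, 'm, 'r, 'l) gfun \<Rightarrow> ('o, 'm, 'p \<times> 'r, 'n \<times> 'l) gfun" where
  "gpair E F = \<lparr>fobj = (\<lambda>x. (fobj E x, fobj F x)), fmor = (\<lambda>f. (fmor E f, fmor F f))\<rparr>"

definition gprod :: "('o, 'm) groupoid \<Rightarrow> ('p, 'n) groupoid \<Rightarrow> ('o \<times> 'p, 'm \<times> 'n) groupoid" where
  "gprod G H = \<lparr>Obj = Obj G \<times> Obj H,
     Hom = (\<lambda>(x, y) (x', y'). Hom G x x' \<times> Hom H y y'),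
     Comp = (\<lambda>(g, h) (g', h'). (Comp G g g', Comp H h h')),
     Idn = (\<lambda>(x, y). (Idn G x, Idn H y))\<rparr>"

definition discrete :: "'o set \<Rightarrow> ('o, unit) groupoid" where
  "discrete A = \<lparr>Obj = A, Hom = (\<lambda>x y. if x = y then {()} else {}),
     Comp = (\<lambda>_ _. ()), Idn = (\<lambda>_. ())\<rparr>"

definition iso_class :: "('o, 'm) groupoid \<Rightarrow> 'o \<Rightarrow> 'o set" where
  "iso_class G x = {y \<in> Obj G. Hom G x y \<noteq> {}}"

definition pi0 :: "('o, 'm) groupoid \<Rightarrow> 'o set set" where
  "pi0 G = iso_class G ` Obj G"

definition rep :: "'o set \<Rightarrow> 'o" where
  "rep A = (SOME x. x \<in> A)"

definition Aut :: "('o, 'm) groupoid \<Rightarrow> 'o \<Rightarrow> 'm set" where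
  "Aut G x = Hom G x x"

text \<open>Meaningful when there are finitely many classes and all automorphism groups are finite.\<close>

definition hcard :: "('o, 'm) groupoid \<Rightarrow> rat" where
  "hcard G = (\<Sum>A\<in>pi0 G. 1 / of_nat (card (Aut G (rep A))))"

text \<open>The homotopy fibre of \<open>F : G \<rightarrow> H\<close> over \<open>h\<close>: objects are pairs \<open>(x, \<phi> : F x \<rightarrow> h)\<close>.\<close>

definition hofib :: "('o, 'm) groupoid \<Rightarrow> ('p, 'n) groupoid \<Rightarrow> ('o, 'm, 'p, 'n) gfun \<Rightarrow> 'p
    \<Rightarrow> ('o \<times> 'n, 'm) groupoid" where
  "hofib G H F h = \<lparr>Obj = {(x, \<phi>). x \<in> Obj G \<and> \<phi> \<in> Hom H (fobj F x) h},
     Hom = (\<lambda>(x, \<phi>) (x', \<phi>'). {g \<in> Hom G x x'. Comp H \<phi>' (fmor F g) = \<phi>}),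
     Comp = Comp G, Idn = (\<lambda>(x, \<phi>). Idn G x)\<rparr>"

definition hofib_proj :: "('o \<times> 'n, 'm, 'o, 'm) gfun" where
  "hofib_proj = \<lparr>fobj = fst, fmor = id\<rparr>"


section \<open>The monad of nonempty tuples with symmetric group actions\<close>

text \<open>
  A morphism \<open>(a\<^sub>0, \<dots>) \<rightarrow> (b\<^sub>0, \<dots>)\<close> of \<open>Sr A\<close> is a permutation \<open>\<sigma>\<close> with morphisms
  \<open>f\<^sub>i : a\<^bsub>\<sigma> i\<^esub> \<rightarrow> b\<^sub>i\<close>; it is encoded as the list with entries \<open>(\<sigma> i, f\<^sub>i)\<close>, positions counting from 0.
\<close>

definition Sr :: "('o, 'm) groupoid \<Rightarrow> ('o list, (nat \<times> 'm) list) groupoid" where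
  "Sr A = \<lparr>Obj = {as. as \<noteq> [] \<and> set as \<subseteq> Obj A},
     Hom = (\<lambda>as bs. {l. length l = length as \<and> length l = length bs \<and>
        distinct (map fst l) \<and> set (map fst l) = {..<length as} \<and>
        (\<forall>i<length bs. snd (l ! i) \<in> Hom A (as ! fst (l ! i)) (bs ! i))}),
     Comp = (\<lambda>l' l. map (\<lambda>(p, g). (fst (l ! p), Comp A g (snd (l ! p)))) l'),
     Idn = (\<lambda>as. map (\<lambda>i. (i, Idn A (as ! i))) [0..<length as])\<rparr>"

definition Sr_fun :: "('o, 'm, 'p, 'n) gfun \<Rightarrow>
    ('o list, (nat \<times> 'm) list, 'p list, (nat \<times> 'n) list) gfun" where
  "Sr_fun F = \<lparr>fobj = map (fobj F), fmor = map (apsnd (fmor F))\<rparr>"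

text \<open>
  On morphisms, the multiplication turns a permutation of blocks together with permutations inside
  the blocks into a permutation of the concatenation. A source block has the same length as the
  target block it is sent to, so \<open>block_start L p\<close> is where source block number \<open>p\<close> starts.
\<close>

definition block_start :: "(nat \<times> (nat \<times> 'm) list) list \<Rightarrow> nat \<Rightarrow> nat" where
  "block_start L p = (\<Sum>(q, l)\<leftarrow>L. if q < p then length l else 0)"

definition mu :: "('o list list, (nat \<times> (nat \<times> 'm) list) list, 'o list, (nat \<times> 'm) list) gfun" where
  "mu = \<lparr>fobj = concat,
     fmor = (\<lambda>L. concat (map (\<lambda>(p, l). map (\<lambda>(j, f). (block_start L p + j, f)) l) L))\<rparr>"


section \<open>Operads\<close>

text \<open>
  \<open>cmp\<close> is the composition on the strict fibre product of \<open>Sr ops\<close> and \<open>ops\<close> over \<open>Sr colours\<close>,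
  the second component being the root.
\<close>

record ('c, 'cm, 'q, 'qm) operad =
  colours :: "('c, 'cm) groupoid"
  ops :: "('q, 'qm) groupoid"
  src :: "('q, 'qm, 'c list, (nat \<times> 'cm) list) gfun"
  tgt :: "('q, 'qm, 'c, 'cm) gfun"
  cmp :: "('q list \<times> 'q, (nat \<times> 'qm) list \<times> 'qm, 'q, 'qm) gfun"
  unt :: "('c, 'cm, 'q, 'qm) gfun"

definition Sym_operad ::
    "nat \<Rightarrow> (nat, unit, nat list \<times> nat, (nat \<times> unit) list \<times> unit) operad" where
  "Sym_operad k = (let K = discrete {1..k}; M = mu in
    \<lparr>colours = K,
     ops = gprod (Sr K) K,
     src = \<lparr>fobj = fst, fmor = fst\<rparr>,
     tgt = \<lparr>fobj = snd, fmor = snd\<rparr>,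
     cmp = \<lparr>fobj = (\<lambda>(qs, r). (fobj M (map fst qs), snd r)),
            fmor = (\<lambda>(l, g). (fmor M (map (apsnd fst) l), snd g))\<rparr>,
     unt = \<lparr>fobj = (\<lambda>c. ([c], c)), fmor = (\<lambda>f. ([(0, f)], f))\<rparr>\<rparr>)"


section \<open>The bar construction\<close>

text \<open>
  Trees with \<open>n\<close> levels, for all \<open>n\<close> at once: \<open>Colour\<close> for \<open>n = 0\<close>, \<open>Oper\<close> for \<open>n = 1\<close>, and
  \<open>Graft qs r\<close> for the pair of a tuple \<open>qs\<close> of trees with \<open>n - 1\<close> levels and a root operation \<open>r\<close>.
\<close>

datatype ('c, 'q) ltree = Colour 'c | Oper 'q | Graft "('c, 'q) ltree list" 'q

datatype ('cm, 'qm) ltree_mor =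
  ColourM 'cm | OperM 'qm | GraftM "(nat \<times> ('cm, 'qm) ltree_mor) list" 'qm

type_synonym ('c, 'cm, 'q, 'qm, 'p, 'n) ltree_fun =
  "(('c, 'q) ltree, ('cm, 'qm) ltree_mor, 'p, 'n) gfun"

definition out :: "('c, 'cm, 'q, 'qm) operad \<Rightarrow> ('c, 'cm, 'q, 'qm, 'c, 'cm) ltree_fun" where
  "out Q = \<lparr>
     fobj = (\<lambda>x. case x of Colour c \<Rightarrow> c | Oper q \<Rightarrow> fobj (tgt Q) q | Graft qs r \<Rightarrow> fobj (tgt Q) r),
     fmor = (\<lambda>f. case f of ColourM c \<Rightarrow> c | OperM q \<Rightarrow> fmor (tgt Q) q | GraftM l g \<Rightarrow> fmor (tgt Q) g)\<rparr>"

text \<open>The root operation of a tree with at least one level.\<close>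

definition root_op :: "('c, 'cm, 'q, 'qm) operad \<Rightarrow> ('c, 'cm, 'q, 'qm, 'q, 'qm) ltree_fun" where
  "root_op Q = \<lparr>
     fobj = (\<lambda>x. case x of Colour c \<Rightarrow> undefined | Oper q \<Rightarrow> q | Graft qs r \<Rightarrow> r),
     fmor = (\<lambda>f. case f of ColourM c \<Rightarrow> undefined | OperM q \<Rightarrow> q | GraftM l g \<Rightarrow> g)\<rparr>"

text \<open>What is left after discarding the root operation of a tree with at least one level.\<close>

definition branches :: "('c, 'cm, 'q, 'qm) operad \<Rightarrow>
    ('c, 'cm, 'q, 'qm, ('c, 'q) ltree list, (nat \<times> ('cm, 'qm) ltree_mor) list) ltree_fun" where
  "branches Q = \<lparr>
     fobj = (\<lambda>x. case x of Colour c \<Rightarrow> undefined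
        | Oper q \<Rightarrow> map Colour (fobj (src Q) q) | Graft qs r \<Rightarrow> qs),
     fmor = (\<lambda>f. case f of ColourM c \<Rightarrow> undefined
        | OperM q \<Rightarrow> map (apsnd ColourM) (fmor (src Q) q) | GraftM l g \<Rightarrow> l)\<rparr>"

fun level :: "('c, 'cm, 'q, 'qm) operad \<Rightarrow> nat \<Rightarrow> (('c, 'q) ltree, ('cm, 'qm) ltree_mor) groupoid" where
  "level Q 0 = \<lparr>Obj = Colour ` Obj (colours Q),
     Hom = (\<lambda>x y. case (x, y) of (Colour c, Colour d) \<Rightarrow> ColourM ` Hom (colours Q) c d | _ \<Rightarrow> {}),
     Comp = (\<lambda>g f. case (g, f) of
        (ColourM g', ColourM f') \<Rightarrow> ColourM (Comp (colours Q) g' f') | _ \<Rightarrow> undefined),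
     Idn = (\<lambda>x. case x of Colour c \<Rightarrow> ColourM (Idn (colours Q) c) | _ \<Rightarrow> undefined)\<rparr>"
| "level Q (Suc 0) = \<lparr>Obj = Oper ` Obj (ops Q),
     Hom = (\<lambda>x y. case (x, y) of (Oper p, Oper q) \<Rightarrow> OperM ` Hom (ops Q) p q | _ \<Rightarrow> {}),
     Comp = (\<lambda>g f. case (g, f) of
        (OperM g', OperM f') \<Rightarrow> OperM (Comp (ops Q) g' f') | _ \<Rightarrow> undefined),
     Idn = (\<lambda>x. case x of Oper q \<Rightarrow> OperM (Idn (ops Q) q) | _ \<Rightarrow> undefined)\<rparr>"
| "level Q (Suc (Suc n)) = (let L = Sr (level Q (Suc n)); T = Sr_fun (out Q) in
    \<lparr>Obj = {Graft qs r | qs r. qs \<in> Obj L \<and> r \<in> Obj (ops Q) \<and> fobj T qs = fobj (src Q) r},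
     Hom = (\<lambda>x y. case (x, y) of
        (Graft qs r, Graft qs' r') \<Rightarrow>
          {GraftM l g | l g. l \<in> Hom L qs qs' \<and> g \<in> Hom (ops Q) r r' \<and> fmor T l = fmor (src Q) g}
        | _ \<Rightarrow> {}),
     Comp = (\<lambda>g f. case (g, f) of
        (GraftM l' g', GraftM l g) \<Rightarrow> GraftM (Comp L l' l) (Comp (ops Q) g' g) | _ \<Rightarrow> undefined),
     Idn = (\<lambda>x. case x of Graft qs r \<Rightarrow> GraftM (Idn L qs) (Idn (ops Q) r) | _ \<Rightarrow> undefined)\<rparr>)"

definition graft_fun :: "('c, 'cm, 'q, 'qm, ('c, 'q) ltree, ('cm, 'qm) ltree_mor) ltree_fun \<Rightarrow>
    ('c, 'cm, 'q, 'qm, ('c, 'q) ltree, ('cm, 'qm) ltree_mor) ltree_fun" where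
  "graft_fun F = \<lparr>
     fobj = (\<lambda>x. case x of Graft qs r \<Rightarrow> Graft (fobj (Sr_fun F) qs) r | _ \<Rightarrow> undefined),
     fmor = (\<lambda>f. case f of GraftM l g \<Rightarrow> GraftM (fmor (Sr_fun F) l) g | _ \<Rightarrow> undefined)\<rparr>"

text \<open>
  \<open>tree_face Q n i\<close> goes from trees with \<open>n\<close> levels to trees with \<open>n - 1\<close> levels, for \<open>i < n\<close>: it
  discards the leaf level if \<open>i = 0\<close>, and composes the levels \<open>i\<close> and \<open>i + 1\<close> (counted from the
  leaves) otherwise. The remaining face, \<open>i = n\<close>, produces tuples of trees.
\<close>

fun tree_face :: "('c, 'cm, 'q, 'qm) operad \<Rightarrow> nat \<Rightarrow> nat \<Rightarrow>
    ('c, 'cm, 'q, 'qm, ('c, 'q) ltree, ('cm, 'qm) ltree_mor) ltree_fun" where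
  "tree_face Q 0 i = undefined"
| "tree_face Q (Suc 0) i = \<lparr>fobj = Colour \<circ> fobj (out Q), fmor = ColourM \<circ> fmor (out Q)\<rparr>"
| "tree_face Q (Suc (Suc n)) i =
    (if i = Suc n then \<lparr>
       fobj = (\<lambda>x. case x of
          Graft qs r \<Rightarrow> let r' = fobj (cmp Q) (fobj (Sr_fun (root_op Q)) qs, r) in
            if n = 0 then Oper r' else Graft (fobj (mu \<circ>\<^sub>G Sr_fun (branches Q)) qs) r'
          | _ \<Rightarrow> undefined),
       fmor = (\<lambda>f. case f of
          GraftM l g \<Rightarrow> let g' = fmor (cmp Q) (fmor (Sr_fun (root_op Q)) l, g) in
            if n = 0 then OperM g' else GraftM (fmor (mu \<circ>\<^sub>G Sr_fun (branches Q)) l) g'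
          | _ \<Rightarrow> undefined)\<rparr>
     else if n = 0 then \<lparr>fobj = Oper \<circ> fobj (root_op Q), fmor = OperM \<circ> fmor (root_op Q)\<rparr>
     else graft_fun (tree_face Q (Suc n) i))"

text \<open>
  \<open>tree_degen Q n i\<close> inserts a level of units between the levels \<open>i\<close> and \<open>i + 1\<close> (above the leaf
  level if \<open>i = 0\<close>, below the root if \<open>i = n\<close>).
\<close>

fun tree_degen :: "('c, 'cm, 'q, 'qm) operad \<Rightarrow> nat \<Rightarrow> nat \<Rightarrow>
    ('c, 'cm, 'q, 'qm, ('c, 'q) ltree, ('cm, 'qm) ltree_mor) ltree_fun" where
  "tree_degen Q 0 i = \<lparr>fobj = Oper \<circ> fobj (unt Q) \<circ> fobj (out Q),
     fmor = OperM \<circ> fmor (unt Q) \<circ> fmor (out Q)\<rparr>"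
| "tree_degen Q (Suc n) i =
    (if i = Suc n then \<lparr>
       fobj = (\<lambda>x. Graft [x] (fobj (unt Q) (fobj (out Q) x))),
       fmor = (\<lambda>f. GraftM [(0, f)] (fmor (unt Q) (fmor (out Q) f)))\<rparr>
     else if n = 0 then \<lparr>
       fobj = (\<lambda>x. Graft (fobj (Sr_fun (tree_degen Q 0 0) \<circ>\<^sub>G branches Q) x) (fobj (root_op Q) x)),
       fmor = (\<lambda>f. GraftM (fmor (Sr_fun (tree_degen Q 0 0) \<circ>\<^sub>G branches Q) f) (fmor (root_op Q) f))\<rparr>
     else graft_fun (tree_degen Q n i))"

record ('o, 'm) simplicial_groupoid =
  simp :: "nat \<Rightarrow> ('o, 'm) groupoid"
  face :: "nat \<Rightarrow> nat \<Rightarrow> ('o, 'm, 'o, 'm) gfun"   \<comment> \<open>\<open>face X n i\<close> is \<open>d\<^sub>i : X\<^sub>n \<rightarrow> X\<^bsub>n-1\<^esub>\<close>\<close>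
  degen :: "nat \<Rightarrow> nat \<Rightarrow> ('o, 'm, 'o, 'm) gfun"  \<comment> \<open>\<open>degen X n i\<close> is \<open>s\<^sub>i : X\<^sub>n \<rightarrow> X\<^bsub>n+1\<^esub>\<close>\<close>

definition bar :: "('c, 'cm, 'q, 'qm) operad \<Rightarrow>
    (('c, 'q) ltree list, (nat \<times> ('cm, 'qm) ltree_mor) list) simplicial_groupoid" where
  "bar Q = \<lparr>simp = (\<lambda>n. Sr (level Q n)),
     face = (\<lambda>n i. if i = n then mu \<circ>\<^sub>G Sr_fun (branches Q) else Sr_fun (tree_face Q n i)),
     degen = (\<lambda>n i. Sr_fun (tree_degen Q n i))\<rparr>"


section \<open>Bialgebras over the rationals with a chosen basis\<close>

text \<open>
  The underlying space is the free vector space on \<open>basis\<close>, realised as the finitely supported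
  functions vanishing off the basis; its tensor square is the free vector space on pairs.
\<close>

record 'b bialgebra =
  basis :: "'b set"
  mult :: "('b \<Rightarrow>\<^sub>0 rat) \<Rightarrow> ('b \<Rightarrow>\<^sub>0 rat) \<Rightarrow> ('b \<Rightarrow>\<^sub>0 rat)"
  unit :: "'b \<Rightarrow>\<^sub>0 rat"
  comult :: "('b \<Rightarrow>\<^sub>0 rat) \<Rightarrow> ('b \<times> 'b \<Rightarrow>\<^sub>0 rat)"
  counit :: "('b \<Rightarrow>\<^sub>0 rat) \<Rightarrow> rat"

definition vectors :: "'b bialgebra \<Rightarrow> ('b \<Rightarrow>\<^sub>0 rat) set" where
  "vectors B = {p. Poly_Mapping.keys p \<subseteq> basis B}"

definition scale :: "rat \<Rightarrow> ('b \<Rightarrow>\<^sub>0 rat) \<Rightarrow> ('b \<Rightarrow>\<^sub>0 rat)" where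
  "scale c p = Poly_Mapping.map ((*) c) p"

definition lin_ext :: "('a \<Rightarrow> ('b \<Rightarrow>\<^sub>0 rat)) \<Rightarrow> ('a \<Rightarrow>\<^sub>0 rat) \<Rightarrow> ('b \<Rightarrow>\<^sub>0 rat)" where
  "lin_ext h p = (\<Sum>x\<in>Poly_Mapping.keys p. scale (Poly_Mapping.lookup p x) (h x))"

definition tensor :: "('a \<Rightarrow>\<^sub>0 rat) \<Rightarrow> ('b \<Rightarrow>\<^sub>0 rat) \<Rightarrow> ('a \<times> 'b \<Rightarrow>\<^sub>0 rat)" where
  "tensor p q = (\<Sum>x\<in>Poly_Mapping.keys p. \<Sum>y\<in>Poly_Mapping.keys q.
     Poly_Mapping.single (x, y) (Poly_Mapping.lookup p x * Poly_Mapping.lookup q y))"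

definition tensor_map :: "(('a \<Rightarrow>\<^sub>0 rat) \<Rightarrow> ('b \<Rightarrow>\<^sub>0 rat)) \<Rightarrow> ('a \<times> 'a \<Rightarrow>\<^sub>0 rat) \<Rightarrow> ('b \<times> 'b \<Rightarrow>\<^sub>0 rat)" where
  "tensor_map \<phi> = lin_ext (\<lambda>(x, y).
     tensor (\<phi> (Poly_Mapping.single x 1)) (\<phi> (Poly_Mapping.single y 1)))"

definition isomorphic_bialgebras :: "'a bialgebra \<Rightarrow> 'b bialgebra \<Rightarrow> bool" where
  "isomorphic_bialgebras A B \<longleftrightarrow> (\<exists>\<phi>. bij_betw \<phi> (vectors A) (vectors B) \<and>
     (\<forall>p\<in>vectors A. \<forall>q\<in>vectors A. \<phi> (p + q) = \<phi> p + \<phi> q) \<and>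
     (\<forall>c. \<forall>p\<in>vectors A. \<phi> (scale c p) = scale c (\<phi> p)) \<and>
     (\<forall>p\<in>vectors A. \<forall>q\<in>vectors A. \<phi> (mult A p q) = mult B (\<phi> p) (\<phi> q)) \<and>
     \<phi> (unit A) = unit B \<and>
     (\<forall>p\<in>vectors A. comult B (\<phi> p) = tensor_map \<phi> (comult A p)) \<and>
     (\<forall>p\<in>vectors A. counit B (\<phi> p) = counit A p))"


section \<open>The incidence bialgebra\<close>

definition Phi :: "('o, 'm) simplicial_groupoid \<Rightarrow> 'o \<Rightarrow> 'o \<Rightarrow> 'o \<Rightarrow>
    (('o \<times> 'm) \<times> ('m \<times> 'm), 'm) groupoid" where
  "Phi X f a b = (let fibre = hofib (simp X 2) (simp X 1) (face X 2 1) f in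
     hofib fibre (gprod (simp X 1) (simp X 1))
       (gpair (face X 2 2) (face X 2 0) \<circ>\<^sub>G hofib_proj) (a, b))"

definition incidence_coeff :: "('o, 'm) simplicial_groupoid \<Rightarrow> 'o set \<Rightarrow> 'o set \<Rightarrow> 'o set \<Rightarrow> rat" where
  "incidence_coeff X f a b = hcard (Phi X (rep f) (rep a) (rep b)) /
     (of_nat (card (Aut (simp X 1) (rep a))) * of_nat (card (Aut (simp X 1) (rep b))))"

text \<open>
  The basis consists of the isomorphism classes of \<open>X\<^sub>1\<close>, tagged with \<open>Some\<close>, and the adjoined unit
  \<open>None\<close>, which is grouplike with counit 1. The sum defining the comultiplication of a basis element
  is indexed by its nonzero terms, of which there are finitely many for the bar construction.
\<close>

fun basis_comult :: "('o, 'm) simplicial_groupoid \<Rightarrow> 'o set option \<Rightarrow>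
    ('o set option \<times> 'o set option \<Rightarrow>\<^sub>0 rat)" where
  "basis_comult X None = Poly_Mapping.single (None, None) 1"
| "basis_comult X (Some f) =
    (\<Sum>(a, b)\<in>{(a, b). a \<in> pi0 (simp X 1) \<and> b \<in> pi0 (simp X 1) \<and> incidence_coeff X f a b \<noteq> 0}.
       Poly_Mapping.single (Some a, Some b) (incidence_coeff X f a b))"

fun basis_counit :: "('o, 'm) simplicial_groupoid \<Rightarrow> 'o set option \<Rightarrow> rat" where
  "basis_counit X None = 1"
| "basis_counit X (Some f) = hcard (hofib (simp X 0) (simp X 1) (degen X 0 0) (rep f))"

text \<open>\<open>jux\<close> is the juxtaposition of configurations.\<close>

fun basis_mult :: "('o, 'm) simplicial_groupoid \<Rightarrow> ('o \<Rightarrow> 'o \<Rightarrow> 'o) \<Rightarrow>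
    'o set option \<Rightarrow> 'o set option \<Rightarrow> 'o set option" where
  "basis_mult X jux None b = b"
| "basis_mult X jux (Some a) None = Some a"
| "basis_mult X jux (Some a) (Some b) = Some (iso_class (simp X 1) (jux (rep a) (rep b)))"

definition incidence_bialgebra :: "('o, 'm) simplicial_groupoid \<Rightarrow> ('o \<Rightarrow> 'o \<Rightarrow> 'o) \<Rightarrow>
    'o set option bialgebra" where
  "incidence_bialgebra X jux = \<lparr>
     basis = insert None (Some ` pi0 (simp X 1)),
     mult = (\<lambda>p q. lin_ext (\<lambda>(a, b). Poly_Mapping.single (basis_mult X jux a b) 1) (tensor p q)),
     unit = Poly_Mapping.single None 1,
     comult = lin_ext (basis_comult X),
     counit = (\<lambda>p. \<Sum>a\<in>Poly_Mapping.keys p. Poly_Mapping.lookup p a * basis_counit X a)\<rparr>"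


section \<open>Formal power series in several variables\<close>

text \<open>
  Variables are \<open>y\<^sub>0, y\<^sub>1, \<dots>\<close>; the exponent \<open>n\<close> stands for the monomial with \<open>y\<^sub>j\<close> to the power
  \<open>lookup n j\<close>, and \<open>coeff F n\<close> is the ordinary coefficient, without factorials.
\<close>

typedef mseries = "UNIV :: ((nat \<Rightarrow>\<^sub>0 nat) \<Rightarrow> rat) set"
  morphisms coeff Series ..

setup_lifting type_definition_mseries

lemma mseries_eqI: "(\<And>n. coeff F n = coeff G n) \<Longrightarrow> F = G"
  by (metis coeff_inverse ext)

lemma finite_decompositions: "finite {(a, b). a + b = (n :: nat \<Rightarrow>\<^sub>0 nat)}"
proof -
  let ?S = "{f. \<forall>x. (x \<in> Poly_Mapping.keys n \<longrightarrow> f x \<in> {.. Max (range (Poly_Mapping.lookup n))}) \<and>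
                (x \<notin> Poly_Mapping.keys n \<longrightarrow> f x = (0::nat))}"
  have fin_range: "finite (range (Poly_Mapping.lookup n))"
  proof -
    have "range (Poly_Mapping.lookup n) \<subseteq> insert 0 (Poly_Mapping.lookup n ` Poly_Mapping.keys n)"
      by (auto simp: in_keys_iff)
    then show ?thesis
      by (rule finite_subset) simp
  qed
  have "finite ?S"
    by (rule finite_set_of_finite_funs) simp_all
  moreover have "Poly_Mapping.lookup ` fst ` {(a, b). a + b = n} \<subseteq> ?S"
  proof -
    have "Poly_Mapping.lookup a x \<le> Max (range (Poly_Mapping.lookup n))" if "a + b = n" for a b x
      using Max_ge[OF fin_range, of "Poly_Mapping.lookup n x"] that by (auto simp: lookup_add)
    then show ?thesis
      by (auto simp: lookup_add in_keys_iff)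
  qed
  ultimately have "finite (Poly_Mapping.lookup ` fst ` {(a, b). a + b = n})"
    by (rule finite_subset[rotated])
  then have "finite (fst ` {(a, b). a + b = n})"
    by (rule finite_imageD) (simp add: inj_on_def poly_mapping_eqI)
  then show ?thesis
    by (rule finite_imageD) (auto simp: inj_on_def)
qed

instantiation mseries :: comm_ring_1
begin

lift_definition zero_mseries :: mseries is "\<lambda>_. 0" .

lift_definition one_mseries :: mseries is "\<lambda>n. if n = 0 then 1 else 0" .

lift_definition plus_mseries :: "mseries \<Rightarrow> mseries \<Rightarrow> mseries" is "\<lambda>F G n. F n + G n" .

lift_definition minus_mseries :: "mseries \<Rightarrow> mseries \<Rightarrow> mseries" is "\<lambda>F G n. F n - G n" .

lift_definition uminus_mseries :: "mseries \<Rightarrow> mseries" is "\<lambda>F n. - F n" .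

lift_definition times_mseries :: "mseries \<Rightarrow> mseries \<Rightarrow> mseries" is
  "\<lambda>F G n. \<Sum>(a, b)\<in>{(a, b). a + b = n}. F a * G b" .

instance
proof
  fix F G H :: mseries
  show "F * G = G * F"
  proof (rule mseries_eqI)
    fix n
    show "coeff (F * G) n = coeff (G * F) n"
      unfolding times_mseries.rep_eq
      by (rule sum.reindex_bij_witness[where i = prod.swap and j = prod.swap])
        (auto simp: add.commute mult.commute)
  qed
  show "(F * G) * H = F * (G * H)"
  proof (rule mseries_eqI)
    fix n
    have "coeff ((F * G) * H) n =
        (\<Sum>(p, c)\<in>{(p, c). p + c = n}. \<Sum>(a, b)\<in>{(a, b). a + b = p}. coeff F a * coeff G b * coeff H c)"
      unfolding times_mseries.rep_eq
      by (intro sum.cong) (auto simp: sum_distrib_right split_def)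
    also have "\<dots> = (\<Sum>((p, c), (a, b))\<in>Sigma {(p, c). p + c = n} (\<lambda>(p, c). {(a, b). a + b = p}).
        coeff F a * coeff G b * coeff H c)"
      by (subst sum.Sigma[symmetric]) (auto simp: finite_decompositions[unfolded split_def] split_def)
    also have "\<dots> = (\<Sum>((a, p), (b, c))\<in>Sigma {(a, p). a + p = n} (\<lambda>(a, p). {(b, c). b + c = p}).
        coeff F a * (coeff G b * coeff H c))"
      by (rule sum.reindex_bij_witness[where
            i = "\<lambda>((a, p), (b, c)). ((a + b, c), (a, b))" and
            j = "\<lambda>((p, c), (a, b)). ((a, b + c), (b, c))"])
        (auto simp: add.assoc mult.assoc)
    also have "\<dots> = (\<Sum>(a, p)\<in>{(a, p). a + p = n}. \<Sum>(b, c)\<in>{(b, c). b + c = p}.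
        coeff F a * (coeff G b * coeff H c))"
      by (subst sum.Sigma[symmetric]) (auto simp: finite_decompositions[unfolded split_def] split_def)
    also have "\<dots> = coeff (F * (G * H)) n"
      unfolding times_mseries.rep_eq
      by (intro sum.cong) (auto simp: sum_distrib_left split_def)
    finally show "coeff ((F * G) * H) n = coeff (F * (G * H)) n" .
  qed
  show "1 * F = F"
  proof (rule mseries_eqI)
    fix n
    have "coeff (1 * F) n = (\<Sum>(a, b)\<in>{(0 :: nat \<Rightarrow>\<^sub>0 nat, n)}. (if a = 0 then 1 else 0) * coeff F b)"
      unfolding times_mseries.rep_eq one_mseries.rep_eq
      by (rule sum.mono_neutral_right) (auto simp: finite_decompositions[unfolded split_def] split_def)
    then show "coeff (1 * F) n = coeff F n"
      by simp
  qed
  show "(F + G) * H = F * H + G * H"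
    by (rule mseries_eqI)
      (simp add: times_mseries.rep_eq plus_mseries.rep_eq split_def distrib_right sum.distrib)
  show "(0::mseries) \<noteq> 1"
  proof
    assume "(0::mseries) = 1"
    then have "coeff 0 0 = coeff 1 0"
      by simp
    then show False
      by (simp add: zero_mseries.rep_eq one_mseries.rep_eq)
  qed
qed (rule mseries_eqI; simp add: plus_mseries.rep_eq zero_mseries.rep_eq
       uminus_mseries.rep_eq minus_mseries.rep_eq algebra_simps)+

end

text \<open>The exponents supported on the variables \<open>y\<^sub>1, \<dots>, y\<^sub>k\<close>.\<close>

definition exponents :: "nat \<Rightarrow> (nat \<Rightarrow>\<^sub>0 nat) set" where
  "exponents k = {n. Poly_Mapping.keys n \<subseteq> {1..k}}"

definition exp_fact :: "(nat \<Rightarrow>\<^sub>0 nat) \<Rightarrow> nat" where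
  "exp_fact n = (\<Prod>j\<in>Poly_Mapping.keys n. fact (Poly_Mapping.lookup n j))"

text \<open>\<open>k\<close>-tuples, indexed by 1 to \<open>k\<close>, of series in \<open>y\<^sub>1, \<dots>, y\<^sub>k\<close> without constant term.\<close>

definition tuples :: "nat \<Rightarrow> (nat \<Rightarrow> mseries) set" where
  "tuples k = {F. \<forall>i\<in>{1..k}. \<forall>n. coeff (F i) n \<noteq> 0 \<longrightarrow> n \<in> exponents k - {0}}"

definition substitute :: "nat \<Rightarrow> mseries \<Rightarrow> (nat \<Rightarrow> mseries) \<Rightarrow> mseries" where
  "substitute k G F = Series (\<lambda>n. Sum_any (\<lambda>m.
     coeff G m * coeff (\<Prod>j=1..k. F j ^ Poly_Mapping.lookup m j) n))"

text \<open>\<open>(G\<^sup>1, \<dots>, G\<^sup>k) \<circ> (F\<^sup>1, \<dots>, F\<^sup>k)\<close>\<close>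

definition compose_tuples :: "nat \<Rightarrow> (nat \<Rightarrow> mseries) \<Rightarrow> (nat \<Rightarrow> mseries) \<Rightarrow> nat \<Rightarrow> mseries" where
  "compose_tuples k G F = (\<lambda>i. substitute k (G i) F)"

definition variables :: "nat \<Rightarrow> mseries" where
  "variables i = Series (\<lambda>n. if n = Poly_Mapping.single i 1 then 1 else 0)"


section \<open>The Faa di Bruno bialgebra\<close>

text \<open>
  The polynomial generator \<open>A\<^sup>i\<^sub>n\<close> is the pair \<open>(i, n)\<close>; monomials in the generators form the basis.
  \<open>coord (i, n)\<close> is the function on tuples that the generator denotes.
\<close>

type_synonym generator = "nat \<times> (nat \<Rightarrow>\<^sub>0 nat)"

definition coord :: "generator \<Rightarrow> (nat \<Rightarrow> mseries) \<Rightarrow> rat" where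
  "coord = (\<lambda>(i, n) F. of_nat (exp_fact n) * coeff (F i) n)"

text \<open>The algebra map on a polynomial algebra over \<open>\<rat>\<close> with prescribed values \<open>h\<close> on the generators;
  \<open>\<iota>\<close> is the structure map of the target algebra.\<close>

definition alg_ext :: "(rat \<Rightarrow> 'r) \<Rightarrow> ('v \<Rightarrow> 'r) \<Rightarrow> (('v \<Rightarrow>\<^sub>0 nat) \<Rightarrow>\<^sub>0 rat) \<Rightarrow> 'r::comm_ring_1" where
  "alg_ext \<iota> h P = (\<Sum>m\<in>Poly_Mapping.keys P. \<iota> (Poly_Mapping.lookup P m) *
     (\<Prod>v\<in>Poly_Mapping.keys m. h v ^ Poly_Mapping.lookup m v))"

definition evaluate :: "((generator \<Rightarrow>\<^sub>0 nat) \<Rightarrow>\<^sub>0 rat) \<Rightarrow> (nat \<Rightarrow> mseries) \<Rightarrow> rat" where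
  "evaluate P F = alg_ext id (\<lambda>v. coord v F) P"

text \<open>An element of the tensor square as a function of two tuples.\<close>

definition evaluate2 :: "((generator \<Rightarrow>\<^sub>0 nat) \<times> (generator \<Rightarrow>\<^sub>0 nat) \<Rightarrow>\<^sub>0 rat) \<Rightarrow>
    (nat \<Rightarrow> mseries) \<Rightarrow> (nat \<Rightarrow> mseries) \<Rightarrow> rat" where
  "evaluate2 T F G = (\<Sum>(m, m')\<in>Poly_Mapping.keys T. Poly_Mapping.lookup T (m, m') *
     evaluate (Poly_Mapping.single m 1) F * evaluate (Poly_Mapping.single m' 1) G)"

definition fdb_monomials :: "nat \<Rightarrow> (generator \<Rightarrow>\<^sub>0 nat) set" where
  "fdb_monomials k = {m. Poly_Mapping.keys m \<subseteq> {1..k} \<times> (exponents k - {0})}"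

definition fdb_comult_gen :: "nat \<Rightarrow> generator \<Rightarrow>
    ((generator \<Rightarrow>\<^sub>0 nat) \<times> (generator \<Rightarrow>\<^sub>0 nat) \<Rightarrow>\<^sub>0 rat)" where
  "fdb_comult_gen k v = (THE T. Poly_Mapping.keys T \<subseteq> fdb_monomials k \<times> fdb_monomials k \<and>
     (\<forall>F\<in>tuples k. \<forall>G\<in>tuples k. evaluate2 T F G = coord v (compose_tuples k G F)))"

text \<open>
  The tensor square of the polynomial algebra is again an algebra, the monoid algebra of pairs of
  monomials; its multiplication is the library's product of finitely supported functions.
\<close>

definition faa_di_bruno :: "nat \<Rightarrow> (generator \<Rightarrow>\<^sub>0 nat) bialgebra" where
  "faa_di_bruno k = \<lparr>
     basis = fdb_monomials k,
     mult = (*),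
     unit = 1,
     comult = alg_ext (Poly_Mapping.single 0) (fdb_comult_gen k),
     counit = alg_ext id (\<lambda>v. coord v variables)\<rparr>"

end

theory Submission
  imports Defs "HOL-Combinatorics.Multiset_Permutations"
begin

text \<open>
  The operation with input colours \<open>c\<close> and output colour \<open>i\<close> corresponds to the generator
  \<open>A\<^sup>i\<^sub>n\<close>, where \<open>n\<close> counts the occurrences of each colour in \<open>c\<close>, so isomorphism classes of
  configurations of operations are the nontrivial monomials. On the series side, a power series is
  summed over words instead of monomials: since a monomial of exponent \<open>n\<close> comes from
  \<open>length c ! / n!\<close> words, dividing the coefficient \<open>F\<^sub>n\<close> by \<open>length c !\<close> for each word \<open>c\<close> gives
  \<open>F\<^sub>n / n!\<close>. Substitution then becomes a sum over two-level trees in which a tree with leaf words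
  \<open>c\<^sub>1, \<dots>, c\<^sub>r\<close> has weight \<open>n! / (r! (length c\<^sub>1)! \<dots> (length c\<^sub>r)!)\<close>. On the groupoid side, a
  homotopy cardinality is the sum over all objects of the reciprocal number of outgoing arrows, and
  \<open>r! (length c\<^sub>1)! \<dots> (length c\<^sub>r)!\<close> is the number of arrows out of such a tree, while \<open>n!\<close> is the
  number of isomorphisms from its composite to a given operation. Hence both comultiplications are
  given by the same sum, tree by tree.
\<close>

section \<open>Groupoids and homotopy cardinality\<close>

text \<open>Matching single operations is not enough: the coefficients of the incidence
  comultiplication are defined for whole configurations, while the Faa di Bruno side extends
  multiplicatively from the generators. A morphism of configurations carries a permutation, so its
  hom-sets are counted by a sum over permutations. The remaining weight of a tuple of trees depends
  only on its multiset of trees, so all \<open>n!\<close> permutations contribute equally; this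
  cancels the \<open>n!\<close> from reordering the trees, and what remains factors over the
  operations. The automorphism groups in the denominator of a coefficient cancel because a nonempty
  hom-set into \<open>a\<close> has as many elements as the automorphism group of \<open>a\<close>.

  The comultiplication of a generator is specified only as a function on pairs of tuples, so the
  explicit sum must be shown to be the only element inducing it: pairs of monomials are distinct
  characters of a multiplicative monoid, hence linearly independent.

  The strict fibre product defining two-level trees causes no trouble in the count: colours are
  discrete, so an arrow out of a tree is determined by its leaf part.\<close>

text \<open>The laws are required for hom-sets between arbitrary values, not only between objects.\<close>

locale lf_groupoid =
  fixes G :: "('o, 'm) groupoid"
  assumes idn_hom: "x \<in> Obj G \<Longrightarrow> Idn G x \<in> Hom G x x"
    and comp_hom: "f \<in> Hom G x y \<Longrightarrow> g \<in> Hom G y z \<Longrightarrow> Comp G g f \<in> Hom G x z"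
    and comp_assoc: "f \<in> Hom G w x \<Longrightarrow> g \<in> Hom G x y \<Longrightarrow> h \<in> Hom G y z \<Longrightarrow>
      Comp G h (Comp G g f) = Comp G (Comp G h g) f"
    and comp_idn: "f \<in> Hom G x y \<Longrightarrow> Comp G f (Idn G x) = f"
    and idn_comp: "f \<in> Hom G x y \<Longrightarrow> Comp G (Idn G y) f = f"
    and ex_inverse: "f \<in> Hom G x y \<Longrightarrow>
      \<exists>g\<in>Hom G y x. Comp G g f = Idn G x \<and> Comp G f g = Idn G y"
    and finite_hom: "finite (Hom G x y)"
begin

lemma hom_sym: "Hom G x y \<noteq> {} \<longleftrightarrow> Hom G y x \<noteq> {}"
  using ex_inverse by blast

lemma hom_trans: "Hom G x y \<noteq> {} \<Longrightarrow> Hom G y z \<noteq> {} \<Longrightarrow> Hom G x z \<noteq> {}"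
  using comp_hom by blast

lemma comp_right_cancel:
  assumes "f \<in> Hom G x y" "g \<in> Hom G y z" "h \<in> Hom G y z" "Comp G g f = Comp G h f"
  shows "g = h"
proof -
  obtain f' where f': "f' \<in> Hom G y x" "Comp G f f' = Idn G y"
    using ex_inverse[OF assms(1)] by blast
  have "g = Comp G (Comp G g f) f'"
    using comp_assoc[OF f'(1) assms(1,2)] comp_idn[OF assms(2)] f'(2) by simp
  also have "\<dots> = h"
    using comp_assoc[OF f'(1) assms(1,3)] comp_idn[OF assms(3)] f'(2) assms(4) by simp
  finally show ?thesis .
qed

lemma ex_right_quotient:
  assumes "f \<in> Hom G x y" "h \<in> Hom G x z"
  shows "\<exists>g\<in>Hom G y z. Comp G g f = h"
proof -
  obtain f' where f': "f' \<in> Hom G y x" "Comp G f' f = Idn G x"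
    using ex_inverse[OF assms(1)] by blast
  have "Comp G (Comp G h f') f = h"
    using comp_assoc[OF assms(1) f'(1) assms(2)] comp_idn[OF assms(2)] f'(2) by simp
  then show ?thesis
    using comp_hom[OF f'(1) assms(2)] by blast
qed

lemma idempotent_eq_idn:
  assumes "e \<in> Hom G x x" "Comp G e e = e"
  shows "e = Idn G x"
proof -
  obtain g where g: "g \<in> Hom G x x" "Comp G g e = Idn G x"
    using ex_inverse[OF assms(1)] by blast
  then show ?thesis
    using comp_assoc[OF assms(1) assms(1) g(1)] idn_comp[OF assms(1)] assms(2) by simp
qed

text \<open>An arrow composed with its inverse gives the identity, so identities are available at
  every source of an arrow, even at values outside \<open>Obj G\<close>.\<close>

lemma idn_hom': "f \<in> Hom G x y \<Longrightarrow> Idn G x \<in> Hom G x x"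
  using ex_inverse comp_hom by metis

lemma card_hom_cong_source:
  assumes "Hom G x y \<noteq> {}"
  shows "card (Hom G x z) = card (Hom G y z)"
proof -
  obtain f where f: "f \<in> Hom G x y" using assms by blast
  have "bij_betw (\<lambda>g. Comp G g f) (Hom G y z) (Hom G x z)"
    unfolding bij_betw_def inj_on_def
    using comp_right_cancel[OF f] comp_hom[OF f] ex_right_quotient[OF f] by fast
  then show ?thesis
    using bij_betw_same_card by metis
qed

text \<open>Inversion embeds each hom-set into the opposite one, and the two resulting inequalities
  meet.\<close>

lemma card_hom_sym: "card (Hom G x y) = card (Hom G y x)"
proof (cases "Hom G x y = {}")
  case True
  with hom_sym[of x y] have "Hom G y x = {}" by blast
  with True show ?thesis by simp
next
  case False
  have "card (Hom G y x) \<le> card (Hom G x y)" for x y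
  proof -
    obtain i where i: "\<And>f. f \<in> Hom G y x \<Longrightarrow>
        i f \<in> Hom G x y \<and> Comp G (i f) f = Idn G y \<and> Comp G f (i f) = Idn G x"
      using ex_inverse[of _ y x] by metis
    have "inj_on i (Hom G y x)"
    proof (rule inj_onI)
      fix f g assume "f \<in> Hom G y x" "g \<in> Hom G y x" "i f = i g"
      then show "f = g"
        using i[of f] i[of g] comp_right_cancel[of "i f" x y f x g] by simp
    qed
    then show ?thesis
      using i finite_hom by (intro card_inj_on_le[of i]) auto
  qed
  from this[of x y] this[of y x] show ?thesis by (rule le_antisym)
qed

lemma card_hom_cong_target:
  assumes "Hom G x y \<noteq> {}"
  shows "card (Hom G z x) = card (Hom G z y)"
  unfolding card_hom_sym[of z x] card_hom_sym[of z y] by (rule card_hom_cong_source[OF assms])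

lemma iso_class_eq_iff:
  assumes "x \<in> Obj G" "y \<in> Obj G"
  shows "iso_class G x = iso_class G y \<longleftrightarrow> Hom G x y \<noteq> {}"
proof
  assume "iso_class G x = iso_class G y"
  moreover have "y \<in> iso_class G y"
    using assms idn_hom by (auto simp: iso_class_def)
  ultimately show "Hom G x y \<noteq> {}"
    by (auto simp: iso_class_def)
next
  assume "Hom G x y \<noteq> {}"
  then have "Hom G x z \<noteq> {} \<longleftrightarrow> Hom G y z \<noteq> {}" for z
    using hom_trans[of x y z] hom_trans[of y x z] hom_sym[of x y] by argo
  then show "iso_class G x = iso_class G y"
    by (simp add: iso_class_def)
qed

lemma rep_mem:
  assumes "A \<in> pi0 G"
  shows "rep A \<in> A" "rep A \<in> Obj G" "A = iso_class G (rep A)"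
proof -
  obtain x where x: "x \<in> Obj G" "A = iso_class G x"
    using assms by (auto simp: pi0_def)
  then have "x \<in> A" using idn_hom by (auto simp: iso_class_def)
  then show *: "rep A \<in> A" unfolding rep_def by (rule someI)
  then show "rep A \<in> Obj G" using x by (auto simp: iso_class_def)
  then show "A = iso_class G (rep A)"
    using x * iso_class_eq_iff[of x "rep A"] by (auto simp: iso_class_def)
qed

end

text \<open>The target is recorded with the arrow because one value may lie in several
  hom-sets.\<close>

definition arrows_from :: "('o, 'm) groupoid \<Rightarrow> 'o \<Rightarrow> ('o \<times> 'm) set" where
  "arrows_from G x = (SIGMA y:Obj G. Hom G x y)"

text \<open>Every object of an isomorphism class \<open>A\<close> is the source of \<open>card A * card (Aut G (rep A))\<close>
  arrows, so weighting objects by their number of outgoing arrows avoids choosing representatives.\<close>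

lemma (in lf_groupoid) hcard_eq_sum_arrows_from:
  assumes "finite (Obj G)"
  shows "hcard G = (\<Sum>x\<in>Obj G. 1 / of_nat (card (arrows_from G x)))"
proof -
  have fin: "finite (pi0 G)" using assms by (simp add: pi0_def)
  have "(\<Sum>x\<in>Obj G. 1 / of_nat (card (arrows_from G x)) :: rat) =
      (\<Sum>A\<in>pi0 G. \<Sum>x\<in>{x \<in> Obj G. iso_class G x = A}. 1 / of_nat (card (arrows_from G x)))"
    using assms fin by (intro sum.group[symmetric]) (auto simp: pi0_def)
  also have "\<dots> = (\<Sum>A\<in>pi0 G. 1 / of_nat (card (Aut G (rep A))))"
  proof (rule sum.cong[OF refl])
    fix A assume A: "A \<in> pi0 G"
    note r = rep_mem[OF A]
    have AO: "A \<subseteq> Obj G" using r(3) by (auto simp: iso_class_def)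
    have fA: "finite A" using AO assms finite_subset by blast
    have "x \<in> A \<longleftrightarrow> x \<in> Obj G \<and> Hom G (rep A) x \<noteq> {}" for x
      using arg_cong[OF r(3), of "\<lambda>B. x \<in> B"] by (simp add: iso_class_def)
    moreover have "iso_class G x = A \<longleftrightarrow> Hom G (rep A) x \<noteq> {}" if "x \<in> Obj G" for x
      using iso_class_eq_iff[OF r(2) that] r(3) by metis
    ultimately have eq: "{x \<in> Obj G. iso_class G x = A} = A"
      by blast
    have c: "card (arrows_from G x) = card A * card (Aut G (rep A))" if "x \<in> A" for x
    proof -
      have rx: "Hom G (rep A) x \<noteq> {}" using that r(3) by (auto simp: iso_class_def)
      have "card (arrows_from G x) = (\<Sum>y\<in>Obj G. card (Hom G x y))"
        unfolding arrows_from_def using assms finite_hom by (simp add: card_SigmaI)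
      also have "\<dots> = (\<Sum>y\<in>A. card (Hom G x y))"
      proof (rule sum.mono_neutral_right[OF assms AO], safe)
        fix y assume y: "y \<in> Obj G" "y \<notin> A"
        then have "Hom G (rep A) y = {}" using r(3) by (auto simp: iso_class_def)
        then show "card (Hom G x y) = 0" using hom_trans[OF rx, of y] by (cases "Hom G x y = {}") auto
      qed
      also have "\<dots> = (\<Sum>y\<in>A. card (Aut G (rep A)))"
      proof (rule sum.cong[OF refl])
        fix y assume "y \<in> A"
        then have "Hom G (rep A) y \<noteq> {}" using r(3) by (auto simp: iso_class_def)
        then show "card (Hom G x y) = card (Aut G (rep A))"
          unfolding Aut_def card_hom_cong_source[OF rx, symmetric]
          by (rule card_hom_cong_target[symmetric])
      qed
      finally show ?thesis by simp
    qed
    have "A \<noteq> {}" using r by auto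
    then have "card A \<noteq> 0" using fA by simp
    then show "(\<Sum>x\<in>{x \<in> Obj G. iso_class G x = A}. 1 / of_nat (card (arrows_from G x)) :: rat) =
        1 / of_nat (card (Aut G (rep A)))"
      unfolding eq using c by simp
  qed
  finally show ?thesis by (simp add: hcard_def)
qed

text \<open>Objects carved out by a condition, as in fibre products and homotopy fibres, leave
  behind hom-sets between values that fail the condition, and there the laws of
  \<open>lf_groupoid\<close> may break. Emptying those hom-sets restores the laws and keeps
  everything between objects.\<close>

definition guarded :: "('o, 'm) groupoid \<Rightarrow> ('o, 'm) groupoid" where
  "guarded G = G\<lparr>Hom := (\<lambda>x y. if x \<in> Obj G \<and> y \<in> Obj G then Hom G x y else {})\<rparr>"

lemma guarded_sel [simp]:
  "Obj (guarded G) = Obj G" "Comp (guarded G) = Comp G" "Idn (guarded G) = Idn G"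
  "f \<in> Hom (guarded G) x y \<longleftrightarrow> x \<in> Obj G \<and> y \<in> Obj G \<and> f \<in> Hom G x y"
  by (auto simp: guarded_def)

lemma Hom_guarded: "x \<in> Obj G \<Longrightarrow> y \<in> Obj G \<Longrightarrow> Hom (guarded G) x y = Hom G x y"
  by (simp add: guarded_def)

lemma lf_groupoid_guarded:
  assumes "lf_groupoid G"
  shows "lf_groupoid (guarded G)"
proof -
  interpret lf_groupoid G by fact
  show ?thesis
  proof
    fix f x y assume "f \<in> Hom (guarded G) x y"
    then show "\<exists>g\<in>Hom (guarded G) y x. Comp (guarded G) g f = Idn (guarded G) x \<and>
        Comp (guarded G) f g = Idn (guarded G) y"
      using ex_inverse[of f x y] by auto
  next
    show "finite (Hom (guarded G) x y)" for x y
      by (simp add: guarded_def finite_hom)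
  qed (auto intro: idn_hom comp_hom simp: comp_assoc comp_idn idn_comp)
qed

lemma arrows_from_guarded: "x \<in> Obj G \<Longrightarrow> arrows_from (guarded G) x = arrows_from G x"
  by (auto simp: arrows_from_def)

text \<open>Only classes of objects and automorphism groups of their representatives enter
  \<open>hcard\<close>; the representatives are again objects, so guarding changes neither.\<close>

lemma hcard_guarded:
  assumes "lf_groupoid (guarded G)"
  shows "hcard (guarded G) = hcard G"
proof -
  have p: "pi0 (guarded G) = pi0 G"
    by (auto simp: pi0_def iso_class_def guarded_def)
  have "rep A \<in> Obj G" if "A \<in> pi0 G" for A
    using lf_groupoid.rep_mem(2)[OF assms, of A] that p by simp
  then show ?thesis
    unfolding hcard_def p by (intro sum.cong) (auto simp: Aut_def Hom_guarded)
qed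

lemma hcard_eq_sum_arrows:
  assumes "lf_groupoid (guarded G)" "finite (Obj G)"
  shows "hcard G = (\<Sum>x\<in>Obj G. 1 / of_nat (card (arrows_from G x)))"
  using lf_groupoid.hcard_eq_sum_arrows_from[OF assms(1)] assms(2)
  by (simp add: hcard_guarded[OF assms(1)] arrows_from_guarded)

section \<open>Functors and products of groupoids\<close>

definition functorial :: "('o, 'm, 'p, 'n) gfun \<Rightarrow> ('o, 'm) groupoid \<Rightarrow> ('p, 'n) groupoid \<Rightarrow> bool" where
  "functorial F G H \<longleftrightarrow>
     (\<forall>x y. \<forall>f\<in>Hom G x y. fmor F f \<in> Hom H (fobj F x) (fobj F y)) \<and>
     (\<forall>x y z. \<forall>f\<in>Hom G x y. \<forall>g\<in>Hom G y z. fmor F (Comp G g f) = Comp H (fmor F g) (fmor F f))"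

lemma functorialI:
  assumes "\<And>x y f. f \<in> Hom G x y \<Longrightarrow> fmor F f \<in> Hom H (fobj F x) (fobj F y)"
    and "\<And>x y z f g. f \<in> Hom G x y \<Longrightarrow> g \<in> Hom G y z \<Longrightarrow>
      fmor F (Comp G g f) = Comp H (fmor F g) (fmor F f)"
  shows "functorial F G H"
  using assms by (auto simp: functorial_def)

lemma functorial_hom: "functorial F G H \<Longrightarrow> f \<in> Hom G x y \<Longrightarrow> fmor F f \<in> Hom H (fobj F x) (fobj F y)"
  by (auto simp: functorial_def)

lemma functorial_comp: "functorial F G H \<Longrightarrow> f \<in> Hom G x y \<Longrightarrow> g \<in> Hom G y z \<Longrightarrow>
    fmor F (Comp G g f) = Comp H (fmor F g) (fmor F f)"
  by (auto simp: functorial_def)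

text \<open>The image of an identity is idempotent, and in a groupoid the only idempotent
  endomorphism is the identity.\<close>

lemma functorial_idn:
  assumes "functorial F G H" "lf_groupoid G" "lf_groupoid H" "f \<in> Hom G x y"
  shows "fmor F (Idn G x) = Idn H (fobj F x)"
proof -
  interpret G: lf_groupoid G by fact
  interpret H: lf_groupoid H by fact
  have i: "Idn G x \<in> Hom G x x" using G.idn_hom'[OF assms(4)] .
  show ?thesis
    using functorial_hom[OF assms(1) i] functorial_comp[OF assms(1) i i] G.comp_idn[OF i]
    by (intro H.idempotent_eq_idn) auto
qed

lemma functorial_gcomp:
  assumes F: "functorial F G H" and E: "functorial E H K"
  shows "functorial (E \<circ>\<^sub>G F) G K"
proof (rule functorialI)
  fix x y z f g assume f: "f \<in> Hom G x y" and g: "g \<in> Hom G y z"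
  show "fmor (E \<circ>\<^sub>G F) (Comp G g f) = Comp K (fmor (E \<circ>\<^sub>G F) g) (fmor (E \<circ>\<^sub>G F) f)"
    using functorial_comp[OF F f g]
      functorial_comp[OF E functorial_hom[OF F f] functorial_hom[OF F g]] by (simp add: gcomp_def)
qed (simp add: gcomp_def functorial_hom[OF E functorial_hom[OF F]])

lemma sel_gprod [simp]:
  "x \<in> Obj (gprod G H) \<longleftrightarrow> fst x \<in> Obj G \<and> snd x \<in> Obj H"
  "f \<in> Hom (gprod G H) x y \<longleftrightarrow> fst f \<in> Hom G (fst x) (fst y) \<and> snd f \<in> Hom H (snd x) (snd y)"
  "Comp (gprod G H) g f = (Comp G (fst g) (fst f), Comp H (snd g) (snd f))"
  "Idn (gprod G H) x = (Idn G (fst x), Idn H (snd x))"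
  by (auto simp: gprod_def mem_Times_iff split: prod.splits)

lemma functorial_gpair:
  assumes E: "functorial E G H" and F: "functorial F G K"
  shows "functorial (gpair E F) G (gprod H K)"
proof (rule functorialI)
  fix x y z f g assume f: "f \<in> Hom G x y" and g: "g \<in> Hom G y z"
  show "fmor (gpair E F) (Comp G g f) = Comp (gprod H K) (fmor (gpair E F) g) (fmor (gpair E F) f)"
    using functorial_comp[OF E f g] functorial_comp[OF F f g] by (simp add: gpair_def)
qed (simp add: gpair_def functorial_hom[OF E] functorial_hom[OF F])

lemma Hom_gprod: "Hom (gprod G H) x y = Hom G (fst x) (fst y) \<times> Hom H (snd x) (snd y)"
  by auto

lemma lf_groupoid_gprod:
  assumes "lf_groupoid G" "lf_groupoid H"
  shows "lf_groupoid (gprod G H)"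
proof -
  interpret G: lf_groupoid G by fact
  interpret H: lf_groupoid H by fact
  show ?thesis
  proof
    fix f x y assume f: "f \<in> Hom (gprod G H) x y"
    then obtain g where "g \<in> Hom G (fst y) (fst x)" "Comp G g (fst f) = Idn G (fst x)"
        "Comp G (fst f) g = Idn G (fst y)"
      using G.ex_inverse[of "fst f" "fst x" "fst y"] by auto
    moreover obtain h where "h \<in> Hom H (snd y) (snd x)" "Comp H h (snd f) = Idn H (snd x)"
        "Comp H (snd f) h = Idn H (snd y)"
      using f H.ex_inverse[of "snd f" "snd x" "snd y"] by auto
    ultimately show "\<exists>g\<in>Hom (gprod G H) y x. Comp (gprod G H) g f = Idn (gprod G H) x \<and>
        Comp (gprod G H) f g = Idn (gprod G H) y"
      by (intro bexI[of _ "(g, h)"]) simp_all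
  next
    show "finite (Hom (gprod G H) x y)" for x y
      by (simp add: Hom_gprod G.finite_hom H.finite_hom)
  next
    show "Comp (gprod G H) g f \<in> Hom (gprod G H) x z"
      if "f \<in> Hom (gprod G H) x y" "g \<in> Hom (gprod G H) y z" for f g x y z
      using that by (auto intro: G.comp_hom H.comp_hom)
  next
    show "Comp (gprod G H) h (Comp (gprod G H) g f) = Comp (gprod G H) (Comp (gprod G H) h g) f"
      if "f \<in> Hom (gprod G H) w x" "g \<in> Hom (gprod G H) x y" "h \<in> Hom (gprod G H) y z"
      for f g h w x y z
      using that G.comp_assoc[of "fst f" "fst w" "fst x" "fst g" "fst y" "fst h" "fst z"]
        H.comp_assoc[of "snd f" "snd w" "snd x" "snd g" "snd y" "snd h" "snd z"] by simp
  next
    fix f x y assume f: "f \<in> Hom (gprod G H) x y"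
    show "Comp (gprod G H) f (Idn (gprod G H) x) = f"
      using f G.comp_idn[of "fst f" "fst x" "fst y"] H.comp_idn[of "snd f" "snd x" "snd y"] by (simp add: prod_eq_iff)
    show "Comp (gprod G H) (Idn (gprod G H) y) f = f"
      using f G.idn_comp[of "fst f" "fst x" "fst y"] H.idn_comp[of "snd f" "snd x" "snd y"] by (simp add: prod_eq_iff)
  qed (simp add: G.idn_hom H.idn_hom)
qed

lemma lf_groupoid_discrete: "lf_groupoid (discrete A)"
  by standard (auto simp: discrete_def split: if_splits)

section \<open>Homotopy fibres and their cardinality\<close>

lemma mem_Hom_hofib: "g \<in> Hom (hofib G H F h) x y \<longleftrightarrow>
    g \<in> Hom G (fst x) (fst y) \<and> Comp H (snd y) (fmor F g) = snd x"
  by (cases x; cases y) (simp add: hofib_def)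

lemma mem_Obj_hofib: "x \<in> Obj (hofib G H F h) \<longleftrightarrow>
    fst x \<in> Obj G \<and> snd x \<in> Hom H (fobj F (fst x)) h"
  by (cases x) (simp add: hofib_def)

lemma sel_hofib: "Comp (hofib G H F h) = Comp G" "Idn (hofib G H F h) x = Idn G (fst x)"
  by (cases x; simp add: hofib_def)+

lemma functorial_guarded: "functorial F G H \<Longrightarrow> functorial F (guarded G) H"
  by (auto simp: functorial_def)

text \<open>A morphism of \<open>hofib G H F h\<close> between pairs that are not objects need not be a morphism over
  \<open>h\<close>, so the groupoid laws only hold after guarding the hom-sets.\<close>

lemma lf_groupoid_hofib:
  assumes "lf_groupoid (guarded G)" "lf_groupoid H" "functorial F (guarded G) H"
  shows "lf_groupoid (guarded (hofib G H F h))"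
proof -
  let ?K = "guarded (hofib G H F h)"
  interpret G: lf_groupoid "guarded G" by fact
  interpret H: lf_groupoid H by fact
  note F_hom = functorial_hom[OF assms(3)] and F_comp = functorial_comp[OF assms(3)]
    and F_idn = functorial_idn[OF assms(3,1,2)]
  have E: "snd y \<in> Hom H (fobj F (fst y)) h" "snd x \<in> Hom H (fobj F (fst x)) h"
      "g \<in> Hom (guarded G) (fst x) (fst y)" "Comp H (snd y) (fmor F g) = snd x"
    if "g \<in> Hom ?K x y" for g x y
    using that by (auto simp: mem_Hom_hofib mem_Obj_hofib)
  have I: "g \<in> Hom ?K x y"
    if "x \<in> Obj (hofib G H F h)" "y \<in> Obj (hofib G H F h)" "g \<in> Hom (guarded G) (fst x) (fst y)"
      "Comp H (snd y) (fmor F g) = snd x" for g x y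
    using that by (auto simp: mem_Hom_hofib)
  have O: "x \<in> Obj (hofib G H F h)" "y \<in> Obj (hofib G H F h)"
    if "g \<in> Hom ?K x y" for g x y
    using that by auto
  show ?thesis
  proof
    fix x assume x: "x \<in> Obj ?K"
    then have i: "Idn G (fst x) \<in> Hom (guarded G) (fst x) (fst x)"
      using G.idn_hom[of "fst x"] by (simp add: mem_Obj_hofib)
    have "Comp H (snd x) (fmor F (Idn G (fst x))) = snd x"
      using F_idn[OF i] x H.comp_idn[of "snd x" _ h] by (simp add: mem_Obj_hofib)
    then show "Idn ?K x \<in> Hom ?K x x"
      using x i I[of x x] by (simp add: sel_hofib)
  next
    fix f g x y z
    assume f: "f \<in> Hom ?K x y" and g: "g \<in> Hom ?K y z"
    have "Comp H (snd z) (fmor F (Comp G g f)) = snd x"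
      using F_comp[OF E(3)[OF f] E(3)[OF g]] H.comp_assoc[OF F_hom[OF E(3)[OF f]] F_hom[OF E(3)[OF g]] E(1)[OF g]]
        E(4)[OF f] E(4)[OF g] by simp
    then show "Comp ?K g f \<in> Hom ?K x z"
      using I[OF O(1)[OF f] O(2)[OF g]] O(1)[OF f] O(2)[OF g] G.comp_hom[OF E(3)[OF f] E(3)[OF g]] by (simp add: sel_hofib)
  next
    fix f g h' w x y z
    assume f: "f \<in> Hom ?K w x" "g \<in> Hom ?K x y"
      "h' \<in> Hom ?K y z"
    show "Comp ?K h' (Comp ?K g f) =
        Comp ?K (Comp ?K h' g) f"
      using G.comp_assoc[OF f[THEN E(3)]] by (simp add: sel_hofib)
  next
    fix f x y assume f: "f \<in> Hom ?K x y"
    show "Comp ?K f (Idn ?K x) = f"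
      using G.comp_idn[OF E(3)[OF f]] by (simp add: sel_hofib)
    show "Comp ?K (Idn ?K y) f = f"
      using G.idn_comp[OF E(3)[OF f]] by (simp add: sel_hofib)
    obtain g where g: "g \<in> Hom (guarded G) (fst y) (fst x)" "Comp G g f = Idn G (fst x)"
        "Comp G f g = Idn G (fst y)"
      using G.ex_inverse[OF E(3)[OF f]] by auto
    \<comment> \<open>The inverse again lies over \<open>h\<close>: \<open>snd x\<close> is
      \<open>snd y\<close> after the image of \<open>f\<close>, and that image cancels against the
      image of \<open>g\<close>.\<close>
    have "Comp H (snd x) (fmor F g) = Comp H (snd y) (fmor F (Comp G f g))"
      using F_comp[OF g(1) E(3)[OF f]] H.comp_assoc[OF F_hom[OF g(1)] F_hom[OF E(3)[OF f]] E(1)[OF f]]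
        E(4)[OF f] by simp
    also have "\<dots> = snd y"
      using F_idn[OF g(1)] g(3) H.comp_idn[OF E(1)[OF f]] by simp
    finally show "\<exists>g\<in>Hom ?K y x.
        Comp ?K g f = Idn ?K x \<and>
        Comp ?K f g = Idn ?K y"
      using g I[OF O(2)[OF f] O(1)[OF f] g(1)] by (intro bexI[of _ g]) (simp_all add: sel_hofib)
  next
    fix x y
    have "Hom ?K x y \<subseteq> Hom (guarded G) (fst x) (fst y)"
      using E(3) by blast
    then show "finite (Hom ?K x y)"
      using G.finite_hom finite_subset by blast
  qed
qed

text \<open>An arrow of \<open>G\<close> out of \<open>fst x\<close> lifts to exactly one arrow out
  of \<open>x\<close>: the structure map at its target must become \<open>snd x\<close> after
  precomposition with the image of the arrow, and that image is invertible. So passing to a homotopy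
  fibre leaves the weights of objects unchanged.\<close>

lemma card_arrows_from_hofib:
  assumes "lf_groupoid (guarded G)" "lf_groupoid H" "functorial F (guarded G) H"
    and x: "x \<in> Obj (hofib G H F h)"
  shows "card (arrows_from (hofib G H F h) x) = card (arrows_from G (fst x))"
proof -
  interpret G: lf_groupoid "guarded G" by fact
  interpret H: lf_groupoid H by fact
  note F_hom = functorial_hom[OF assms(3)]
  have x': "fst x \<in> Obj G" "snd x \<in> Hom H (fobj F (fst x)) h"
    using x by (simp_all add: mem_Obj_hofib)
  have "bij_betw (apfst fst) (arrows_from (hofib G H F h) x) (arrows_from G (fst x))"
    unfolding bij_betw_def
  proof
    show "inj_on (apfst fst) (arrows_from (hofib G H F h) x)"
    proof (rule inj_onI)
      fix p q assume pq: "p \<in> arrows_from (hofib G H F h) x" "q \<in> arrows_from (hofib G H F h) x"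
        "apfst fst p = apfst fst q"
      obtain y \<phi> f z \<psi> g where e: "p = ((y, \<phi>), f)" "q = ((z, \<psi>), g)" by (metis prod.exhaust)
      have f: "f \<in> Hom (guarded G) (fst x) y"
        using pq x' by (simp add: arrows_from_def e mem_Hom_hofib mem_Obj_hofib)
      have yz: "y = z" "f = g" using pq(3) by (simp_all add: e)
      have "\<phi> \<in> Hom H (fobj F y) h" "\<psi> \<in> Hom H (fobj F y) h"
        "Comp H \<phi> (fmor F f) = Comp H \<psi> (fmor F f)"
        using pq(1,2) by (simp_all add: arrows_from_def e yz mem_Hom_hofib mem_Obj_hofib)
      from H.comp_right_cancel[OF F_hom[OF f] this] show "p = q"
        by (simp add: e yz)
    qed
    show "apfst fst ` arrows_from (hofib G H F h) x = arrows_from G (fst x)"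
    proof
      show "apfst fst ` arrows_from (hofib G H F h) x \<subseteq> arrows_from G (fst x)"
        by (auto simp: arrows_from_def mem_Hom_hofib mem_Obj_hofib)
      show "arrows_from G (fst x) \<subseteq> apfst fst ` arrows_from (hofib G H F h) x"
      proof
        fix p assume p: "p \<in> arrows_from G (fst x)"
        obtain y f where e: "p = (y, f)" by (cases p)
        have f: "f \<in> Hom (guarded G) (fst x) y" using p x' by (simp add: e arrows_from_def)
        obtain \<phi> where "\<phi> \<in> Hom H (fobj F y) h" "Comp H \<phi> (fmor F f) = snd x"
          using H.ex_right_quotient[OF F_hom[OF f] x'(2)] by blast
        then have "((y, \<phi>), f) \<in> arrows_from (hofib G H F h) x"
          using f by (simp add: arrows_from_def mem_Hom_hofib mem_Obj_hofib)
        then show "p \<in> apfst fst ` arrows_from (hofib G H F h) x"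
          unfolding e by (rule rev_image_eqI) simp
      qed
    qed
  qed
  then show ?thesis by (rule bij_betw_same_card)
qed

lemma Obj_hofib_eq:
  assumes "T \<subseteq> Obj G" "\<And>x. x \<in> Obj G \<Longrightarrow> Hom H (fobj F x) h \<noteq> {} \<Longrightarrow> x \<in> T"
  shows "Obj (hofib G H F h) = (SIGMA x:T. Hom H (fobj F x) h)"
  using assms by (force simp: mem_Obj_hofib)

text \<open>Each object \<open>x\<close> occurs in the fibre once for every morphism from its image
  to \<open>h\<close>, always with the weight it has in \<open>G\<close>. The finite set
  \<open>T\<close> collects the objects that occur at all, since \<open>G\<close> itself may have
  infinitely many.\<close>

lemma hcard_hofib:
  assumes "lf_groupoid (guarded G)" "lf_groupoid H" "functorial F (guarded G) H"
    and T: "finite T" "T \<subseteq> Obj G" "\<And>x. x \<in> Obj G \<Longrightarrow> Hom H (fobj F x) h \<noteq> {} \<Longrightarrow> x \<in> T"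
  shows "hcard (hofib G H F h) =
    (\<Sum>x\<in>T. of_nat (card (Hom H (fobj F x) h)) / of_nat (card (arrows_from G x)))"
proof -
  interpret H: lf_groupoid H by fact
  have O: "Obj (hofib G H F h) = (SIGMA x:T. Hom H (fobj F x) h)"
    using T by (intro Obj_hofib_eq)
  have "hcard (hofib G H F h) = (\<Sum>x\<in>Obj (hofib G H F h). 1 / of_nat (card (arrows_from G (fst x))))"
    using T(1) H.finite_hom
    by (subst hcard_eq_sum_arrows[OF lf_groupoid_hofib[OF assms(1-3)]])
      (auto simp: card_arrows_from_hofib[OF assms(1-3)] O)
  also have "\<dots> = (\<Sum>x\<in>T. \<Sum>\<phi>\<in>Hom H (fobj F x) h. 1 / of_nat (card (arrows_from G x)))"
    unfolding O using T(1) H.finite_hom by (subst sum.Sigma) (auto simp: split_def)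
  finally show ?thesis by simp
qed

text \<open>The shape of \<open>Phi\<close>. Taking a second fibre multiplies the number of
  structure maps once more, and the weights still come from \<open>G\<close>.\<close>

lemma hcard_hofib_hofib:
  assumes "lf_groupoid (guarded G)" "lf_groupoid H" "lf_groupoid K"
    and "functorial F (guarded G) H" "functorial E (guarded G) K"
    and T: "finite T" "T \<subseteq> Obj G" "\<And>x. x \<in> Obj G \<Longrightarrow> Hom H (fobj F x) h \<noteq> {} \<Longrightarrow> x \<in> T"
  shows "hcard (hofib (hofib G H F h) K (E \<circ>\<^sub>G hofib_proj) k) =
    (\<Sum>x\<in>T. of_nat (card (Hom H (fobj F x) h) * card (Hom K (fobj E x) k)) / of_nat (card (arrows_from G x)))"
proof -
  interpret H: lf_groupoid H by fact
  note GF = assms(1,2,4)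
  have O: "Obj (hofib G H F h) = (SIGMA x:T. Hom H (fobj F x) h)"
    using T by (intro Obj_hofib_eq)
  have fin: "finite (Obj (hofib G H F h))"
    unfolding O using T(1) H.finite_hom by auto
  have "functorial (E \<circ>\<^sub>G hofib_proj) (guarded (hofib G H F h)) K"
    using assms(5)
    by (auto simp: functorial_def gcomp_def hofib_proj_def mem_Hom_hofib mem_Obj_hofib sel_hofib)
  \<comment> \<open>The fibre over \<open>h\<close> has finitely many objects, so its whole object
    set can serve as the set \<open>T\<close> for the outer fibre.\<close>
  then have "hcard (hofib (hofib G H F h) K (E \<circ>\<^sub>G hofib_proj) k) =
      (\<Sum>x\<in>Obj (hofib G H F h). of_nat (card (Hom K (fobj (E \<circ>\<^sub>G hofib_proj) x) k)) /
        of_nat (card (arrows_from (hofib G H F h) x)))"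
    using fin by (intro hcard_hofib lf_groupoid_hofib GF assms(3)) auto
  also have "\<dots> = (\<Sum>x\<in>Obj (hofib G H F h). of_nat (card (Hom K (fobj E (fst x)) k)) /
        of_nat (card (arrows_from G (fst x))))"
    by (intro sum.cong) (auto simp: card_arrows_from_hofib[OF GF] gcomp_def hofib_proj_def)
  also have "\<dots> = (\<Sum>x\<in>T. \<Sum>\<phi>\<in>Hom H (fobj F x) h. of_nat (card (Hom K (fobj E x) k)) /
        of_nat (card (arrows_from G x)))"
    unfolding O using T(1) H.finite_hom by (subst sum.Sigma) (auto simp: split_def)
  finally show ?thesis by simp
qed

section \<open>Tuples and their permutations\<close>

lemma permutations_of_lessThanD:
  assumes "ps \<in> permutations_of_set {..<n}"
  shows "length ps = n" "set ps = {..<n}" "distinct ps" "i < n \<Longrightarrow> ps ! i < n"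
proof -
  show *: "set ps = {..<n}" "distinct ps"
    using assms by (auto dest: permutations_of_setD)
  show l: "length ps = n"
    using distinct_card[OF *(2)] * by simp
  show "ps ! i < n" if "i < n"
    using nth_mem[of i ps] that l * by simp
qed

lemma permutation_surj:
  assumes "ps \<in> permutations_of_set {..<n}" "p < n"
  obtains i where "i < n" "ps ! i = p"
  using permutations_of_lessThanD[OF assms(1)] assms(2) by (metis in_set_conv_nth lessThan_iff)

lemma permutation_comp:
  assumes "ps \<in> permutations_of_set {..<n}" "qs \<in> permutations_of_set {..<n}"
  shows "map ((!) ps) qs \<in> permutations_of_set {..<n}"
proof (rule permutations_of_setI)
  note p = permutations_of_lessThanD[OF assms(1)] and q = permutations_of_lessThanD[OF assms(2)]
  show "distinct (map ((!) ps) qs)"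
    using p q by (simp add: distinct_map inj_on_def nth_eq_iff_index_eq)
  show "set (map ((!) ps) qs) = {..<n}"
    using p(1,2) q(2) nth_image[of n ps] by (simp add: atLeast0LessThan)
qed

lemma permutation_inverse:
  assumes "ps \<in> permutations_of_set {..<n}"
  obtains qs where "qs \<in> permutations_of_set {..<n}"
    "\<And>i. i < n \<Longrightarrow> qs ! (ps ! i) = i" "\<And>i. i < n \<Longrightarrow> ps ! (qs ! i) = i"
proof -
  note p = permutations_of_lessThanD[OF assms]
  have "\<forall>i. \<exists>j. i < n \<longrightarrow> j < n \<and> ps ! j = i"
    using permutation_surj[OF assms] by metis
  then obtain q where q: "\<And>i. i < n \<Longrightarrow> q i < n \<and> ps ! q i = i" by metis
  have qp: "q (ps ! i) = i" if "i < n" for i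
    using p(1) p(4)[OF that] q[of "ps ! i"] that nth_eq_iff_index_eq[OF p(3), of "q (ps ! i)" i] by simp
  have "map q [0..<n] \<in> permutations_of_set {..<n}"
  proof (rule permutations_of_setI)
    have "inj_on q {..<n}"
      by (rule inj_on_inverseI[of _ "(!) ps"]) (use q in auto)
    then show "distinct (map q [0..<n])"
      by (simp add: distinct_map atLeast0LessThan)
    show "set (map q [0..<n]) = {..<n}"
    proof
      show "{..<n} \<subseteq> set (map q [0..<n])"
      proof
        fix i assume "i \<in> {..<n}"
        then show "i \<in> set (map q [0..<n])"
          using p(4)[of i] qp[of i] by (auto intro!: image_eqI[of _ _ "ps ! i"])
      qed
    qed (use q in auto)
  qed
  then show thesis
    using that[of "map q [0..<n]"] q qp p(4) by simp
qed

section \<open>The groupoid of tuples\<close>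

lemma mem_Hom_Sr:
  "l \<in> Hom (Sr A) as bs \<longleftrightarrow> length l = length as \<and> length bs = length as \<and>
    map fst l \<in> permutations_of_set {..<length as} \<and>
    (\<forall>i<length as. snd (l ! i) \<in> Hom A (as ! fst (l ! i)) (bs ! i))"
  by (auto simp: Sr_def permutations_of_set_def)

lemma Hom_SrD:
  assumes "l \<in> Hom (Sr A) as bs"
  shows "length l = length as" "length bs = length as"
    "map fst l \<in> permutations_of_set {..<length as}"
    "i < length as \<Longrightarrow> fst (l ! i) < length as"
    "i < length as \<Longrightarrow> snd (l ! i) \<in> Hom A (as ! fst (l ! i)) (bs ! i)"
proof -
  show *: "length l = length as" "length bs = length as"
    "map fst l \<in> permutations_of_set {..<length as}"
    "i < length as \<Longrightarrow> snd (l ! i) \<in> Hom A (as ! fst (l ! i)) (bs ! i)"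
    using assms by (auto simp: mem_Hom_Sr)
  show "i < length as \<Longrightarrow> fst (l ! i) < length as"
    using permutations_of_lessThanD(4)[OF *(3), of i] *(1) by simp
qed

lemma length_Comp_Sr: "length (Comp (Sr A) l' l) = length l'"
  by (simp add: Sr_def)

lemma nth_Comp_Sr: "i < length l' \<Longrightarrow> Comp (Sr A) l' l ! i =
    (fst (l ! fst (l' ! i)), Comp A (snd (l' ! i)) (snd (l ! fst (l' ! i))))"
  by (simp add: Sr_def split_def)

lemma Idn_Sr: "length (Idn (Sr A) as) = length as"
    "i < length as \<Longrightarrow> Idn (Sr A) as ! i = (i, Idn A (as ! i))"
  by (simp_all add: Sr_def)

lemma Obj_Sr: "xs \<in> Obj (Sr A) \<longleftrightarrow> xs \<noteq> [] \<and> set xs \<subseteq> Obj A"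
  by (simp add: Sr_def)

lemma lf_groupoid_Sr:
  assumes "lf_groupoid A"
  shows "lf_groupoid (Sr A)"
proof -
  interpret A: lf_groupoid A by fact
  show ?thesis
  proof
    fix as assume as: "as \<in> Obj (Sr A)"
    have "map fst (Idn (Sr A) as) = [0..<length as]"
      by (rule nth_equalityI) (simp_all add: Idn_Sr)
    then show "Idn (Sr A) as \<in> Hom (Sr A) as as"
      using as by (auto simp: mem_Hom_Sr Idn_Sr Obj_Sr permutations_of_set_def subset_code(1) intro!: A.idn_hom)
  next
    fix l l' as bs cs assume l: "l \<in> Hom (Sr A) as bs" and l': "l' \<in> Hom (Sr A) bs cs"
    note h = Hom_SrD[OF l] and h' = Hom_SrD[OF l']
    have "map fst (Comp (Sr A) l' l) = map ((!) (map fst l)) (map fst l')"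
      using h h' by (intro nth_equalityI) (simp_all add: length_Comp_Sr nth_Comp_Sr)
    then have "map fst (Comp (Sr A) l' l) \<in> permutations_of_set {..<length as}"
      using permutation_comp[OF h(3) h'(3)[unfolded h(2)]] by (simp only:)
    moreover have "snd (Comp (Sr A) l' l ! i) \<in> Hom A (as ! fst (Comp (Sr A) l' l ! i)) (cs ! i)"
      if "i < length as" for i
      using that h h' A.comp_hom[OF h(5)[of "fst (l' ! i)"] h'(5)[of i]] by (simp add: nth_Comp_Sr)
    ultimately show "Comp (Sr A) l' l \<in> Hom (Sr A) as cs"
      using h(1,2) h'(1,2) by (simp add: mem_Hom_Sr length_Comp_Sr)
  next
    fix l l' l'' as bs cs ds
    assume l: "l \<in> Hom (Sr A) as bs" and l': "l' \<in> Hom (Sr A) bs cs" and l'': "l'' \<in> Hom (Sr A) cs ds"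
    note h = Hom_SrD[OF l] and h' = Hom_SrD[OF l'] and h'' = Hom_SrD[OF l'']
    show "Comp (Sr A) l'' (Comp (Sr A) l' l) = Comp (Sr A) (Comp (Sr A) l'' l') l"
    proof (rule nth_equalityI)
      fix i assume "i < length (Comp (Sr A) l'' (Comp (Sr A) l' l))"
      then have i: "i < length cs" using h'' by (simp add: length_Comp_Sr)
      define j where "j = fst (l'' ! i)"
      have j: "j < length bs" using h'' h' i by (simp add: j_def)
      define k where "k = fst (l' ! j)"
      have k: "k < length as" using h' h j by (simp add: k_def)
      have "snd (l ! k) \<in> Hom A (as ! fst (l ! k)) (bs ! k)" "snd (l' ! j) \<in> Hom A (bs ! k) (cs ! j)"
        "snd (l'' ! i) \<in> Hom A (cs ! j) (ds ! i)"
        using h(5)[of k] h'(5)[of j] h''(5)[of i] i j k by (simp_all add: j_def k_def)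
      from A.comp_assoc[OF this] show "Comp (Sr A) l'' (Comp (Sr A) l' l) ! i =
          Comp (Sr A) (Comp (Sr A) l'' l') l ! i"
        using i j k h h' h'' by (simp add: nth_Comp_Sr length_Comp_Sr flip: j_def k_def)
    qed (simp add: length_Comp_Sr)
  next
    fix l as bs assume l: "l \<in> Hom (Sr A) as bs"
    note h = Hom_SrD[OF l]
    show "Comp (Sr A) l (Idn (Sr A) as) = l"
      using h by (intro nth_equalityI)
        (simp_all add: length_Comp_Sr nth_Comp_Sr Idn_Sr prod_eq_iff A.comp_idn[OF h(5)])
    show "Comp (Sr A) (Idn (Sr A) bs) l = l"
      using h by (intro nth_equalityI)
        (simp_all add: length_Comp_Sr nth_Comp_Sr Idn_Sr prod_eq_iff A.idn_comp[OF h(5)])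
    let ?n = "length as"
    obtain qs where qs: "qs \<in> permutations_of_set {..<?n}"
        "\<And>i. i < ?n \<Longrightarrow> qs ! fst (l ! i) = i" "\<And>i. i < ?n \<Longrightarrow> fst (l ! (qs ! i)) = i"
      using permutation_inverse[OF h(3)] h(1) permutations_of_lessThanD(4) by (metis nth_map)
    note q = permutations_of_lessThanD[OF qs(1)]
    obtain g where g: "\<And>i. i < ?n \<Longrightarrow> g i \<in> Hom A (bs ! i) (as ! fst (l ! i)) \<and>
        Comp A (g i) (snd (l ! i)) = Idn A (as ! fst (l ! i)) \<and> Comp A (snd (l ! i)) (g i) = Idn A (bs ! i)"
      using A.ex_inverse[OF h(5)] by metis
    \<comment> \<open>Position \<open>i\<close> of the inverse must end at \<open>as ! i\<close>.
      The component of \<open>l\<close> that starts there sits at position \<open>qs ! i\<close>, so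
      its inverse \<open>g (qs ! i)\<close> is placed at position \<open>i\<close>.\<close>
    define l' where "l' = map (\<lambda>p. (p, g p)) qs"
    have len: "length l' = ?n" using q by (simp add: l'_def)
    have nth: "l' ! i = (qs ! i, g (qs ! i))" if "i < ?n" for i using that q by (simp add: l'_def)
    have "map fst l' = qs" by (simp add: l'_def comp_def)
    moreover have "snd (l' ! i) \<in> Hom A (bs ! fst (l' ! i)) (as ! i)" if "i < ?n" for i
      using g[of "qs ! i"] that q(4) qs(3) by (simp add: nth)
    ultimately have "l' \<in> Hom (Sr A) bs as"
      using h(2) qs(1) by (simp add: mem_Hom_Sr len)
    moreover have "Comp (Sr A) l' l = Idn (Sr A) as"
      using g q(4) qs(3) by (intro nth_equalityI) (simp_all add: length_Comp_Sr nth_Comp_Sr Idn_Sr len nth)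
    moreover have "Comp (Sr A) l l' = Idn (Sr A) bs"
      using g qs(2) h(1,2,4) by (intro nth_equalityI) (simp_all add: length_Comp_Sr nth_Comp_Sr Idn_Sr nth)
    ultimately show "\<exists>g\<in>Hom (Sr A) bs as. Comp (Sr A) g l = Idn (Sr A) as \<and> Comp (Sr A) l g = Idn (Sr A) bs"
      by blast
  next
    fix as bs
    define S where "S = {..<length as} \<times> (\<Union>p<length as. \<Union>i<length as. Hom A (as ! p) (bs ! i))"
    have "l \<in> {l. set l \<subseteq> S \<and> length l = length as}" if l: "l \<in> Hom (Sr A) as bs" for l
    proof -
      note h = Hom_SrD[OF l]
      have "l ! i \<in> S" if "i < length as" for i
        using that h(4)[OF that] h(5)[OF that] unfolding S_def mem_Times_iff by blast
      then have "\<forall>x\<in>set l. x \<in> S" by (simp add: all_set_conv_all_nth h(1))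
      then show ?thesis using h(1) by blast
    qed
    moreover have "finite {l. set l \<subseteq> S \<and> length l = length as}"
      by (intro finite_lists_length_eq) (simp add: S_def A.finite_hom)
    ultimately show "finite (Hom (Sr A) as bs)"
      by (metis (no_types, lifting) finite_subset subsetI)
  qed
qed

lemma Sr_fun_sel [simp]: "fobj (Sr_fun F) = map (fobj F)" "fmor (Sr_fun F) = map (apsnd (fmor F))"
  by (simp_all add: Sr_fun_def)

lemma functorial_Sr_fun:
  assumes F: "functorial F A B"
  shows "functorial (Sr_fun F) (Sr A) (Sr B)"
proof (rule functorialI)
  fix as bs l assume l: "l \<in> Hom (Sr A) as bs"
  note h = Hom_SrD[OF l]
  have "map fst (map (apsnd (fmor F)) l) = map fst l" by simp
  then show "fmor (Sr_fun F) l \<in> Hom (Sr B) (fobj (Sr_fun F) as) (fobj (Sr_fun F) bs)"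
    using h functorial_hom[OF F h(5)] unfolding mem_Hom_Sr by simp
next
  fix as bs cs l l' assume l: "l \<in> Hom (Sr A) as bs" and l': "l' \<in> Hom (Sr A) bs cs"
  note h = Hom_SrD[OF l] and h' = Hom_SrD[OF l']
  show "fmor (Sr_fun F) (Comp (Sr A) l' l) = Comp (Sr B) (fmor (Sr_fun F) l') (fmor (Sr_fun F) l)"
  proof (rule nth_equalityI)
    fix i assume "i < length (fmor (Sr_fun F) (Comp (Sr A) l' l))"
    then have i: "i < length bs" using h' by (simp add: length_Comp_Sr)
    then show "fmor (Sr_fun F) (Comp (Sr A) l' l) ! i = Comp (Sr B) (fmor (Sr_fun F) l') (fmor (Sr_fun F) l) ! i"
      using h h' functorial_comp[OF F h(5)[of "fst (l' ! i)"] h'(5)[OF i]]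
      by (simp add: nth_Comp_Sr length_Comp_Sr)
  qed (simp add: length_Comp_Sr)
qed

section \<open>Concatenation and the multiplication of the monad\<close>

lemma nth_concat_block:
  assumes "p < length xss" "j < length (xss ! p)"
  shows "length (concat (take p xss)) + j < length (concat xss)"
    "concat xss ! (length (concat (take p xss)) + j) = xss ! p ! j"
proof -
  have "concat xss = concat (take p xss) @ xss ! p @ concat (drop (Suc p) xss)"
    by (subst id_take_nth_drop[OF assms(1)]) simp
  then show "length (concat (take p xss)) + j < length (concat xss)"
    "concat xss ! (length (concat (take p xss)) + j) = xss ! p ! j"
    using assms(2) by (simp_all add: nth_append)
qed

lemma concat_block_cases:
  assumes "i < length (concat xss)"
  obtains p j where "p < length xss" "j < length (xss ! p)" "i = length (concat (take p xss)) + j"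
proof -
  have "\<exists>p j. p < length xss \<and> j < length (xss ! p) \<and> i = length (concat (take p xss)) + j"
    using assms
  proof (induction xss arbitrary: i)
    case (Cons xs xss)
    show ?case
    proof (cases "i < length xs")
      case True
      then show ?thesis by (intro exI[of _ 0] exI[of _ i]) simp
    next
      case False
      then have "i - length xs < length (concat xss)" using Cons.prems by simp
      from Cons.IH[OF this] obtain p j where "p < length xss" "j < length (xss ! p)"
          "i - length xs = length (concat (take p xss)) + j"
        by blast
      then show ?thesis using False by (intro exI[of _ "Suc p"] exI[of _ j]) auto
    qed
  qed simp
  then show thesis using that by blast
qed

definition mu_mor :: "(nat \<times> (nat \<times> 'm) list) list \<Rightarrow> (nat \<times> 'm) list" where
  "mu_mor L = concat (map (\<lambda>(p, l). map (\<lambda>(j, f). (block_start L p + j, f)) l) L)"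

lemma mu_sel: "fobj mu = concat" "fmor mu = mu_mor"
  by (simp_all add: mu_def mu_mor_def fun_eq_iff)

text \<open>The block tags of \<open>L\<close> form a permutation, and an inner list tagged
  \<open>q\<close> has the length of source block \<open>q\<close>; the lengths with tag below
  \<open>p\<close> therefore add up to the offset of source block \<open>p\<close>.\<close>

lemma block_start_eq:
  assumes L: "L \<in> Hom (Sr (Sr A)) xss yss" and p: "p \<le> length xss"
  shows "block_start L p = length (concat (take p xss))"
proof -
  note h = Hom_SrD[OF L] and s = permutations_of_lessThanD[OF Hom_SrD(3)[OF L]]
  have "length l = length (xss ! q)" if "(q, l) \<in> set L" for q l
  proof -
    obtain i where "i < length L" "L ! i = (q, l)"
      using \<open>(q, l) \<in> set L\<close> by (auto simp: in_set_conv_nth)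
    then show ?thesis
      using h(1) Hom_SrD(1)[OF h(5)[of i]] by simp
  qed
  then have "block_start L p = (\<Sum>q\<leftarrow>map fst L. if q < p then length (xss ! q) else 0)"
    unfolding block_start_def by (auto simp: comp_def intro!: arg_cong[of _ _ sum_list])
  also have "\<dots> = (\<Sum>q<length xss. if q < p then length (xss ! q) else 0)"
    using s(2,3) by (simp only: sum_list_distinct_conv_sum_set)
  also have "\<dots> = (\<Sum>q<p. length (xss ! q))"
    using p by (intro sum.mono_neutral_cong_right) auto
  also have "\<dots> = length (concat (take p xss))"
    using p by (simp add: length_concat sum_list_sum_nth atLeast0LessThan)
  finally show ?thesis .
qed

lemma length_mu:
  assumes L: "L \<in> Hom (Sr (Sr A)) xss yss"
  shows "length (mu_mor L) = length (concat xss)"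
proof -
  note h = Hom_SrD[OF L] and s = permutations_of_lessThanD[OF Hom_SrD(3)[OF L]]
  have "fst x < length xss" if "x \<in> set L" for x
    using that s(2) by auto
  then have "block_start L (length xss) = length (mu_mor L)"
    by (auto simp: block_start_def mu_mor_def length_concat comp_def split_def intro!: arg_cong[of _ _ sum_list])
  then show ?thesis using block_start_eq[OF L, of "length xss"] by simp
qed

text \<open>The multiplication in coordinates (block, offset), in which functoriality becomes a
  direct calculation.\<close>

lemma nth_mu:
  assumes L: "L \<in> Hom (Sr (Sr A)) xss yss" and i: "i < length yss" and j: "j < length (yss ! i)"
  shows "mu_mor L ! (length (concat (take i yss)) + j) =
    (length (concat (take (fst (L ! i)) xss)) + fst (snd (L ! i) ! j), snd (snd (L ! i) ! j))"
proof -
  note h = Hom_SrD[OF L]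
  let ?B = "map (\<lambda>(p, l). map (\<lambda>(j, f). (block_start L p + j, f)) l) L"
  have len: "length (?B ! q) = length (yss ! q)" "length (snd (L ! q)) = length (yss ! q)"
    if "q < length yss" for q
    using that h(1,2) Hom_SrD(1,2)[OF h(5)] by (simp_all add: split_def)
  have "map length (take i ?B) = map length (take i yss)"
    using i h(1,2) len by (intro nth_equalityI) simp_all
  then have "length (concat (take i ?B)) = length (concat (take i yss))"
    by (simp only: length_concat)
  then have "mu_mor L ! (length (concat (take i yss)) + j) = ?B ! i ! j"
    using nth_concat_block(2)[of i ?B j] i j h(1,2) len(1)[OF i] by (simp add: mu_mor_def)
  also have "\<dots> = (block_start L (fst (L ! i)) + fst (snd (L ! i) ! j), snd (snd (L ! i) ! j))"
    using i j h(1,2) len(2)[OF i] by (simp add: split_def)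
  finally show ?thesis
    using block_start_eq[OF L, of "fst (L ! i)"] h(2) h(4)[of i] i by simp
qed

lemma mu_hom:
  assumes L: "L \<in> Hom (Sr (Sr A)) xss yss"
  shows "mu_mor L \<in> Hom (Sr A) (concat xss) (concat yss)"
proof -
  note h = Hom_SrD[OF L]
  let ?N = "length (concat xss)"
  have len: "length (concat yss) = ?N"
  proof -
    have "map length yss = map (length \<circ> snd) L"
      using h Hom_SrD(1,2)[OF h(5)] by (intro nth_equalityI) simp_all
    then show ?thesis
      using length_mu[OF L] by (simp add: length_concat mu_mor_def comp_def split_def)
  qed
  have entry: "fst (mu_mor L ! k) < ?N \<and>
      snd (mu_mor L ! k) \<in> Hom A (concat xss ! fst (mu_mor L ! k)) (concat yss ! k)" if k: "k < ?N" for k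
  proof -
    obtain i j where ij: "i < length yss" "j < length (yss ! i)" "k = length (concat (take i yss)) + j"
      by (rule concat_block_cases[of k yss]) (use k len in simp_all)
    have i: "i < length xss" using ij h by simp
    note h' = Hom_SrD[OF h(5)[OF i]]
    have p: "fst (L ! i) < length xss" and q: "fst (snd (L ! i) ! j) < length (xss ! fst (L ! i))"
      using h(4)[OF i] h'(2) h'(4)[of j] ij(2) by simp_all
    show ?thesis
      using nth_concat_block[OF p q] nth_concat_block[OF ij(1,2)] h'(2) h'(5)[of j] ij
      by (simp add: nth_mu[OF L ij(1,2)])
  qed
  have "{..<?N} \<subseteq> set (map fst (mu_mor L))"
  proof
    fix k assume "k \<in> {..<?N}"
    then have k: "k < ?N" by simp
    obtain p q where pq: "p < length xss" "q < length (xss ! p)" "k = length (concat (take p xss)) + q"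
      by (rule concat_block_cases[OF k])
    obtain i where i: "i < length xss" "fst (L ! i) = p"
      using permutation_surj[OF h(3) pq(1)] h(1) by (metis nth_map)
    note h' = Hom_SrD[OF h(5)[OF i(1)]]
    obtain j where j: "j < length (xss ! p)" "fst (snd (L ! i) ! j) = q"
      using permutation_surj[OF h'(3), of q] h'(1) pq(2) i(2) by (metis nth_map)
    have ij: "i < length yss" "j < length (yss ! i)" using h(2) h'(2) i j by simp_all
    have "fst (mu_mor L ! (length (concat (take i yss)) + j)) = k"
      unfolding nth_mu[OF L ij] using i j pq by simp
    moreover have "length (concat (take i yss)) + j < length (mu_mor L)"
      using nth_concat_block(1)[OF ij] len length_mu[OF L] by simp
    ultimately show "k \<in> set (map fst (mu_mor L))"
      by (metis length_map nth_map nth_mem)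
  qed
  moreover have "\<forall>x\<in>set (mu_mor L). fst x < ?N"
    unfolding all_set_conv_all_nth length_mu[OF L] using entry by simp
  then have "set (map fst (mu_mor L)) \<subseteq> {..<?N}" by auto
  ultimately have s: "set (map fst (mu_mor L)) = {..<?N}" by (rule equalityI[rotated])
  \<comment> \<open>Instead of comparing blocks pairwise, injectivity follows by counting: a list of
    \<open>?N\<close> entries with \<open>?N\<close> different values has no repetition.\<close>
  moreover have "distinct (map fst (mu_mor L))"
    by (rule card_distinct) (simp only: s length_mu[OF L] length_map card_lessThan)
  ultimately show "mu_mor L \<in> Hom (Sr A) (concat xss) (concat yss)"
    using entry len length_mu[OF L] by (simp add: mem_Hom_Sr permutations_of_set_def)
qed

lemma functorial_mu:
  assumes "lf_groupoid A"
  shows "functorial mu (Sr (Sr A)) (Sr A)"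
proof (rule functorialI)
  fix xss yss zss L L' assume L: "L \<in> Hom (Sr (Sr A)) xss yss" and L': "L' \<in> Hom (Sr (Sr A)) yss zss"
  note h = Hom_SrD[OF L] and h' = Hom_SrD[OF L']
  have LL: "Comp (Sr (Sr A)) L' L \<in> Hom (Sr (Sr A)) xss zss"
    by (intro lf_groupoid.comp_hom[OF _ L L'] lf_groupoid_Sr assms)
  have len: "length (mu_mor L') = length (concat zss)"
    using mu_hom[OF L', THEN Hom_SrD(1)] mu_hom[OF L', THEN Hom_SrD(2)] by (simp add: mu_mor_def)
  have "mu_mor (Comp (Sr (Sr A)) L' L) = Comp (Sr A) (mu_mor L') (mu_mor L)"
  proof (rule nth_equalityI)
    show l: "length (mu_mor (Comp (Sr (Sr A)) L' L)) = length (Comp (Sr A) (mu_mor L') (mu_mor L))"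
      using mu_hom[OF LL, THEN Hom_SrD(1)] mu_hom[OF LL, THEN Hom_SrD(2)] len
      by (simp add: mu_mor_def length_Comp_Sr)
    fix k assume "k < length (mu_mor (Comp (Sr (Sr A)) L' L))"
    then have k: "k < length (concat zss)" using l len by (simp add: length_Comp_Sr)
    obtain i j where ij: "i < length zss" "j < length (zss ! i)" "k = length (concat (take i zss)) + j"
      by (rule concat_block_cases[OF k])
    have i: "i < length yss" using ij h' by simp
    note b' = Hom_SrD[OF h'(5)[OF i]]
    define p where "p = fst (L' ! i)"
    define q where "q = fst (snd (L' ! i) ! j)"
    have p: "p < length yss" using h'(4)[OF i] by (simp add: p_def)
    have q: "q < length (yss ! p)" using b'(4)[of j] b'(2) ij(2) by (simp add: p_def q_def)
    have j: "j < length (snd (L' ! i))" using b' ij(2) by simp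
    show "mu_mor (Comp (Sr (Sr A)) L' L) ! k = Comp (Sr A) (mu_mor L') (mu_mor L) ! k"
      using k len h'(1) i j unfolding ij(3)
      by (simp add: nth_Comp_Sr nth_mu[OF LL ij(1,2)] nth_mu[OF L' ij(1,2)] nth_mu[OF L p q]
          flip: p_def q_def)
  qed
  then show "fmor mu (Comp (Sr (Sr A)) L' L) = Comp (Sr A) (fmor mu L') (fmor mu L)"
    by (simp add: mu_sel)
qed (simp add: mu_sel mu_hom)

section \<open>Numbers of arrows between tuples\<close>

lemma card_lists_nth:
  assumes "\<And>i. i < n \<Longrightarrow> finite (C i)"
  shows "finite {ys. length ys = n \<and> (\<forall>i<n. ys ! i \<in> C i)} \<and>
    card {ys. length ys = n \<and> (\<forall>i<n. ys ! i \<in> C i)} = (\<Prod>i<n. card (C i))"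
  using assms
proof (induction n)
  case 0
  have "{ys. length ys = 0 \<and> (\<forall>i<0. ys ! i \<in> C i)} = {[]}" by auto
  then show ?case by simp
next
  case (Suc n)
  let ?S = "\<lambda>n. {ys. length ys = n \<and> (\<forall>i<n. ys ! i \<in> C i)}"
  have "?S (Suc n) = (\<lambda>(ys, y). ys @ [y]) ` (?S n \<times> C n)"
  proof (intro equalityI subsetI)
    fix ys assume ys: "ys \<in> ?S (Suc n)"
    then have "ys \<noteq> []" by auto
    then have "ys = take n ys @ [ys ! n]" "take n ys \<in> ?S n" "ys ! n \<in> C n"
      using ys take_Suc_conv_app_nth[of n ys] by auto
    then show "ys \<in> (\<lambda>(ys, y). ys @ [y]) ` (?S n \<times> C n)" 
      by (intro image_eqI[of _ _ "(take n ys, ys ! n)"]) auto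
  qed (auto simp: nth_append less_Suc_eq)
  moreover have "inj_on (\<lambda>(ys, y). ys @ [y]) (?S n \<times> C n)"
    by (auto simp: inj_on_def)
  ultimately show ?case
    using Suc by (simp add: card_image card_cartesian_product)
qed

text \<open>Hom-sets of \<open>Sr A\<close> and sets of arrows out of a tuple both consist of a
  permutation with a choice at each position; \<open>zip\<close> separates the two ingredients. One
  count serves both.\<close>

lemma card_permutation_lists:
  assumes "\<And>i p. i < n \<Longrightarrow> p < n \<Longrightarrow> finite (C i p)"
  shows "card {l. map fst l \<in> permutations_of_set {..<n} \<and> (\<forall>i<n. snd (l ! i) \<in> C i (fst (l ! i)))} =
    (\<Sum>ps\<in>permutations_of_set {..<n}. \<Prod>i<n. card (C i (ps ! i)))" (is "card ?S = _")
proof -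
  let ?P = "permutations_of_set {..<n}"
  let ?L = "\<lambda>ps. {ys. length ys = n \<and> (\<forall>i<n. ys ! i \<in> C i (ps ! i))}"
  have L: "finite (?L ps)" "card (?L ps) = (\<Prod>i<n. card (C i (ps ! i)))" if "ps \<in> ?P" for ps
    using card_lists_nth[of n "\<lambda>i. C i (ps ! i)"] assms permutations_of_lessThanD(4)[OF that] by auto
  have len: "length l = n" if "map fst l \<in> ?P" for l :: "(nat \<times> 'a) list"
    using permutations_of_lessThanD(1)[OF that] by simp
  have "bij_betw (\<lambda>l. (map fst l, map snd l)) ?S (SIGMA ps:?P. ?L ps)"
  proof (rule bij_betw_byWitness[where f' = "\<lambda>(ps, ys). zip ps ys"])
    show "\<forall>l\<in>?S. (\<lambda>(ps, ys). zip ps ys) (map fst l, map snd l) = l"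
      by (simp add: zip_map_fst_snd)
    show "\<forall>x\<in>SIGMA ps:?P. ?L ps. (map fst ((\<lambda>(ps, ys). zip ps ys) x), map snd ((\<lambda>(ps, ys). zip ps ys) x)) = x"
      by (auto simp: permutations_of_lessThanD(1))
    show "(\<lambda>l. (map fst l, map snd l)) ` ?S \<subseteq> (SIGMA ps:?P. ?L ps)"
      using len by auto
    show "(\<lambda>(ps, ys). zip ps ys) ` (SIGMA ps:?P. ?L ps) \<subseteq> ?S"
      by (auto simp: permutations_of_lessThanD(1))
  qed
  then have "card ?S = card (SIGMA ps:?P. ?L ps)" by (rule bij_betw_same_card)
  also have "\<dots> = (\<Sum>ps\<in>?P. \<Prod>i<n. card (C i (ps ! i)))"
    using L by (subst card_SigmaI) auto
  finally show ?thesis .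
qed

text \<open>The right-hand side is the permanent of the matrix of sizes of hom-sets between
  entries.\<close>

lemma card_Hom_Sr:
  assumes "lf_groupoid A" "length bs = length as"
  shows "card (Hom (Sr A) as bs) =
    (\<Sum>ps\<in>permutations_of_set {..<length as}. \<Prod>i<length as. card (Hom A (as ! (ps ! i)) (bs ! i)))"
proof -
  interpret lf_groupoid A by fact
  have len: "length l = length as" if "map fst l \<in> permutations_of_set {..<length as}"
    for l :: "(nat \<times> 'b) list"
    using permutations_of_lessThanD(1)[OF that] by simp
  have "Hom (Sr A) as bs = {l. map fst l \<in> permutations_of_set {..<length as} \<and>
      (\<forall>i<length as. snd (l ! i) \<in> Hom A (as ! fst (l ! i)) (bs ! i))}"
    using assms(2) len by (auto simp: mem_Hom_Sr)
  then show ?thesis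
    using card_permutation_lists[of "length as" "\<lambda>i p. Hom A (as ! p) (bs ! i)"] finite_hom by simp
qed

text \<open>With the target free, a permutation is chosen first and then, at each position, any
  arrow out of the source entry sent there. The number of choices at the positions is the same
  product for every permutation, whence the factorial.\<close>

lemma card_arrows_from_Sr:
  assumes fin: "\<And>x. x \<in> set xs \<Longrightarrow> finite (arrows_from A x)" and xs: "xs \<noteq> []"
  shows "card (arrows_from (Sr A) xs) = fact (length xs) * (\<Prod>x\<leftarrow>xs. card (arrows_from A x))"
proof -
  let ?n = "length xs"
  let ?S = "{l. map fst l \<in> permutations_of_set {..<?n} \<and>
    (\<forall>i<?n. snd (l ! i) \<in> arrows_from A (xs ! fst (l ! i)))}"
  have "bij_betw (\<lambda>l. (map (fst \<circ> snd) l, map (apsnd snd) l)) ?S (arrows_from (Sr A) xs)"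
  proof (rule bij_betw_byWitness[where f' = "\<lambda>(ys, l). map (\<lambda>(y, (p, f)). (p, (y, f))) (zip ys l)"])
    show "\<forall>l\<in>?S. (\<lambda>(ys, l). map (\<lambda>(y, (p, f)). (p, (y, f))) (zip ys l))
        (map (fst \<circ> snd) l, map (apsnd snd) l) = l"
      by (auto simp: zip_map_map zip_same_conv_map split_def apsnd_def map_prod_def intro!: map_idI)
    show "\<forall>a\<in>arrows_from (Sr A) xs. (map (fst \<circ> snd) ((\<lambda>(ys, l). map (\<lambda>(y, (p, f)). (p, (y, f))) (zip ys l)) a),
        map (apsnd snd) ((\<lambda>(ys, l). map (\<lambda>(y, (p, f)). (p, (y, f))) (zip ys l)) a)) = a"
    proof
      fix a assume a: "a \<in> arrows_from (Sr A) xs"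
      obtain ys l where yl: "a = (ys, l)" by (cases a)
      have "length l = length ys" using a by (simp add: yl arrows_from_def mem_Hom_Sr)
      then have "map (fst \<circ> snd) (map (\<lambda>(y, (p, f)). (p, (y, f))) (zip ys l)) = ys"
        "map (apsnd snd) (map (\<lambda>(y, (p, f)). (p, (y, f))) (zip ys l)) = l"
        by (simp_all add: list_eq_iff_nth_eq split_def)
      then show "(map (fst \<circ> snd) ((\<lambda>(ys, l). map (\<lambda>(y, (p, f)). (p, (y, f))) (zip ys l)) a),
        map (apsnd snd) ((\<lambda>(ys, l). map (\<lambda>(y, (p, f)). (p, (y, f))) (zip ys l)) a)) = a"
        by (simp only: yl prod.case)
    qed
    show "(\<lambda>l. (map (fst \<circ> snd) l, map (apsnd snd) l)) ` ?S \<subseteq> arrows_from (Sr A) xs"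
    proof (rule image_subsetI)
      fix l assume l: "l \<in> ?S"
      have ln: "length l = ?n"
        using l permutations_of_lessThanD(1)[of "map fst l" ?n] by simp
      have "snd (l ! i) \<in> arrows_from A (xs ! fst (l ! i))" if "i < ?n" for i
        using l that by simp
      then have "fst (snd (l ! i)) \<in> Obj A \<and> snd (snd (l ! i)) \<in> Hom A (xs ! fst (l ! i)) (fst (snd (l ! i)))"
        if "i < ?n" for i
        using that by (fastforce simp: arrows_from_def)
      moreover have "map fst (map (apsnd snd) l) = map fst l" by simp
      ultimately show "(map (fst \<circ> snd) l, map (apsnd snd) l) \<in> arrows_from (Sr A) xs"
        using l ln xs by (auto simp: arrows_from_def mem_Hom_Sr Obj_Sr set_conv_nth)
    qed
    show "(\<lambda>(ys, l). map (\<lambda>(y, (p, f)). (p, (y, f))) (zip ys l)) ` arrows_from (Sr A) xs \<subseteq> ?S"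
    proof (rule image_subsetI)
      fix a assume a: "a \<in> arrows_from (Sr A) xs"
      obtain ys l where yl: "a = (ys, l)" by (cases a)
      have l: "l \<in> Hom (Sr A) xs ys" "set ys \<subseteq> Obj A"
        using a by (auto simp: yl arrows_from_def Obj_Sr)
      note h = Hom_SrD[OF l(1)]
      define m where "m = map (\<lambda>(y, (p, f)). (p, (y, f))) (zip ys l)"
      have "map fst m = map fst l"
        using h by (simp add: m_def list_eq_iff_nth_eq split_def)
      then have "map fst m \<in> permutations_of_set {..<?n}"
        using h by simp
      moreover have "snd (m ! i) \<in> arrows_from A (xs ! fst (m ! i))" if "i < ?n" for i
        using h that l(2) by (simp add: m_def split_def arrows_from_def subset_code(1))
      ultimately show "(\<lambda>(ys, l). map (\<lambda>(y, (p, f)). (p, (y, f))) (zip ys l)) a \<in> ?S"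
        by (simp add: yl m_def)
    qed
  qed
  then have "card (arrows_from (Sr A) xs) = card ?S" by (rule bij_betw_same_card[symmetric])
  also have "\<dots> = (\<Sum>ps\<in>permutations_of_set {..<?n}. \<Prod>i<?n. card (arrows_from A (xs ! (ps ! i))))"
    using fin by (intro card_permutation_lists) simp
  also have "\<dots> = (\<Sum>ps\<in>permutations_of_set {..<?n}. \<Prod>x\<leftarrow>xs. card (arrows_from A x))"
  proof (rule sum.cong[OF refl])
    fix ps assume "ps \<in> permutations_of_set {..<?n}"
    note p = permutations_of_lessThanD[OF this]
    have "bij_betw ((!) ps) {..<?n} {..<?n}"
      using bij_betw_nth[OF p(3)] p(1,2) by simp
    then have "(\<Prod>i<?n. card (arrows_from A (xs ! (ps ! i)))) = (\<Prod>i<?n. card (arrows_from A (xs ! i)))"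
      by (rule prod.reindex_bij_betw)
    also have "\<dots> = (\<Prod>x\<leftarrow>xs. card (arrows_from A x))"
      by (simp add: prod.list_conv_set_nth atLeast0LessThan)
    finally show "(\<Prod>i<?n. card (arrows_from A (xs ! (ps ! i)))) = (\<Prod>x\<leftarrow>xs. card (arrows_from A x))" .
  qed
  finally show ?thesis by (simp add: card_permutations_of_set)
qed

section \<open>Words and formal sums\<close>

text \<open>Multisets in the form that exponents and monomials already have, so that one notion
  serves words of colours as well as lists of generators.\<close>

definition content :: "'a list \<Rightarrow> ('a \<Rightarrow>\<^sub>0 nat)" where
  "content xs = (\<Sum>x\<leftarrow>xs. Poly_Mapping.single x 1)"

lemma content_simps [simp]:
  "content [] = 0" "content (x # xs) = Poly_Mapping.single x 1 + content xs"
  "content (xs @ ys) = content xs + content ys"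
  by (simp_all add: content_def)

lemma lookup_content: "Poly_Mapping.lookup (content xs) x = count (mset xs) x"
  by (induction xs) (simp_all add: lookup_add lookup_single when_def)

lemma keys_content [simp]: "Poly_Mapping.keys (content xs) = set xs"
  by (auto simp: in_keys_iff lookup_content count_eq_zero_iff)

lemma content_eq_iff: "content xs = content ys \<longleftrightarrow> mset xs = mset ys"
  by (simp add: poly_mapping_eq_iff multiset_eq_iff fun_eq_iff lookup_content)

lemma content_eq_0_iff [simp]: "content xs = 0 \<longleftrightarrow> xs = []"
  using content_eq_iff[of xs "[]"] by simp

lemma content_surj: "\<exists>xs. content xs = m"
proof -
  obtain xs where xs: "mset xs = (\<Sum>x\<in>Poly_Mapping.keys m. replicate_mset (Poly_Mapping.lookup m x) x)"
    using ex_mset by blast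
  have "count (mset xs) x = Poly_Mapping.lookup m x" for x
    unfolding xs count_sum by (simp add: sum.delta' if_distrib in_keys_iff cong: if_cong)
  then have "content xs = m"
    by (intro poly_mapping_eqI) (simp add: lookup_content)
  then show ?thesis ..
qed

lemma prod_power_content:
  fixes h :: "'a \<Rightarrow> 'b::comm_monoid_mult"
  assumes "finite S" "set xs \<subseteq> S"
  shows "(\<Prod>v\<in>S. h v ^ Poly_Mapping.lookup (content xs) v) = (\<Prod>x\<leftarrow>xs. h x)"
  using assms(2)
proof (induction xs)
  case (Cons x xs)
  have "(\<Prod>v\<in>S. h v ^ Poly_Mapping.lookup (content (x # xs)) v) =
      (\<Prod>v\<in>S. (if v = x then h v else 1) * h v ^ Poly_Mapping.lookup (content xs) v)"
    by (intro prod.cong) (auto simp: lookup_add lookup_single when_def)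
  also have "\<dots> = h x * (\<Prod>v\<in>S. h v ^ Poly_Mapping.lookup (content xs) v)"
    using assms(1) Cons.prems by (simp add: prod.distrib prod.delta)
  finally show ?case using Cons by simp
qed simp

text \<open>The words counted are the rearrangements of \<open>xs\<close>; this is the multinomial
  coefficient with denominators cleared.\<close>

lemma card_content_class:
  "card {ys. content ys = content xs} * (\<Prod>x\<in>set xs. fact (count (mset xs) x)) = fact (length xs)"
proof -
  have "{ys. content ys = content xs} = permutations_of_multiset (mset xs)"
    by (auto simp: content_eq_iff permutations_of_multiset_def)
  then show ?thesis
    using card_permutations_of_multiset_aux[of "mset xs"] by simp
qed

lemma finite_content_class: "finite {ys. content ys = n}"
proof -
  obtain xs where "content xs = n" using content_surj by blast
  then have "{ys. content ys = n} = permutations_of_multiset (mset xs)"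
    by (auto simp: content_eq_iff permutations_of_multiset_def)
  then show ?thesis by simp
qed

lemma content_eqD: "content xs = content ys \<Longrightarrow> length xs = length ys \<and> set xs = set ys"
  by (metis content_eq_iff mset_eq_length mset_eq_setD)

lemma card_content_class_exp_fact:
  "card {ys. content ys = content xs} * exp_fact (content xs) = fact (length xs)"
  using card_content_class[of xs] by (simp add: exp_fact_def lookup_content)

lemma exp_fact_pos: "exp_fact n > 0"
  by (simp add: exp_fact_def prod_pos)

lemma sum_inverse_fact_content_class:
  "(\<Sum>c\<in>{c. content c = n}. 1 / fact (length c)) = (1 / of_nat (exp_fact n) :: rat)"
proof -
  obtain xs where xs: "content xs = n" using content_surj by blast
  have "(\<Sum>c\<in>{c. content c = n}. 1 / fact (length c)) = (\<Sum>c\<in>{c. content c = n}. 1 / fact (length xs) :: rat)"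
    by (intro sum.cong) (auto dest: content_eqD simp: xs[symmetric])
  also have "\<dots> = of_nat (card {c. content c = n}) / of_nat (fact (length xs))"
    by simp
  also have "\<dots> = 1 / of_nat (exp_fact n)"
  proof -
    have *: "card {c. content c = n} \<noteq> 0"
      using xs finite_content_class[of n] by (auto simp: card_eq_0_iff)
    have "fact (length xs) = card {c. content c = n} * exp_fact n"
      using card_content_class_exp_fact[of xs] xs by simp
    then show ?thesis using * by (simp only: of_nat_mult) simp
  qed
  finally show ?thesis .
qed

text \<open>Evaluation, linear extension, relabelling of a basis and tensor products all have this
  form; additivity in the coefficient, proved once, makes all of them commute with sums.\<close>

definition coeff_sum :: "('a \<Rightarrow> 'b::zero \<Rightarrow> 'c::comm_monoid_add) \<Rightarrow> ('a \<Rightarrow>\<^sub>0 'b) \<Rightarrow> 'c" where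
  "coeff_sum g p = (\<Sum>x\<in>Poly_Mapping.keys p. g x (Poly_Mapping.lookup p x))"

definition coeff_additive :: "('a \<Rightarrow> 'b::monoid_add \<Rightarrow> 'c::comm_monoid_add) \<Rightarrow> bool" where
  "coeff_additive g \<longleftrightarrow> (\<forall>x. g x 0 = 0) \<and> (\<forall>x a b. g x (a + b) = g x a + g x b)"

lemma coeff_sum_superset:
  assumes "coeff_additive g" "finite S" "Poly_Mapping.keys p \<subseteq> S"
  shows "coeff_sum g p = (\<Sum>x\<in>S. g x (Poly_Mapping.lookup p x))"
  unfolding coeff_sum_def using assms
  by (intro sum.mono_neutral_left) (auto simp: coeff_additive_def in_keys_iff)

lemma coeff_sum_0 [simp]: "coeff_sum g 0 = 0"
  by (simp add: coeff_sum_def)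

lemma coeff_sum_add:
  fixes p q :: "'a \<Rightarrow>\<^sub>0 'b::comm_monoid_add"
  assumes "coeff_additive g"
  shows "coeff_sum g (p + q) = coeff_sum g p + coeff_sum g q"
proof -
  let ?S = "Poly_Mapping.keys p \<union> Poly_Mapping.keys q"
  have "coeff_sum g (p + q) = (\<Sum>x\<in>?S. g x (Poly_Mapping.lookup (p + q) x))"
    by (intro coeff_sum_superset assms) (simp_all add: keys_add)
  also have "\<dots> = (\<Sum>x\<in>?S. g x (Poly_Mapping.lookup p x)) + (\<Sum>x\<in>?S. g x (Poly_Mapping.lookup q x))"
    using assms by (simp add: coeff_additive_def lookup_add sum.distrib)
  also have "(\<Sum>x\<in>?S. g x (Poly_Mapping.lookup p x)) = coeff_sum g p"
    by (intro coeff_sum_superset[symmetric] assms) simp_all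
  also have "(\<Sum>x\<in>?S. g x (Poly_Mapping.lookup q x)) = coeff_sum g q"
    by (intro coeff_sum_superset[symmetric] assms) simp_all
  finally show ?thesis .
qed

lemma coeff_sum_sum:
  fixes p :: "'i \<Rightarrow> 'a \<Rightarrow>\<^sub>0 'b::comm_monoid_add"
  assumes "coeff_additive g"
  shows "coeff_sum g (\<Sum>i\<in>I. p i) = (\<Sum>i\<in>I. coeff_sum g (p i))"
  by (induction I rule: infinite_finite_induct) (simp_all add: coeff_sum_add[OF assms])

lemma coeff_sum_single:
  assumes "coeff_additive g"
  shows "coeff_sum g (Poly_Mapping.single x c) = g x c"
  using coeff_sum_superset[OF assms, of "{x}" "Poly_Mapping.single x c"] by simp

lemma sum_single_keys: "(\<Sum>x\<in>Poly_Mapping.keys p. Poly_Mapping.single x (Poly_Mapping.lookup p x)) = p"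
proof (rule poly_mapping_eqI)
  fix y
  show "Poly_Mapping.lookup (\<Sum>x\<in>Poly_Mapping.keys p. Poly_Mapping.single x (Poly_Mapping.lookup p x)) y =
      Poly_Mapping.lookup p y"
    by (simp add: lookup_sum lookup_single when_def in_keys_iff)
qed

section \<open>Composition of power series\<close>

text \<open>The two-level trees whose composite has input content \<open>n\<close>, with the root
  left out: its inputs are forced to be \<open>map snd qs\<close>, and its output colour is kept
  apart. The empty list occurs only for \<open>n = 0\<close>.\<close>

definition grafts :: "nat \<Rightarrow> (nat \<Rightarrow>\<^sub>0 nat) \<Rightarrow> (nat list \<times> nat) list set" where
  "grafts k n = {qs. (\<forall>q\<in>set qs. fst q \<noteq> [] \<and> set (fst q) \<subseteq> {1..k} \<and> snd q \<in> {1..k}) \<and>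
     content (concat (map fst qs)) = n}"

definition gen :: "nat list \<times> nat \<Rightarrow> generator" where
  "gen = (\<lambda>(c, i). (i, content c))"

definition graft_weight :: "(nat list \<times> nat) list \<Rightarrow> rat" where
  "graft_weight qs = 1 / (fact (length qs) * (\<Prod>q\<leftarrow>qs. fact (length (fst q))))"

text \<open>The explicit candidate for the comultiplication of a generator. The leaf operations
  stand in the left factor because they name coefficients of the series that are substituted; the
  root names a coefficient of the outer series.\<close>

definition fdb_sum :: "nat \<Rightarrow> generator \<Rightarrow> ((generator \<Rightarrow>\<^sub>0 nat) \<times> (generator \<Rightarrow>\<^sub>0 nat) \<Rightarrow>\<^sub>0 rat)" where
  "fdb_sum k = (\<lambda>(i, n). \<Sum>qs\<in>grafts k n. Poly_Mapping.single
     (content (map gen qs), content [(i, content (map snd qs))]) (of_nat (exp_fact n) * graft_weight qs))"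

lemma length_le_concat:
  "(\<And>xs. xs \<in> set xss \<Longrightarrow> xs \<noteq> []) \<Longrightarrow> length xss \<le> length (concat xss)"
proof (induction xss)
  case (Cons xs xss)
  then have "xs \<noteq> []" "length xss \<le> length (concat xss)" by auto
  moreover from this have "1 \<le> length xs" by (simp add: Suc_le_eq)
  ultimately show ?case by simp
qed simp

lemma length_le_concat_mem: "xs \<in> set xss \<Longrightarrow> length xs \<le> length (concat xss)"
  by (induction xss) auto

lemma graftsD:
  assumes "qs \<in> grafts k (content c)"
  shows "length qs \<le> length c" "q \<in> set qs \<Longrightarrow> length (fst q) \<le> length c"
    "q \<in> set qs \<Longrightarrow> fst q \<noteq> [] \<and> set (fst q) \<subseteq> {1..k} \<and> snd q \<in> {1..k}"
    "content (concat (map fst qs)) = content c"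
proof -
  show *: "q \<in> set qs \<Longrightarrow> fst q \<noteq> [] \<and> set (fst q) \<subseteq> {1..k} \<and> snd q \<in> {1..k}" for q
    using assms by (simp add: grafts_def)
  show "content (concat (map fst qs)) = content c"
    using assms by (simp add: grafts_def)
  then have l: "length (concat (map fst qs)) = length c"
    by (rule content_eqD[THEN conjunct1])
  show "length qs \<le> length c"
    using length_le_concat[of "map fst qs"] * l by fastforce
  show "q \<in> set qs \<Longrightarrow> length (fst q) \<le> length c"
    using length_le_concat_mem[of "fst q" "map fst qs"] l by auto
qed

text \<open>Every operation has at least one leaf, so the number of leaves bounds both the number of
  operations and the length of each leaf word.\<close>

lemma finite_grafts: "finite (grafts k n)"
proof -
  obtain c where c: "content c = n" using content_surj by blast
  let ?W = "{ws. set ws \<subseteq> {1..k} \<and> length ws \<le> length c} \<times> {1..k}"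
  have "grafts k n \<subseteq> {qs. set qs \<subseteq> ?W \<and> length qs \<le> length c}"
  proof
    fix qs assume "qs \<in> grafts k n"
    then have qs: "qs \<in> grafts k (content c)" by (simp add: c)
    have "q \<in> ?W" if "q \<in> set qs" for q
      using graftsD(2,3)[OF qs that] by (simp add: mem_Times_iff)
    then show "qs \<in> {qs. set qs \<subseteq> ?W \<and> length qs \<le> length c}"
      using graftsD(1)[OF qs] by blast
  qed
  moreover have "finite {qs. set qs \<subseteq> ?W \<and> length qs \<le> length c}"
    by (intro finite_lists_length_le finite_cartesian_product) simp_all
  ultimately show ?thesis by (rule finite_subset)
qed

lemma content_mem_exponents_iff: "content c \<in> exponents k \<longleftrightarrow> set c \<subseteq> {1..k}"
  by (simp add: exponents_def)

definition words :: "nat \<Rightarrow> (nat \<Rightarrow>\<^sub>0 nat) \<Rightarrow> nat list set" where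
  "words k n = {c. c \<noteq> [] \<and> set c \<subseteq> {1..k} \<and> content c = n}"

lemma coeff_eq_sum_words:
  assumes F: "F \<in> tuples k" and i: "i \<in> {1..k}"
  shows "coeff (F i) n = (\<Sum>c\<in>words k n. coord (gen (c, i)) F / fact (length c))"
proof (cases "n \<in> exponents k - {0}")
  case True
  then have "c \<noteq> [] \<and> set c \<subseteq> {1..k}" if "content c = n" for c
    using that content_mem_exponents_iff[of c k] by auto
  then have "words k n = {c. content c = n}"
    unfolding words_def by blast
  then have "(\<Sum>c\<in>words k n. coord (gen (c, i)) F / fact (length c)) =
      (\<Sum>c\<in>{c. content c = n}. coord (i, n) F * (1 / fact (length c)))"
    by (intro sum.cong) (auto simp: gen_def)
  also have "\<dots> = coeff (F i) n"
    using exp_fact_pos[of n] unfolding sum_distrib_left[symmetric] sum_inverse_fact_content_class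
    by (simp add: coord_def)
  finally show ?thesis by simp
next
  case False
  then have "c \<notin> words k n" for c
    using content_mem_exponents_iff[of c k] by (auto simp: words_def)
  then have "words k n = {}" by blast
  then show ?thesis
    using F i False by (auto simp: tuples_def)
qed

lemma finite_words: "finite (words k n)"
  by (rule finite_subset[OF _ finite_content_class[of n]]) (auto simp: words_def)

text \<open>Each factor is expanded over words, so a term of the product picks one leaf word per
  factor, and the exponents add up to the content of the concatenation. A term is thus a list of
  operations whose outputs are \<open>es\<close>.\<close>

lemma coeff_prod_list:
  assumes F: "F \<in> tuples k" and "set es \<subseteq> {1..k}"
  shows "coeff (\<Prod>e\<leftarrow>es. F e) n =
    (\<Sum>qs\<in>{qs \<in> grafts k n. map snd qs = es}. \<Prod>q\<leftarrow>qs. coord (gen q) F / fact (length (fst q)))"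
  using assms(2)
proof (induction es arbitrary: n)
  case Nil
  have "{qs \<in> grafts k n. map snd qs = []} = (if n = 0 then {[]} else {})"
    by (auto simp: grafts_def)
  then show ?case by (simp add: one_mseries.rep_eq)
next
  case (Cons e es)
  let ?w = "\<lambda>q. coord (gen q) F / fact (length (fst q))"
  let ?D = "{(a, b). a + b = n}"
  let ?G = "\<lambda>n es. {qs \<in> grafts k n. map snd qs = es}"
  have e: "e \<in> {1..k}" and es: "set es \<subseteq> {1..k}" using Cons.prems by auto
  have "coeff (\<Prod>e\<leftarrow>e # es. F e) n = (\<Sum>x\<in>?D. coeff (F e) (fst x) * coeff (\<Prod>e\<leftarrow>es. F e) (snd x))"
    by (simp add: times_mseries.rep_eq split_def)
  also have "\<dots> = (\<Sum>x\<in>?D. \<Sum>y\<in>words k (fst x) \<times> ?G (snd x) es. ?w (fst y, e) * (\<Prod>q\<leftarrow>snd y. ?w q))"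
    unfolding coeff_eq_sum_words[OF F e] Cons.IH[OF es]
    by (simp add: sum_product sum.cartesian_product split_def)
  also have "\<dots> = (\<Sum>z\<in>(SIGMA x:?D. words k (fst x) \<times> ?G (snd x) es).
      ?w (fst (snd z), e) * (\<Prod>q\<leftarrow>snd (snd z). ?w q))"
    by (subst sum.Sigma) (auto simp: finite_decompositions[unfolded split_def] finite_words finite_grafts split_def)
  also have "\<dots> = (\<Sum>qs\<in>?G n (e # es). \<Prod>q\<leftarrow>qs. ?w q)"
  \<comment> \<open>The splitting \<open>(a, b)\<close> of \<open>n\<close> is redundant:
    \<open>a\<close> is the content of the first leaf word and \<open>b\<close> the content of all
    remaining leaves.\<close>
  proof (rule sum.reindex_bij_witness[where
        i = "\<lambda>qs. ((content (fst (hd qs)), content (concat (map fst (tl qs)))), fst (hd qs), tl qs)" and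
        j = "\<lambda>z. (fst (snd z), e) # snd (snd z)"])
    fix qs assume "qs \<in> ?G n (e # es)"
    then obtain c qs' where qs: "qs = (c, e) # qs'" "map snd qs' = es" "qs \<in> grafts k n"
      by (cases qs) auto
    then show "((content (fst (hd qs)), content (concat (map fst (tl qs)))), fst (hd qs), tl qs) \<in>
        (SIGMA x:?D. words k (fst x) \<times> ?G (snd x) es)"
      by (auto simp: grafts_def words_def)
    show "(\<lambda>z. (fst (snd z), e) # snd (snd z))
        ((content (fst (hd qs)), content (concat (map fst (tl qs)))), fst (hd qs), tl qs) = qs"
      using qs by simp
  next
    fix z assume "z \<in> (SIGMA x:?D. words k (fst x) \<times> ?G (snd x) es)"
    then show "(fst (snd z), e) # snd (snd z) \<in> ?G n (e # es)"
      "((content (fst (hd ((fst (snd z), e) # snd (snd z)))),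
         content (concat (map fst (tl ((fst (snd z), e) # snd (snd z)))))),
        fst (hd ((fst (snd z), e) # snd (snd z))), tl ((fst (snd z), e) # snd (snd z))) = z"
      "(\<Prod>q\<leftarrow>(fst (snd z), e) # snd (snd z). ?w q) = ?w (fst (snd z), e) * (\<Prod>q\<leftarrow>snd (snd z). ?w q)"
      using e by (auto simp: grafts_def words_def)
  qed
  finally show ?case .
qed

lemma coeff_substitute:
  assumes F: "F \<in> tuples k" and G: "G \<in> tuples k" and i: "i \<in> {1..k}"
  shows "coeff (substitute k (G i) F) n = (\<Sum>qs\<in>grafts k n.
    graft_weight qs * (\<Prod>q\<leftarrow>qs. coord (gen q) F) * coord (i, content (map snd qs)) G)"
proof -
  obtain c where c: "content c = n" using content_surj by blast
  define E where "E = {es. set es \<subseteq> {1..k} \<and> length es \<le> length c}"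
  let ?P = "\<lambda>m. \<Prod>j=1..k. F j ^ Poly_Mapping.lookup m j"
  let ?w = "\<lambda>q. coord (gen q) F / fact (length (fst q))"
  have finE: "finite E" unfolding E_def by (intro finite_lists_length_le) simp
  have P: "?P (content es) = (\<Prod>e\<leftarrow>es. F e)" if "set es \<subseteq> {1..k}" for es
    using that by (intro prod_power_content) simp_all
  have E: "qs \<in> grafts k n \<Longrightarrow> map snd qs \<in> E" for qs
    using graftsD[of qs k c] by (auto simp: E_def c)
  \<comment> \<open>Such a monomial either involves foreign variables, where \<open>G i\<close> has
    no coefficient, or is the content of a word longer than \<open>c\<close>; a product of that many
    series without constant term has no term of exponent \<open>n\<close>.\<close>
  have out: "coeff (G i) m * coeff (?P m) n = 0" if "m \<notin> content ` E" for m
  proof (cases "m \<in> exponents k")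
    case True
    obtain es where es: "content es = m" using content_surj by blast
    then have "set es \<subseteq> {1..k}" using True content_mem_exponents_iff[of es k] by simp
    moreover have "{qs \<in> grafts k n. map snd qs = es} = {}"
      using es that E by blast
    ultimately have "coeff (\<Prod>e\<leftarrow>es. F e) n = 0"
      by (simp only: coeff_prod_list[OF F] sum.empty)
    then have "coeff (?P m) n = 0"
      using P[OF \<open>set es \<subseteq> {1..k}\<close>] es by simp
    then show ?thesis by simp
  next
    case False
    then show ?thesis using G i by (auto simp: tuples_def)
  qed
  have "coeff (substitute k (G i) F) n = Sum_any (\<lambda>m. coeff (G i) m * coeff (?P m) n)"
    by (simp add: substitute_def Series_inverse)
  also have "\<dots> = (\<Sum>m\<in>content ` E. coeff (G i) m * coeff (?P m) n)"
    using finE out by (intro Sum_any.expand_superset) auto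
  \<comment> \<open>The monomial \<open>m\<close> is spread over its words. The reciprocal
    factorials of their lengths add up to \<open>1 / exp_fact m\<close>, which cancels the factor
    \<open>exp_fact m\<close> contained in \<open>coord\<close>.\<close>
  also have "\<dots> = (\<Sum>m\<in>content ` E. \<Sum>es\<in>{es \<in> E. content es = m}.
      1 / fact (length es) * coord (i, content es) G * coeff (?P (content es)) n)"
  proof (rule sum.cong[OF refl])
    fix m assume "m \<in> content ` E"
    then obtain es where es: "es \<in> E" "content es = m" by auto
    then have "{es \<in> E. content es = m} = {es. content es = m}"
      by (auto simp: E_def dest: content_eqD)
    then have "(\<Sum>es\<in>{es \<in> E. content es = m}.
        1 / fact (length es) * coord (i, content es) G * coeff (?P (content es)) n) =
      (\<Sum>es\<in>{es. content es = m}. 1 / fact (length es) * (coord (i, m) G * coeff (?P m) n))"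
      by (intro sum.cong) auto
    also have "\<dots> = 1 / of_nat (exp_fact m) * (coord (i, m) G * coeff (?P m) n)"
      unfolding sum_distrib_right[symmetric] sum_inverse_fact_content_class ..
    also have "\<dots> = coeff (G i) m * coeff (?P m) n"
      using exp_fact_pos[of m] by (simp add: coord_def)
    finally show "coeff (G i) m * coeff (?P m) n = (\<Sum>es\<in>{es \<in> E. content es = m}.
        1 / fact (length es) * coord (i, content es) G * coeff (?P (content es)) n)" by simp
  qed
  also have "\<dots> = (\<Sum>es\<in>E. 1 / fact (length es) * coord (i, content es) G * coeff (?P (content es)) n)"
    using finE by (intro sum.group) auto
  also have "\<dots> = (\<Sum>es\<in>E. \<Sum>qs\<in>{qs \<in> grafts k n. map snd qs = es}.
      graft_weight qs * (\<Prod>q\<leftarrow>qs. coord (gen q) F) * coord (i, content (map snd qs)) G)"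
  proof (rule sum.cong[OF refl])
    fix es assume "es \<in> E"
    then have es: "set es \<subseteq> {1..k}" by (simp add: E_def)
    have w: "(\<Prod>q\<leftarrow>qs. ?w q) = (\<Prod>q\<leftarrow>qs. coord (gen q) F) / (\<Prod>q\<leftarrow>qs. fact (length (fst q)))" for qs
      by (induction qs) simp_all
    have "1 / fact (length es) * coord (i, content es) G * coeff (?P (content es)) n =
        (\<Sum>qs\<in>{qs \<in> grafts k n. map snd qs = es}.
          1 / fact (length es) * coord (i, content es) G * (\<Prod>q\<leftarrow>qs. ?w q))"
      unfolding P[OF es] coeff_prod_list[OF F es] sum_distrib_left ..
    also have "\<dots> = (\<Sum>qs\<in>{qs \<in> grafts k n. map snd qs = es}.
      graft_weight qs * (\<Prod>q\<leftarrow>qs. coord (gen q) F) * coord (i, content (map snd qs)) G)"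
      by (intro sum.cong refl) (auto simp: w graft_weight_def)
    finally show "1 / fact (length es) * coord (i, content es) G * coeff (?P (content es)) n =
      (\<Sum>qs\<in>{qs \<in> grafts k n. map snd qs = es}.
        graft_weight qs * (\<Prod>q\<leftarrow>qs. coord (gen q) F) * coord (i, content (map snd qs)) G)" .
  qed
  also have "\<dots> = (\<Sum>qs\<in>grafts k n.
      graft_weight qs * (\<Prod>q\<leftarrow>qs. coord (gen q) F) * coord (i, content (map snd qs)) G)"
    using finE finite_grafts E by (intro sum.group) auto
  finally show ?thesis .
qed

section \<open>Polynomials as functions on tuples of series\<close>

lemma evaluate_content: "evaluate (Poly_Mapping.single (content vs) 1) F = (\<Prod>v\<leftarrow>vs. coord v F)"
  using prod_power_content[of "set vs" vs "\<lambda>v. coord v F"]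
  by (simp add: evaluate_def alg_ext_def)

lemma evaluate2_eq_coeff_sum: "evaluate2 T F G = coeff_sum (\<lambda>(m, m') c. c *
    evaluate (Poly_Mapping.single m 1) F * evaluate (Poly_Mapping.single m' 1) G) T"
  by (simp add: evaluate2_def coeff_sum_def split_def)

lemma coeff_additive_evaluate2: "coeff_additive (\<lambda>(m, m') c. c *
    evaluate (Poly_Mapping.single m 1) F * evaluate (Poly_Mapping.single m' 1) G)"
  by (auto simp: coeff_additive_def algebra_simps)

lemma evaluate2_fdb_sum:
  assumes F: "F \<in> tuples k" and G: "G \<in> tuples k" and i: "i \<in> {1..k}"
  shows "evaluate2 (fdb_sum k (i, n)) F G = coord (i, n) (compose_tuples k G F)"
proof -
  have "evaluate2 (fdb_sum k (i, n)) F G = (\<Sum>qs\<in>grafts k n. of_nat (exp_fact n) *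
      (graft_weight qs * (\<Prod>q\<leftarrow>qs. coord (gen q) F) * coord (i, content (map snd qs)) G))"
    unfolding evaluate2_eq_coeff_sum fdb_sum_def prod.case coeff_sum_sum[OF coeff_additive_evaluate2]
      coeff_sum_single[OF coeff_additive_evaluate2] evaluate_content
    by (simp add: comp_def mult.assoc)
  then show ?thesis
    unfolding sum_distrib_left[symmetric] coeff_substitute[OF assms, symmetric]
    by (simp add: coord_def compose_tuples_def)
qed

text \<open>Artin's argument: multiplying the relation by \<open>\<chi> i y - \<chi> s y\<close> eliminates the
  character \<open>\<chi> s\<close>.\<close>

lemma characters_independent:
  fixes \<chi> :: "'i \<Rightarrow> 'm \<Rightarrow> rat"
  assumes "finite S" and mult: "\<And>i x y. \<chi> i (mul x y) = \<chi> i x * \<chi> i y" and one: "\<And>i. \<chi> i e = 1"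
    and distinct: "\<And>i j. i \<in> S \<Longrightarrow> j \<in> S \<Longrightarrow> i \<noteq> j \<Longrightarrow> \<exists>y. \<chi> i y \<noteq> \<chi> j y"
    and zero: "\<And>x. (\<Sum>i\<in>S. c i * \<chi> i x) = 0"
  shows "\<forall>i\<in>S. c i = 0"
  using assms(1) distinct zero
proof (induction S arbitrary: c rule: finite_induct)
  case (insert s S)
  have c: "c i = 0" if i: "i \<in> S" for i
  proof -
    have "i \<noteq> s" using i insert.hyps by blast
    then obtain y where y: "\<chi> i y \<noteq> \<chi> s y" using insert.prems(1)[of i s] i by blast
    have "\<forall>i\<in>S. c i * (\<chi> i y - \<chi> s y) = 0"
    proof (rule insert.IH)
      fix x
      have "(\<Sum>i\<in>S. c i * (\<chi> i y - \<chi> s y) * \<chi> i x) =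
          (\<Sum>i\<in>insert s S. c i * (\<chi> i y - \<chi> s y) * \<chi> i x)"
        using insert.hyps by simp
      also have "\<dots> = (\<Sum>i\<in>insert s S. c i * \<chi> i (mul y x) - \<chi> s y * (c i * \<chi> i x))"
        by (intro sum.cong refl) (simp add: mult algebra_simps)
      also have "\<dots> = 0"
        unfolding sum_subtractf sum_distrib_left[symmetric] insert.prems(2) by simp
      finally show "(\<Sum>i\<in>S. c i * (\<chi> i y - \<chi> s y) * \<chi> i x) = 0" .
    qed (use insert.prems(1) in blast)
    then show ?thesis using i y by auto
  qed
  moreover have "c s = 0"
    using insert.prems(2)[of e] insert.hyps c by (simp add: one)
  ultimately show ?case by blast
qed simp

text \<open>A tuple on which the generators take the arbitrary prescribed values \<open>h\<close>.
  The generators can thus be varied independently, and an identity of functions on tuples can be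
  tested at every assignment.\<close>

definition tuple_of :: "nat \<Rightarrow> (generator \<Rightarrow> rat) \<Rightarrow> nat \<Rightarrow> mseries" where
  "tuple_of k h = (\<lambda>i. Series (\<lambda>n. if n \<in> exponents k - {0} then h (i, n) / of_nat (exp_fact n) else 0))"

lemma tuple_of_mem: "tuple_of k h \<in> tuples k"
  by (auto simp: tuple_of_def tuples_def Series_inverse split: if_splits)

lemma coord_tuple_of:
  assumes "snd v \<in> exponents k - {0}"
  shows "coord v (tuple_of k h) = h v"
  using assms exp_fact_pos[of "snd v"] by (simp add: coord_def tuple_of_def Series_inverse split_def)

definition monomial_value :: "('v \<Rightarrow>\<^sub>0 nat) \<Rightarrow> ('v \<Rightarrow> rat) \<Rightarrow> rat" where
  "monomial_value m h = (\<Prod>v\<in>Poly_Mapping.keys m. h v ^ Poly_Mapping.lookup m v)"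

lemma evaluate_tuple_of:
  assumes "m \<in> fdb_monomials k"
  shows "evaluate (Poly_Mapping.single m 1) (tuple_of k h) = monomial_value m h"
proof -
  have "snd v \<in> exponents k - {0}" if "v \<in> Poly_Mapping.keys m" for v
    using assms that by (auto simp: fdb_monomials_def)
  then show ?thesis
    by (simp add: evaluate_def alg_ext_def monomial_value_def coord_tuple_of)
qed

lemma monomial_value_separates:
  assumes "m \<noteq> m'"
  shows "\<exists>h. monomial_value m h \<noteq> monomial_value m' h"
proof -
  obtain v where v: "Poly_Mapping.lookup m v \<noteq> Poly_Mapping.lookup m' v"
    using assms by (meson poly_mapping_eqI)
  \<comment> \<open>Assigning 2 to \<open>v\<close> and 1 to all other generators reads off the
    exponent of \<open>v\<close>, since distinct powers of 2 differ.\<close>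
  have "monomial_value m (\<lambda>w. if w = v then 2 else 1) = 2 ^ Poly_Mapping.lookup m v" for m
  proof -
    have "monomial_value m (\<lambda>w. if w = v then 2 else 1) =
        (\<Prod>w\<in>Poly_Mapping.keys m. if w = v then 2 ^ Poly_Mapping.lookup m v else 1)"
      unfolding monomial_value_def by (intro prod.cong) auto
    then show ?thesis by (simp add: prod.delta in_keys_iff)
  qed
  then show ?thesis using v by (intro exI[of _ "\<lambda>w. if w = v then 2 else 1"]) simp
qed

lemma monomial_value_one: "monomial_value m (\<lambda>_. 1) = 1"
  by (simp add: monomial_value_def)

lemma monomial_value_mult: "monomial_value m (\<lambda>v. g v * h v) = monomial_value m g * monomial_value m h"
  by (simp add: monomial_value_def power_mult_distrib prod.distrib)

text \<open>A pair of monomials is a multiplicative function of a pair of assignments, and different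
  pairs are different functions. Independence of characters then forces every coefficient of
  \<open>T\<close> to vanish.\<close>

lemma evaluate2_eq_0D:
  assumes keys: "Poly_Mapping.keys T \<subseteq> fdb_monomials k \<times> fdb_monomials k"
    and zero: "\<And>F G. F \<in> tuples k \<Longrightarrow> G \<in> tuples k \<Longrightarrow> evaluate2 T F G = 0"
  shows "T = 0"
proof -
  let ?\<chi> = "\<lambda>p h. monomial_value (fst p) (fst h) * monomial_value (snd p) (snd h)"
  have "\<forall>p\<in>Poly_Mapping.keys T. Poly_Mapping.lookup T p = 0"
  proof (rule characters_independent[where \<chi> = ?\<chi> and e = "(\<lambda>_. 1, \<lambda>_. 1)" and
        mul = "\<lambda>g h. (\<lambda>v. fst g v * fst h v, \<lambda>v. snd g v * snd h v)"])
    fix p q :: "(generator \<Rightarrow>\<^sub>0 nat) \<times> (generator \<Rightarrow>\<^sub>0 nat)" assume "p \<noteq> q"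
    then consider "fst p \<noteq> fst q" | "snd p \<noteq> snd q" by (auto simp: prod_eq_iff)
    then show "\<exists>h. ?\<chi> p h \<noteq> ?\<chi> q h"
    proof cases
      case 1
      then obtain h where "monomial_value (fst p) h \<noteq> monomial_value (fst q) h"
        using monomial_value_separates by blast
      then show ?thesis by (intro exI[of _ "(h, \<lambda>_. 1)"]) (simp add: monomial_value_one)
    next
      case 2
      then obtain h where "monomial_value (snd p) h \<noteq> monomial_value (snd q) h"
        using monomial_value_separates by blast
      then show ?thesis by (intro exI[of _ "(\<lambda>_. 1, h)"]) (simp add: monomial_value_one)
    qed
  next
    fix h
    have "(\<Sum>p\<in>Poly_Mapping.keys T. Poly_Mapping.lookup T p * ?\<chi> p h) =
        evaluate2 T (tuple_of k (fst h)) (tuple_of k (snd h))"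
      unfolding evaluate2_def using keys
      by (intro sum.cong) (auto simp: evaluate_tuple_of mult.assoc)
    then show "(\<Sum>p\<in>Poly_Mapping.keys T. Poly_Mapping.lookup T p * ?\<chi> p h) = 0"
      by (simp add: zero tuple_of_mem)
  qed (simp_all add: monomial_value_one monomial_value_mult)
  then show ?thesis by (metis in_keys_iff poly_mapping_eqI lookup_zero)
qed

lemma keys_sum_single_subset:
  "Poly_Mapping.keys (\<Sum>i\<in>I. Poly_Mapping.single (f i) (c i)) \<subseteq> f ` I"
  using keys_sum[of "\<lambda>i. Poly_Mapping.single (f i) (c i)" I] by (auto split: if_splits)

lemma keys_fdb_sum:
  assumes "i \<in> {1..k}" "n \<in> exponents k - {0}"
  shows "Poly_Mapping.keys (fdb_sum k (i, n)) \<subseteq> fdb_monomials k \<times> fdb_monomials k"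
proof -
  have "content (map gen qs) \<in> fdb_monomials k \<and> content [(i, content (map snd qs))] \<in> fdb_monomials k"
    if "qs \<in> grafts k n" for qs
  proof -
    obtain c where c: "content c = n" using content_surj by blast
    then have "qs \<noteq> []" using that assms(2) by (auto simp: grafts_def)
    moreover note graftsD(3)[of qs k c]
    ultimately show ?thesis
      using that assms(1) c
      by (fastforce simp: fdb_monomials_def content_mem_exponents_iff gen_def simp del: content_simps(2))
  qed
  then show ?thesis
    unfolding fdb_sum_def prod.case using keys_sum_single_subset by fastforce
qed

text \<open>The composition formula shows that \<open>fdb_sum\<close> satisfies the description. Two
  elements satisfying it differ by one that vanishes as a function, hence by 0.\<close>

lemma fdb_comult_gen_eq:
  assumes "i \<in> {1..k}" "n \<in> exponents k - {0}"
  shows "fdb_comult_gen k (i, n) = fdb_sum k (i, n)"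
  unfolding fdb_comult_gen_def
proof (rule the_equality)
  show *: "Poly_Mapping.keys (fdb_sum k (i, n)) \<subseteq> fdb_monomials k \<times> fdb_monomials k \<and>
      (\<forall>F\<in>tuples k. \<forall>G\<in>tuples k. evaluate2 (fdb_sum k (i, n)) F G = coord (i, n) (compose_tuples k G F))"
    using keys_fdb_sum[OF assms] evaluate2_fdb_sum assms(1) by blast
  fix T assume T: "Poly_Mapping.keys T \<subseteq> fdb_monomials k \<times> fdb_monomials k \<and>
      (\<forall>F\<in>tuples k. \<forall>G\<in>tuples k. evaluate2 T F G = coord (i, n) (compose_tuples k G F))"
  have "T - fdb_sum k (i, n) = 0"
  proof (rule evaluate2_eq_0D)
    show "Poly_Mapping.keys (T - fdb_sum k (i, n)) \<subseteq> fdb_monomials k \<times> fdb_monomials k"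
      using T * keys_diff[of T "fdb_sum k (i, n)"] by blast
    fix F G assume FG: "F \<in> tuples k" "G \<in> tuples k"
    have "evaluate2 (T - fdb_sum k (i, n)) F G + evaluate2 (fdb_sum k (i, n)) F G = evaluate2 T F G"
      unfolding evaluate2_eq_coeff_sum coeff_sum_add[OF coeff_additive_evaluate2, symmetric] by simp
    then show "evaluate2 (T - fdb_sum k (i, n)) F G = 0"
      using T * FG by simp
  qed
  then show "T = fdb_sum k (i, n)" by simp
qed

section \<open>The levels of the bar construction\<close>

text \<open>A morphism between tuples of objects only uses morphisms between objects. Tuples of
  trees thereby inherit the groupoid laws, which for single trees are established on the guarded
  level.\<close>

lemma guarded_Sr: "guarded (Sr A) = guarded (Sr (guarded A))"
proof -
  have "Hom (Sr A) xs ys = Hom (Sr (guarded A)) xs ys" if "xs \<in> Obj (Sr A)" "ys \<in> Obj (Sr A)" for xs ys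
  proof -
    have *: "xs ! p \<in> Obj A" "ys ! i \<in> Obj A" if "p < length xs" "i < length ys" for p i
      using that \<open>xs \<in> Obj (Sr A)\<close> \<open>ys \<in> Obj (Sr A)\<close> by (auto simp: Obj_Sr)
    have "l \<in> Hom (Sr A) xs ys \<longleftrightarrow> l \<in> Hom (Sr (guarded A)) xs ys" for l
    proof
      assume "l \<in> Hom (Sr A) xs ys"
      from Hom_SrD[OF this] * show "l \<in> Hom (Sr (guarded A)) xs ys" by (simp add: mem_Hom_Sr)
    next
      assume "l \<in> Hom (Sr (guarded A)) xs ys"
      then show "l \<in> Hom (Sr A) xs ys" by (simp add: mem_Hom_Sr)
    qed
    then show ?thesis by blast
  qed
  moreover have "Obj (Sr (guarded A)) = Obj (Sr A)" by (simp add: Sr_def)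
  ultimately have "Hom (guarded (Sr A)) = Hom (guarded (Sr (guarded A)))"
    by (simp add: guarded_def fun_eq_iff)
  then show ?thesis
    by (simp add: guarded_def Sr_def)
qed

text \<open>Each level of the bar construction wraps known data in tree constructors;
  \<open>ob\<close> and \<open>mo\<close> are these wrappers on objects and morphisms.\<close>

lemma lf_groupoid_transport:
  assumes A: "lf_groupoid A" and ob: "inj ob"
    and O: "\<And>x. x \<in> Obj G \<Longrightarrow> x \<in> ob ` Obj A"
    and H: "\<And>f x y. f \<in> Hom G x y \<longleftrightarrow> (\<exists>c d g. x = ob c \<and> y = ob d \<and> f = mo g \<and> g \<in> Hom A c d)"
    and C: "\<And>f g. Comp G (mo g) (mo f) = mo (Comp A g f)"
    and I: "\<And>c. Idn G (ob c) = mo (Idn A c)"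
  shows "lf_groupoid G"
proof -
  interpret A: lf_groupoid A by fact
  have ob_eq: "ob c = ob d \<longleftrightarrow> c = d" for c d using ob by (auto dest: injD)
  show ?thesis
  proof
    fix x assume "x \<in> Obj G"
    then obtain c where "x = ob c" "c \<in> Obj A" using O by blast
    then show "Idn G x \<in> Hom G x x" using A.idn_hom[of c] by (auto simp: H I)
  next
    fix f g x y z assume "f \<in> Hom G x y" "g \<in> Hom G y z"
    then obtain c d e f' g' where "x = ob c" "y = ob d" "z = ob e" "f = mo f'" "g = mo g'"
        "f' \<in> Hom A c d" "g' \<in> Hom A d e"
      by (auto simp: H ob_eq)
    then show "Comp G g f \<in> Hom G x z" using A.comp_hom[of f' c d g' e] by (auto simp: H C)
  next
    fix f g h w x y z assume "f \<in> Hom G w x" "g \<in> Hom G x y" "h \<in> Hom G y z"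
    then obtain b c d e f' g' h' where "f = mo f'" "g = mo g'" "h = mo h'"
        "f' \<in> Hom A b c" "g' \<in> Hom A c d" "h' \<in> Hom A d e"
      by (auto simp: H ob_eq)
    then show "Comp G h (Comp G g f) = Comp G (Comp G h g) f"
      using A.comp_assoc[of f' b c g' d h' e] by (simp add: C)
  next
    fix f x y assume "f \<in> Hom G x y"
    then obtain c d f' where f: "x = ob c" "y = ob d" "f = mo f'" "f' \<in> Hom A c d"
      by (auto simp: H)
    show "Comp G f (Idn G x) = f" using A.comp_idn[OF f(4)] by (simp add: f(1-3) C I)
    show "Comp G (Idn G y) f = f" using A.idn_comp[OF f(4)] by (simp add: f(1-3) C I)
    obtain g where "g \<in> Hom A d c" "Comp A g f' = Idn A c" "Comp A f' g = Idn A d"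
      using A.ex_inverse[OF f(4)] by blast
    then show "\<exists>g\<in>Hom G y x. Comp G g f = Idn G x \<and> Comp G f g = Idn G y"
      by (intro bexI[of _ "mo g"]) (auto simp: f(1-3) C I H)
  next
    fix x y
    show "finite (Hom G x y)"
    proof (cases "x \<in> range ob \<and> y \<in> range ob")
      case True
      then obtain c d where "x = ob c" "y = ob d" by blast
      then have "Hom G x y \<subseteq> mo ` Hom A c d" by (auto simp: H ob_eq)
      then show ?thesis using A.finite_hom finite_surj by blast
    next
      case False
      then have "f \<notin> Hom G x y" for f by (auto simp: H)
      then have "Hom G x y = {}" by blast
      then show ?thesis by simp
    qed
  qed
qed

text \<open>The strict fibre product of two functors is the equalizer of their composites with the
  projections of the product; trees with two levels arise in this way.\<close>

definition equalizer :: "('o, 'm, 'p, 'n) gfun \<Rightarrow> ('o, 'm, 'p, 'n) gfun \<Rightarrow> ('o, 'm) groupoid \<Rightarrow>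
    ('o, 'm) groupoid" where
  "equalizer E F G = G\<lparr>Obj := {x \<in> Obj G. fobj E x = fobj F x},
     Hom := (\<lambda>x y. {f \<in> Hom G x y. fmor E f = fmor F f})\<rparr>"

lemma sel_equalizer [simp]:
  "x \<in> Obj (equalizer E F G) \<longleftrightarrow> x \<in> Obj G \<and> fobj E x = fobj F x"
  "f \<in> Hom (equalizer E F G) x y \<longleftrightarrow> f \<in> Hom G x y \<and> fmor E f = fmor F f"
  "Comp (equalizer E F G) = Comp G" "Idn (equalizer E F G) = Idn G"
  by (simp_all add: equalizer_def)

lemma lf_groupoid_equalizer:
  assumes "lf_groupoid G" "lf_groupoid H" and E: "functorial E G H" and F: "functorial F G H"
  shows "lf_groupoid (guarded (equalizer E F G))"
proof -
  interpret G: lf_groupoid G by fact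
  interpret H: lf_groupoid H by fact
  let ?K = "guarded (equalizer E F G)"
  have sel: "Comp ?K = Comp G" "Idn ?K = Idn G" "x \<in> Obj ?K \<longleftrightarrow> x \<in> Obj G \<and> fobj E x = fobj F x"
    "f \<in> Hom ?K x y \<longleftrightarrow> x \<in> Obj G \<and> fobj E x = fobj F x \<and> y \<in> Obj G \<and> fobj E y = fobj F y \<and>
      f \<in> Hom G x y \<and> fmor E f = fmor F f" for x y f
    by auto
  show ?thesis
  proof
    fix x assume "x \<in> Obj ?K"
    then have x: "x \<in> Obj G" "fobj E x = fobj F x" by (simp_all add: sel)
    show "Idn ?K x \<in> Hom ?K x x"
      using x G.idn_hom[OF x(1)] functorial_idn[OF E assms(1,2) G.idn_hom[OF x(1)]]
        functorial_idn[OF F assms(1,2) G.idn_hom[OF x(1)]] by (simp add: sel)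
  next
    fix f g x y z assume f: "f \<in> Hom ?K x y" and g: "g \<in> Hom ?K y z"
    then have *: "f \<in> Hom G x y" "g \<in> Hom G y z" by (simp_all add: sel)
    show "Comp ?K g f \<in> Hom ?K x z"
      using f g functorial_comp[OF E *] functorial_comp[OF F *] G.comp_hom[OF *] by (simp add: sel)
  next
    fix f g h w x y z assume "f \<in> Hom ?K w x" "g \<in> Hom ?K x y" "h \<in> Hom ?K y z"
    then show "Comp ?K h (Comp ?K g f) = Comp ?K (Comp ?K h g) f"
      using G.comp_assoc[of f w x g y h z] by (simp add: sel)
  next
    fix f x y assume "f \<in> Hom ?K x y"
    then have f: "f \<in> Hom G x y" "fmor E f = fmor F f" "x \<in> Obj G" "fobj E x = fobj F x"
        "y \<in> Obj G" "fobj E y = fobj F y" by (simp_all add: sel)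
    show "Comp ?K f (Idn ?K x) = f" "Comp ?K (Idn ?K y) f = f"
      using G.comp_idn[OF f(1)] G.idn_comp[OF f(1)] by (simp_all add: sel)
    obtain g where g: "g \<in> Hom G y x" "Comp G g f = Idn G x" "Comp G f g = Idn G y"
      using G.ex_inverse[OF f(1)] by blast
    \<comment> \<open>Why inverses stay in the equalizer: the images of \<open>g\<close> under
      \<open>E\<close> and \<open>F\<close> are both left inverse to the common image of
      \<open>f\<close>, so cancellation identifies them.\<close>
    have "Comp H (fmor E g) (fmor E f) = Idn H (fobj E x)"
      using functorial_comp[OF E f(1) g(1)] functorial_idn[OF E assms(1,2) f(1)] g(2) by simp
    moreover have "Comp H (fmor F g) (fmor E f) = Idn H (fobj E x)"
      using functorial_comp[OF F f(1) g(1)] functorial_idn[OF F assms(1,2) f(1)] g(2) f(2,4) by simp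
    moreover have "fmor F g \<in> Hom H (fobj E y) (fobj E x)"
      using functorial_hom[OF F g(1)] f by simp
    ultimately have "fmor E g = fmor F g"
      using H.comp_right_cancel[OF functorial_hom[OF E f(1)] functorial_hom[OF E g(1)]] by simp
    then show "\<exists>g\<in>Hom ?K y x. Comp ?K g f = Idn ?K x \<and> Comp ?K f g = Idn ?K y"
      using f g by (intro bexI[of _ g]) (simp_all add: sel)
  next
    fix x y
    have "Hom ?K x y \<subseteq> Hom G x y" by (auto simp: sel)
    then show "finite (Hom ?K x y)" using G.finite_hom finite_subset by blast
  qed
qed

text \<open>An operad only needs a composition on the fibre product over the tuples of colours; the last
  assumption asks for an extension to the whole product, which \<open>Sym_operad\<close> has.\<close>

locale operad_functors =
  fixes Q :: "('c, 'cm, 'q, 'qm) operad"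
  assumes colours: "lf_groupoid (colours Q)" and ops: "lf_groupoid (ops Q)"
    and src: "functorial (src Q) (ops Q) (Sr (colours Q))"
    and tgt: "functorial (tgt Q) (ops Q) (colours Q)"
    and unt: "functorial (unt Q) (colours Q) (ops Q)"
    and cmp: "functorial (cmp Q) (gprod (Sr (ops Q)) (ops Q)) (ops Q)"

section \<open>Low levels and the functoriality of their faces and degeneracies\<close>

lemma level_0_sel:
  "x \<in> Obj (level Q 0) \<longleftrightarrow> x \<in> Colour ` Obj (colours Q)"
  "f \<in> Hom (level Q 0) x y \<longleftrightarrow>
    (\<exists>c d g. x = Colour c \<and> y = Colour d \<and> f = ColourM g \<and> g \<in> Hom (colours Q) c d)"
  "Comp (level Q 0) (ColourM h) (ColourM g) = ColourM (Comp (colours Q) h g)"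
  "Idn (level Q 0) (Colour c) = ColourM (Idn (colours Q) c)"
  by (auto split: ltree.splits)

lemma level_1_sel:
  "x \<in> Obj (level Q (Suc 0)) \<longleftrightarrow> x \<in> Oper ` Obj (ops Q)"
  "f \<in> Hom (level Q (Suc 0)) x y \<longleftrightarrow>
    (\<exists>p q g. x = Oper p \<and> y = Oper q \<and> f = OperM g \<and> g \<in> Hom (ops Q) p q)"
  "Comp (level Q (Suc 0)) (OperM h) (OperM g) = OperM (Comp (ops Q) h g)"
  "Idn (level Q (Suc 0)) (Oper q) = OperM (Idn (ops Q) q)"
  by (auto split: ltree.splits)

lemma level_2_sel:
  "x \<in> Obj (level Q (Suc (Suc 0))) \<longleftrightarrow> (\<exists>qs r. x = Graft qs r \<and> qs \<in> Obj (Sr (level Q (Suc 0))) \<and>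
     r \<in> Obj (ops Q) \<and> map (fobj (out Q)) qs = fobj (src Q) r)"
  "f \<in> Hom (level Q (Suc (Suc 0))) x y \<longleftrightarrow> (\<exists>qs r qs' r' l g. x = Graft qs r \<and> y = Graft qs' r' \<and>
     f = GraftM l g \<and> l \<in> Hom (Sr (level Q (Suc 0))) qs qs' \<and> g \<in> Hom (ops Q) r r' \<and>
     map (apsnd (fmor (out Q))) l = fmor (src Q) g)"
  "Comp (level Q (Suc (Suc 0))) (GraftM l' g') (GraftM l g) =
     GraftM (Comp (Sr (level Q (Suc 0))) l' l) (Comp (ops Q) g' g)"
  "Idn (level Q (Suc (Suc 0))) (Graft qs r) = GraftM (Idn (Sr (level Q (Suc 0))) qs) (Idn (ops Q) r)"
  by (auto simp: Let_def split: ltree.splits)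

declare level.simps [simp del]

lemma out_sel [simp]:
  "fobj (out Q) (Colour c) = c" "fobj (out Q) (Oper q) = fobj (tgt Q) q"
  "fmor (out Q) (ColourM f) = f" "fmor (out Q) (OperM g) = fmor (tgt Q) g"
  by (simp_all add: out_def)

lemma root_op_sel [simp]:
  "fobj (root_op Q) (Oper q) = q" "fobj (root_op Q) (Graft qs r) = r"
  "fmor (root_op Q) (OperM g) = g" "fmor (root_op Q) (GraftM l g) = g"
  by (simp_all add: root_op_def)

lemma branches_Graft [simp]:
  "fobj (branches Q) (Graft qs r) = qs" "fmor (branches Q) (GraftM l g) = l"
  by (simp_all add: branches_def)

lemma tree_face_2_0: "tree_face Q (Suc (Suc 0)) 0 =
    \<lparr>fobj = Oper \<circ> fobj (root_op Q), fmor = OperM \<circ> fmor (root_op Q)\<rparr>"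
  by simp

lemma tree_face_2_1_Graft:
  "fobj (tree_face Q (Suc (Suc 0)) (Suc 0)) (Graft qs r) =
    Oper (fobj (cmp Q) (map (fobj (root_op Q)) qs, r))"
  "fmor (tree_face Q (Suc (Suc 0)) (Suc 0)) (GraftM l g) =
    OperM (fmor (cmp Q) (map (apsnd (fmor (root_op Q))) l, g))"
  by simp_all

declare tree_face.simps [simp del] tree_degen.simps [simp del]

context operad_functors
begin

lemma lf_groupoid_level_0: "lf_groupoid (level Q 0)"
  by (rule lf_groupoid_transport[OF colours, where ob = Colour and mo = ColourM])
    (simp_all add: level_0_sel inj_on_def)

lemma lf_groupoid_level_1: "lf_groupoid (level Q (Suc 0))"
  by (rule lf_groupoid_transport[OF ops, where ob = Oper and mo = OperM])
    (simp_all add: level_1_sel inj_on_def)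

lemma functorial_out_0: "functorial (out Q) (level Q 0) (colours Q)"
  by (rule functorialI) (auto simp: level_0_sel)

lemma functorial_out_1: "functorial (out Q) (level Q (Suc 0)) (colours Q)"
proof (rule functorialI)
  fix x y f assume "f \<in> Hom (level Q (Suc 0)) x y"
  then show "fmor (out Q) f \<in> Hom (colours Q) (fobj (out Q) x) (fobj (out Q) y)"
    using functorial_hom[OF tgt] by (auto simp: level_1_sel)
next
  fix x y z f g assume "f \<in> Hom (level Q (Suc 0)) x y" "g \<in> Hom (level Q (Suc 0)) y z"
  then show "fmor (out Q) (Comp (level Q (Suc 0)) g f) = Comp (colours Q) (fmor (out Q) g) (fmor (out Q) f)"
    using functorial_comp[OF tgt] by (auto simp: level_1_sel)
qed

lemma functorial_root_op_1: "functorial (root_op Q) (level Q (Suc 0)) (ops Q)"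
  by (rule functorialI) (auto simp: level_1_sel)

lemma functorial_root_op_2: "functorial (root_op Q) (level Q (Suc (Suc 0))) (ops Q)"
  by (rule functorialI) (auto simp: level_2_sel)

lemma functorial_branches_2: "functorial (branches Q) (level Q (Suc (Suc 0))) (Sr (level Q (Suc 0)))"
  by (rule functorialI) (auto simp: level_2_sel)

lemma functorial_Oper: "functorial \<lparr>fobj = Oper, fmor = OperM\<rparr> (ops Q) (level Q (Suc 0))"
  by (rule functorialI) (auto simp: level_1_sel)

lemma functorial_tree_face_2_0: "functorial (tree_face Q (Suc (Suc 0)) 0) (level Q (Suc (Suc 0))) (level Q (Suc 0))"
  using functorial_gcomp[OF functorial_root_op_2 functorial_Oper] by (simp add: tree_face_2_0 gcomp_def)

lemma functorial_tree_face_2_1: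
  "functorial (tree_face Q (Suc (Suc 0)) (Suc 0)) (level Q (Suc (Suc 0))) (level Q (Suc 0))"
proof -
  let ?d = "tree_face Q (Suc (Suc 0)) (Suc 0)"
  let ?L1 = "level Q (Suc 0)" and ?L2 = "level Q (Suc (Suc 0))"
  have R: "functorial (Sr_fun (root_op Q)) (Sr ?L1) (Sr (ops Q))"
    by (rule functorial_Sr_fun[OF functorial_root_op_1])
  let ?E = "gpair (Sr_fun (root_op Q) \<circ>\<^sub>G branches Q) (root_op Q)"
  have E: "functorial (\<lparr>fobj = Oper, fmor = OperM\<rparr> \<circ>\<^sub>G (cmp Q \<circ>\<^sub>G ?E)) ?L2 ?L1"
    by (intro functorial_gcomp[OF _ functorial_Oper] functorial_gcomp[OF _ cmp] functorial_gpair
      functorial_gcomp[OF functorial_branches_2 R] functorial_root_op_2)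
  \<comment> \<open>The face map is \<open>undefined\<close> off \<open>Graft\<close>, so it is not
    equal to the composite functor constructed above. All morphisms of this level run between
    grafts, where the two agree; only the values of the composite there are kept.\<close>
  obtain F where F: "functorial F ?L2 ?L1"
    and "\<And>qs r. fobj F (Graft qs r) = Oper (fobj (cmp Q) (map (fobj (root_op Q)) qs, r))"
      "\<And>l g. fmor F (GraftM l g) = OperM (fmor (cmp Q) (map (apsnd (fmor (root_op Q))) l, g))"
    using that[OF E] by (simp add: gcomp_def gpair_def)
  then have eq: "fobj ?d (Graft qs r) = fobj F (Graft qs r)"
      "fmor ?d (GraftM l g) = fmor F (GraftM l g)" for qs r l g
    by (simp_all add: tree_face_2_1_Graft)
  show ?thesis
  proof (rule functorialI)
    fix x y f assume f: "f \<in> Hom ?L2 x y"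
    then show "fmor ?d f \<in> Hom ?L1
        (fobj ?d x) (fobj ?d y)"
      using functorial_hom[OF F f] by (auto simp: level_2_sel(2) eq)
  next
    fix x y z f g assume fg: "f \<in> Hom ?L2 x y" "g \<in> Hom ?L2 y z"
    then show "fmor ?d (Comp ?L2 g f) =
        Comp ?L1 (fmor ?d g) (fmor ?d f)"
      using functorial_comp[OF F fg] by (auto simp: level_2_sel(2,3) eq)
  qed
qed

lemma functorial_tree_degen_0: "functorial (tree_degen Q 0 0) (level Q 0) (level Q (Suc 0))"
  using functorial_gcomp[OF functorial_gcomp[OF functorial_out_0 unt] functorial_Oper]
  by (simp add: gcomp_def tree_degen.simps o_assoc)

lemma lf_groupoid_level_2: "lf_groupoid (guarded (level Q (Suc (Suc 0))))"
proof -
  let ?P = "gprod (Sr (level Q (Suc 0))) (ops Q)"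
  \<comment> \<open>\<open>?E\<close> reads the outputs of the leaf operations and \<open>?F\<close>
    the inputs of the root; a tree is a pair on which they agree.\<close>
  let ?E = "\<lparr>fobj = map (fobj (out Q)) \<circ> fst, fmor = map (apsnd (fmor (out Q))) \<circ> fst\<rparr>"
  let ?F = "\<lparr>fobj = fobj (src Q) \<circ> snd, fmor = fmor (src Q) \<circ> snd\<rparr>"
  have E: "functorial ?E ?P (Sr (colours Q))"
    using functorial_Sr_fun[OF functorial_out_1] by (auto simp: functorial_def)
  have F: "functorial ?F ?P (Sr (colours Q))"
    using src by (auto simp: functorial_def)
  note G = lf_groupoid_equalizer[OF lf_groupoid_gprod[OF lf_groupoid_Sr[OF lf_groupoid_level_1] ops]
      lf_groupoid_Sr[OF colours] E F]
  show ?thesis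
  proof (rule lf_groupoid_transport[OF G, where ob = "\<lambda>(qs, r). Graft qs r" and mo = "\<lambda>(l, g). GraftM l g"])
    show "inj (\<lambda>(qs, r). Graft qs r)" by (auto simp: inj_on_def)
    show "x \<in> (\<lambda>(qs, r). Graft qs r) ` Obj (guarded (equalizer ?E ?F ?P))"
      if "x \<in> Obj (guarded (level Q (Suc (Suc 0))))" for x
      using that by (auto simp: level_2_sel)
    show "f \<in> Hom (guarded (level Q (Suc (Suc 0)))) x y \<longleftrightarrow> (\<exists>c d g. x = (case c of (qs, r) \<Rightarrow> Graft qs r) \<and>
        y = (case d of (qs, r) \<Rightarrow> Graft qs r) \<and> f = (case g of (l, g) \<Rightarrow> GraftM l g) \<and>
        g \<in> Hom (guarded (equalizer ?E ?F ?P)) c d)" for f x y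
      by (simp add: level_2_sel split_paired_Ex) blast
  qed (auto simp: level_2_sel)
qed

end

section \<open>Counting arrows\<close>

lemma mset_permuted:
  assumes "ps \<in> permutations_of_set {..<length xs}"
  shows "mset (map ((!) xs) ps) = mset xs"
proof -
  have "mset ps = mset_set {..<length xs}"
    using permutations_of_lessThanD(2,3)[OF assms] mset_set_set[of ps] by simp
  then have "mset (map ((!) xs) ps) = image_mset ((!) xs) (mset_set {..<length xs})"
    by simp
  also have "\<dots> = image_mset ((!) xs) (mset [0..<length xs])"
    by (simp add: atLeast0LessThan)
  also have "\<dots> = mset (map ((!) xs) [0..<length xs])"
    by (rule mset_map[symmetric])
  also have "\<dots> = mset xs"
    by (rule arg_cong[OF map_nth])
  finally show ?thesis .
qed

text \<open>If \<open>h\<close> is a complete isomorphism invariant of the entries, then the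
  multiset of its values is one for tuples: equal multisets provide a permutation matching
  isomorphic entries, and a morphism of tuples is such a matching.\<close>

lemma Hom_Sr_nonempty_iff:
  assumes A: "\<And>x y. x \<in> set xs \<Longrightarrow> y \<in> set ys \<Longrightarrow> Hom A x y \<noteq> {} \<longleftrightarrow> h x = h y"
  shows "Hom (Sr A) xs ys \<noteq> {} \<longleftrightarrow> content (map h xs) = content (map h ys)"
proof
  assume "Hom (Sr A) xs ys \<noteq> {}"
  then obtain l where l: "l \<in> Hom (Sr A) xs ys" by blast
  note H = Hom_SrD[OF l]
  have "h (xs ! fst (l ! i)) = h (ys ! i)" if "i < length xs" for i
    using A[of "xs ! fst (l ! i)" "ys ! i"] H(5)[OF that] H(2) H(4)[OF that] that by auto
  then have "map ((!) (map h xs)) (map fst l) = map h ys"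
    using H(1,2,4) by (simp add: list_eq_iff_nth_eq)
  moreover have "mset (map ((!) (map h xs)) (map fst l)) = mset (map h xs)"
    using H(3) by (intro mset_permuted) simp
  ultimately show "content (map h xs) = content (map h ys)"
    by (simp only: content_eq_iff)
next
  assume "content (map h xs) = content (map h ys)"
  then have m: "mset (map h ys) = mset (map h xs)" by (simp add: content_eq_iff)
  then have len: "length ys = length xs" using mset_eq_length by fastforce
  obtain p where p: "p permutes {..<length (map h xs)}" "permute_list p (map h xs) = map h ys"
    using mset_eq_permutation[OF m] by blast
  have pn: "p i < length xs" if "i < length xs" for i
    using permutes_in_image[OF p(1), of i] that by simp
  have h: "h (xs ! p i) = h (ys ! i)" if "i < length xs" for i
    using arg_cong[OF p(2), of "\<lambda>l. l ! i"] that pn len by (simp add: permute_list_nth[OF p(1)])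
  have "Hom A (xs ! p i) (ys ! i) \<noteq> {}" if "i < length xs" for i
    using A[of "xs ! p i" "ys ! i"] h[OF that] pn[OF that] len that by simp
  then have "(SOME g. g \<in> Hom A (xs ! p i) (ys ! i)) \<in> Hom A (xs ! p i) (ys ! i)" if "i < length xs" for i
    using that some_in_eq by blast
  then obtain g where g: "\<And>i. i < length xs \<Longrightarrow> g i \<in> Hom A (xs ! p i) (ys ! i)"
    by (rule that)
  have "map p [0..<length xs] \<in> permutations_of_set {..<length xs}"
  proof (rule permutations_of_setI)
    show "distinct (map p [0..<length xs])"
      using permutes_inj_on[OF p(1)] by (simp add: distinct_map)
    show "set (map p [0..<length xs]) = {..<length xs}"
      using permutes_image[OF p(1)] by (simp add: atLeast0LessThan)
  qed
  then have "map (\<lambda>i. (p i, g i)) [0..<length xs] \<in> Hom (Sr A) xs ys"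
    using g len by (simp add: mem_Hom_Sr comp_def)
  then show "Hom (Sr A) xs ys \<noteq> {}" by blast
qed

text \<open>The source of multiplicativity. Each hom-set is counted by a permanent; the terms of a
  fixed permutation are reindexed by permuting \<open>xs\<close>, which \<open>W\<close> does not
  notice, so every permutation yields the same sum. Without the permutations the count is a product
  over positions.\<close>

lemma sum_card_Hom_Sr:
  fixes W :: "'x list \<Rightarrow> rat"
  assumes H: "lf_groupoid H" and W: "\<And>xs ys. mset xs = mset ys \<Longrightarrow> W xs = W ys"
  shows "(\<Sum>xs\<in>{xs. set xs \<subseteq> S \<and> length xs = length fs}.
      of_nat (card (Hom (Sr H) (map F xs) fs)) * W xs) =
    fact (length fs) * (\<Sum>xs\<in>{xs. set xs \<subseteq> S \<and> length xs = length fs}.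
      (\<Prod>i<length fs. of_nat (card (Hom H (F (xs ! i)) (fs ! i)))) * W xs)"
proof -
  let ?n = "length fs"
  let ?L = "{xs. set xs \<subseteq> S \<and> length xs = ?n}"
  let ?P = "permutations_of_set {..<?n}"
  let ?h = "\<lambda>x i. of_nat (card (Hom H (F x) (fs ! i))) :: rat"
  have "(\<Sum>xs\<in>?L. of_nat (card (Hom (Sr H) (map F xs) fs)) * W xs) =
      (\<Sum>xs\<in>?L. \<Sum>ps\<in>?P. (\<Prod>i<?n. ?h (xs ! (ps ! i)) i) * W xs)"
    by (intro sum.cong refl)
      (simp add: card_Hom_Sr[OF H] permutations_of_lessThanD(4) sum_distrib_right)
  also have "\<dots> = (\<Sum>ps\<in>?P. \<Sum>xs\<in>?L. (\<Prod>i<?n. ?h (xs ! (ps ! i)) i) * W xs)"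
    by (rule sum.swap)
  also have "\<dots> = (\<Sum>ps\<in>?P. \<Sum>xs\<in>?L. (\<Prod>i<?n. ?h (xs ! i) i) * W xs)"
  proof (rule sum.cong[OF refl])
    fix ps assume ps: "ps \<in> ?P"
    obtain qs where qs: "qs \<in> ?P" "\<And>i. i < ?n \<Longrightarrow> qs ! (ps ! i) = i" "\<And>i. i < ?n \<Longrightarrow> ps ! (qs ! i) = i"
      using permutation_inverse[OF ps] by blast
    note p = permutations_of_lessThanD[OF ps] and q = permutations_of_lessThanD[OF qs(1)]
    have L: "map ((!) xs) ps \<in> ?L" if "xs \<in> ?L" "ps \<in> ?P" for xs ps
      using that permutations_of_lessThanD(1,2)[OF that(2)] by auto
    show "(\<Sum>xs\<in>?L. (\<Prod>i<?n. ?h (xs ! (ps ! i)) i) * W xs) = (\<Sum>xs\<in>?L. (\<Prod>i<?n. ?h (xs ! i) i) * W xs)"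
    proof (rule sum.reindex_bij_witness[where i = "\<lambda>xs. map ((!) xs) qs" and j = "\<lambda>xs. map ((!) xs) ps"])
      fix xs assume xs: "xs \<in> ?L"
      show "map ((!) (map ((!) xs) ps)) qs = xs" "map ((!) (map ((!) xs) qs)) ps = xs"
        using xs p(1,4) q(1,4) qs(2,3) by (simp_all add: list_eq_iff_nth_eq)
      show "map ((!) xs) ps \<in> ?L" "map ((!) xs) qs \<in> ?L"
        using L[OF xs] ps qs(1) by blast+
      have "W (map ((!) xs) ps) = W xs"
        using mset_permuted[of ps xs] ps xs by (intro W) simp
      then show "(\<Prod>i<?n. ?h (map ((!) xs) ps ! i) i) * W (map ((!) xs) ps) =
          (\<Prod>i<?n. ?h (xs ! (ps ! i)) i) * W xs"
        using p(1) by simp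
    qed
  qed
  finally show ?thesis by (simp add: card_permutations_of_set)
qed

lemma card_arrows_from_discrete: "c \<in> A \<Longrightarrow> card (arrows_from (discrete A) c) = 1"
proof -
  assume "c \<in> A"
  then have "arrows_from (discrete A) c = {(c, ())}"
    by (auto simp: arrows_from_def discrete_def split: if_splits)
  then show ?thesis by simp
qed

lemma card_arrows_from_gprod:
  "card (arrows_from (gprod G H) x) = card (arrows_from G (fst x)) * card (arrows_from H (snd x))"
proof -
  have "bij_betw (\<lambda>((y, f), (z, g)). ((y, z), (f, g))) (arrows_from G (fst x) \<times> arrows_from H (snd x))
      (arrows_from (gprod G H) x)"
    by (rule bij_betw_byWitness[where f' = "\<lambda>((y, z), (f, g)). ((y, f), (z, g))"])
      (auto simp: arrows_from_def)
  then show ?thesis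
    using bij_betw_same_card card_cartesian_product by metis
qed

lemma card_arrows_from_level_0:
  "card (arrows_from (level Q 0) (Colour c)) = card (arrows_from (colours Q) c)"
proof -
  have "arrows_from (level Q 0) (Colour c) = map_prod Colour ColourM ` arrows_from (colours Q) c"
    by (force simp: arrows_from_def level_0_sel)
  then show ?thesis
    by (simp add: card_image inj_on_def map_prod_def split_def prod_eq_iff)
qed

lemma card_arrows_from_level_1:
  "card (arrows_from (level Q (Suc 0)) (Oper q)) = card (arrows_from (ops Q) q)"
proof -
  have "arrows_from (level Q (Suc 0)) (Oper q) = map_prod Oper OperM ` arrows_from (ops Q) q"
    by (force simp: arrows_from_def level_1_sel)
  then show ?thesis
    by (simp add: card_image inj_on_def map_prod_def split_def prod_eq_iff)
qed

lemma Hom_level_1: "Hom (level Q (Suc 0)) (Oper p) (Oper q) = OperM ` Hom (ops Q) p q"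
  by (auto simp: level_1_sel)

section \<open>The operads \<open>Sym_operad k\<close>\<close>

lemma Sym_operad_sel [simp]:
  "colours (Sym_operad k) = discrete {1..k}"
  "ops (Sym_operad k) = gprod (Sr (discrete {1..k})) (discrete {1..k})"
  "fobj (src (Sym_operad k)) = fst" "fmor (src (Sym_operad k)) = fst"
  "fobj (tgt (Sym_operad k)) = snd" "fmor (tgt (Sym_operad k)) = snd"
  "fobj (unt (Sym_operad k)) c = ([c], c)" "fmor (unt (Sym_operad k)) f = ([(0, f)], f)"
  "fobj (cmp (Sym_operad k)) (qs, r) = (concat (map fst qs), snd r)"
  "fmor (cmp (Sym_operad k)) (l, g) = (mu_mor (map (apsnd fst) l), snd g)"
  by (simp_all add: Sym_operad_def Let_def mu_sel)

lemma functorial_fst: "fobj F = fst \<Longrightarrow> fmor F = fst \<Longrightarrow> functorial F (gprod G H) G"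
  by (simp add: functorial_def)

lemma functorial_snd: "fobj F = snd \<Longrightarrow> fmor F = snd \<Longrightarrow> functorial F (gprod G H) H"
  by (simp add: functorial_def)

interpretation Sym: operad_functors "Sym_operad k" for k
proof (rule operad_functors.intro)
  let ?K = "discrete {1..k}"
  have SrK: "lf_groupoid (Sr ?K)" by (intro lf_groupoid_Sr lf_groupoid_discrete)
  show "lf_groupoid (colours (Sym_operad k))" by (simp add: lf_groupoid_discrete)
  show "lf_groupoid (ops (Sym_operad k))"
    unfolding Sym_operad_sel by (intro lf_groupoid_gprod SrK lf_groupoid_discrete)
  show "functorial (src (Sym_operad k)) (ops (Sym_operad k)) (Sr (colours (Sym_operad k)))"
    by (simp add: functorial_fst)
  show "functorial (tgt (Sym_operad k)) (ops (Sym_operad k)) (colours (Sym_operad k))"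
    by (simp add: functorial_snd)
  show "functorial (unt (Sym_operad k)) (colours (Sym_operad k)) (ops (Sym_operad k))"
    by (rule functorialI)
      (auto simp: mem_Hom_Sr permutations_of_set_def Sr_def)
  have "functorial \<lparr>fobj = fst, fmor = fst\<rparr> (ops (Sym_operad k)) (Sr ?K)"
    by (simp add: functorial_fst)
  \<comment> \<open>On inputs, the composition is the multiplication of the monad applied to the
    tuple of input words, so its functoriality is that of \<open>mu\<close>; the output colour is
    the root's.\<close>
  from functorial_gcomp[OF functorial_Sr_fun[OF this] functorial_mu[OF lf_groupoid_discrete]]
  have C: "functorial (mu \<circ>\<^sub>G Sr_fun \<lparr>fobj = fst, fmor = fst\<rparr>) (Sr (ops (Sym_operad k))) (Sr ?K)" .
  show "functorial (cmp (Sym_operad k)) (gprod (Sr (ops (Sym_operad k))) (ops (Sym_operad k)))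
      (ops (Sym_operad k))"
  proof (rule functorialI)
    fix x y f assume "f \<in> Hom (gprod (Sr (ops (Sym_operad k))) (ops (Sym_operad k))) x y"
    then have f: "fst f \<in> Hom (Sr (ops (Sym_operad k))) (fst x) (fst y)"
        "snd f \<in> Hom (ops (Sym_operad k)) (snd x) (snd y)" by simp_all
    show "fmor (cmp (Sym_operad k)) f \<in> Hom (ops (Sym_operad k))
        (fobj (cmp (Sym_operad k)) x) (fobj (cmp (Sym_operad k)) y)"
      using functorial_hom[OF C f(1)] f(2)
      by (cases f; cases x; cases y) (simp add: gcomp_def mu_sel)
  next
    fix x y z f g
    assume "f \<in> Hom (gprod (Sr (ops (Sym_operad k))) (ops (Sym_operad k))) x y"
      "g \<in> Hom (gprod (Sr (ops (Sym_operad k))) (ops (Sym_operad k))) y z"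
    then have fg: "fst f \<in> Hom (Sr (ops (Sym_operad k))) (fst x) (fst y)"
        "fst g \<in> Hom (Sr (ops (Sym_operad k))) (fst y) (fst z)" by simp_all
    show "fmor (cmp (Sym_operad k)) (Comp (gprod (Sr (ops (Sym_operad k))) (ops (Sym_operad k))) g f) =
        Comp (ops (Sym_operad k)) (fmor (cmp (Sym_operad k)) g) (fmor (cmp (Sym_operad k)) f)"
      using functorial_comp[OF C fg] by (cases f; cases g) (simp add: gcomp_def mu_sel)
  qed
qed

lemma Hom_Sr_discrete_nonempty_iff: "Hom (Sr (discrete A)) c d \<noteq> {} \<longleftrightarrow> content c = content d"
  using Hom_Sr_nonempty_iff[of c d "discrete A" "\<lambda>x. x"] by (simp add: discrete_def)

lemma card_arrows_from_Sr_discrete: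
  assumes "c \<noteq> []" "set c \<subseteq> A"
  shows "card (arrows_from (Sr (discrete A)) c) = fact (length c)"
proof -
  have c1: "card (arrows_from (discrete A) x) = 1" if "x \<in> set c" for x
    using assms that by (intro card_arrows_from_discrete) auto
  \<comment> \<open>Infinite sets have cardinality 0, so a positive count already gives
    finiteness.\<close>
  then have "finite (arrows_from (discrete A) x)" if "x \<in> set c" for x
    using that by (intro card_ge_0_finite) simp
  then have "card (arrows_from (Sr (discrete A)) c) = fact (length c) * (\<Prod>x\<leftarrow>c. card (arrows_from (discrete A) x))"
    using assms by (intro card_arrows_from_Sr)
  also have "map (\<lambda>x. card (arrows_from (discrete A) x)) c = map (\<lambda>_. 1) c"
    using c1 by simp
  also have "(\<Prod>x\<leftarrow>c. 1) = (1 :: nat)" by (induction c) simp_all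
  finally show ?thesis by simp
qed

text \<open>The \<open>fact (length c)\<close> arrows out of \<open>c\<close> are spread evenly over
  its rearrangements. Their number is a multinomial coefficient, which leaves
  \<open>exp_fact (content c)\<close> arrows for each.\<close>

lemma card_Hom_Sr_discrete:
  fixes c d :: "nat list"
  assumes c: "c \<noteq> []" "set c \<subseteq> A"
  shows "card (Hom (Sr (discrete A)) c d) = (if content c = content d then exp_fact (content c) else 0)"
proof (cases "content c = content d")
  case True
  interpret lf_groupoid "Sr (discrete A)" by (intro lf_groupoid_Sr lf_groupoid_discrete)
  let ?C = "{d. content d = content c}"
  have "d \<noteq> [] \<and> set d \<subseteq> A" if "d \<in> ?C" for d
    using that c content_eqD[of d c] by auto
  then have "d \<in> ?C \<longleftrightarrow> d \<in> Obj (Sr (discrete A))" if "g \<in> Hom (Sr (discrete A)) c d" for d g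
    using Hom_Sr_discrete_nonempty_iff[of A c d] that by (auto simp: Obj_Sr discrete_def)
  then have "arrows_from (Sr (discrete A)) c = (SIGMA d:?C. Hom (Sr (discrete A)) c d)"
    unfolding arrows_from_def by blast
  then have "fact (length c) = card (SIGMA d:?C. Hom (Sr (discrete A)) c d)"
    using card_arrows_from_Sr_discrete[OF c] by simp
  also have "\<dots> = (\<Sum>d\<in>?C. card (Hom (Sr (discrete A)) c d))"
    by (rule card_SigmaI) (simp_all add: finite_content_class finite_hom)
  also have "\<dots> = (\<Sum>d\<in>?C. card (Hom (Sr (discrete A)) c c))"
    by (intro sum.cong refl card_hom_cong_target) (simp add: Hom_Sr_discrete_nonempty_iff)
  finally have "card ?C * exp_fact (content c) = card ?C * card (Hom (Sr (discrete A)) c c)"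
    using card_content_class_exp_fact[of c] by simp
  moreover have "card ?C \<noteq> 0"
    using finite_content_class[of "content c"] by (subst card_eq_0_iff) auto
  ultimately have "card (Hom (Sr (discrete A)) c c) = exp_fact (content c)" by simp
  moreover have "card (Hom (Sr (discrete A)) c d) = card (Hom (Sr (discrete A)) c c)"
    using True by (intro card_hom_cong_target) (simp add: Hom_Sr_discrete_nonempty_iff)
  ultimately show ?thesis using True by simp
next
  case False
  then have "Hom (Sr (discrete A)) c d = {}" using Hom_Sr_discrete_nonempty_iff by blast
  then show ?thesis using False by simp
qed

abbreviation ops_level :: "nat \<Rightarrow> ((nat, nat list \<times> nat) ltree, (unit, (nat \<times> unit) list \<times> unit) ltree_mor) groupoid" where
  "ops_level k \<equiv> level (Sym_operad k) (Suc 0)"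

abbreviation trees_level :: "nat \<Rightarrow> ((nat, nat list \<times> nat) ltree, (unit, (nat \<times> unit) list \<times> unit) ltree_mor) groupoid" where
  "trees_level k \<equiv> level (Sym_operad k) (Suc (Suc 0))"

fun op_gen :: "('c, nat list \<times> nat) ltree \<Rightarrow> generator" where
  "op_gen (Oper q) = gen q"

lemma mem_Obj_level_1:
  "x \<in> Obj (ops_level k) \<longleftrightarrow>
    (\<exists>c i. x = Oper (c, i) \<and> c \<noteq> [] \<and> set c \<subseteq> {1..k} \<and> i \<in> {1..k})"
  by (auto simp: level_1_sel Obj_Sr discrete_def)

lemma card_Hom_level_1:
  assumes "x \<in> Obj (ops_level k)" "y \<in> Obj (ops_level k)"
  shows "card (Hom (ops_level k) x y) =
    (if op_gen x = op_gen y then exp_fact (snd (op_gen x)) else 0)"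
proof -
  obtain c i d j where x: "x = Oper (c, i)" "c \<noteq> []" "set c \<subseteq> {1..k}" and y: "y = Oper (d, j)"
    using assms by (auto simp: mem_Obj_level_1)
  have "card (Hom (ops_level k) x y) =
      card (Hom (Sr (discrete {1..k})) c d) * card (Hom (discrete {1..k}) i j)"
    by (simp add: x(1) y Hom_level_1 card_image inj_on_def Hom_gprod card_cartesian_product)
  also have "\<dots> = (if op_gen x = op_gen y then exp_fact (snd (op_gen x)) else 0)"
    unfolding card_Hom_Sr_discrete[OF x(2,3)] by (auto simp: x(1) y gen_def discrete_def)
  finally show ?thesis .
qed

lemma Hom_level_1_nonempty_iff:
  assumes "x \<in> Obj (ops_level k)" "y \<in> Obj (ops_level k)"
  shows "Hom (ops_level k) x y \<noteq> {} \<longleftrightarrow> op_gen x = op_gen y"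
  using card_Hom_level_1[OF assms] exp_fact_pos[of "snd (op_gen x)"]
    lf_groupoid.finite_hom[OF Sym.lf_groupoid_level_1, of k x y]
  by (auto simp: card_eq_0_iff split: if_splits)

lemma Hom_Sr_level_1_nonempty_iff:
  assumes "set xs \<subseteq> Obj (ops_level k)" "set ys \<subseteq> Obj (ops_level k)"
  shows "Hom (Sr (ops_level k)) xs ys \<noteq> {} \<longleftrightarrow>
    content (map op_gen xs) = content (map op_gen ys)"
  using assms by (intro Hom_Sr_nonempty_iff Hom_level_1_nonempty_iff) auto

lemma card_arrows_from_level_1_Sym:
  assumes "c \<noteq> []" "set c \<subseteq> {1..k}" "i \<in> {1..k}"
  shows "card (arrows_from (ops_level k) (Oper (c, i))) = fact (length c)"
  using assms by (simp add: card_arrows_from_level_1 card_arrows_from_gprod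
    card_arrows_from_Sr_discrete card_arrows_from_discrete)

text \<open>The matching condition forces the input word of the root, so the leaf operations and the
  output colour \<open>i\<close> describe the whole tree.\<close>

definition tree :: "nat \<Rightarrow> (nat list \<times> nat) list \<Rightarrow> (nat, nat list \<times> nat) ltree" where
  "tree i qs = Graft (map Oper qs) (map snd qs, i)"

lemma tree_eq_iff: "tree i qs = tree j ps \<longleftrightarrow> i = j \<and> qs = ps"
  by (auto simp: tree_def inj_map_eq_map inj_on_def)

lemma mem_Obj_level_2:
  "t \<in> Obj (trees_level k) \<longleftrightarrow> (\<exists>i qs. t = tree i qs \<and> i \<in> {1..k} \<and> qs \<noteq> [] \<and>
    (\<forall>q\<in>set qs. fst q \<noteq> [] \<and> set (fst q) \<subseteq> {1..k} \<and> snd q \<in> {1..k}))" (is "?l \<longleftrightarrow> ?r")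
proof
  assume ?l
  then obtain ps r where "t = Graft ps r" "ps \<in> Obj (Sr (ops_level k))"
      "r \<in> Obj (ops (Sym_operad k))" "map (fobj (out (Sym_operad k))) ps = fobj (src (Sym_operad k)) r"
    unfolding level_2_sel(1) by blast
  then have t: "t = Graft ps r" "ps \<noteq> []" "set ps \<subseteq> Obj (ops_level k)"
      "r \<in> Obj (ops (Sym_operad k))" "map (fobj (out (Sym_operad k))) ps = fst r"
    by (simp_all add: Obj_Sr)
  have "\<forall>p\<in>set ps. \<exists>q. p = Oper q"
  proof
    fix p assume "p \<in> set ps"
    then have "p \<in> Obj (ops_level k)" using t(3) by blast
    then show "\<exists>q. p = Oper q" by (auto simp: mem_Obj_level_1)
  qed
  then obtain qs where qs: "ps = map Oper qs" using ex_map_conv[of ps Oper] by blast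
  have "map snd qs = fst r" using t(5) qs by (simp add: comp_def)
  then have t': "t = tree (snd r) qs" by (simp add: t(1) qs tree_def)
  have q: "fst q \<noteq> [] \<and> set (fst q) \<subseteq> {1..k} \<and> snd q \<in> {1..k}" if "q \<in> set qs" for q
  proof -
    have "Oper q \<in> Obj (ops_level k)" using that t(3) qs by auto
    then show ?thesis by (cases q) (simp add: mem_Obj_level_1)
  qed
  have "snd r \<in> {1..k}" "qs \<noteq> []" using t(2,4) qs by (simp_all add: discrete_def)
  with t' q show ?r by blast
next
  assume ?r
  then obtain i qs where t: "t = tree i qs" "i \<in> {1..k}" "qs \<noteq> []"
    "\<forall>q\<in>set qs. fst q \<noteq> [] \<and> set (fst q) \<subseteq> {1..k} \<and> snd q \<in> {1..k}" by blast
  have "Oper q \<in> Obj (ops_level k)" if "q \<in> set qs" for q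
    using bspec[OF t(4) that] by (cases q) (simp add: mem_Obj_level_1)
  moreover have "set (map snd qs) \<subseteq> {1..k}" using t(4) by auto
  ultimately show ?l
    using t(2,3) by (auto simp: t(1) tree_def level_2_sel Obj_Sr discrete_def)
qed

text \<open>The leaf part of an arrow determines the rest: the root must carry the permutation
  induced on the outputs of the leaf operations, and its output component is the only morphism of a
  discrete groupoid. So the arrows out of the tree are those out of its tuple of leaf
  operations.\<close>

lemma card_arrows_from_tree:
  assumes "tree i qs \<in> Obj (trees_level k)"
  shows "card (arrows_from (trees_level k) (tree i qs)) =
    fact (length qs) * (\<Prod>q\<leftarrow>qs. fact (length (fst q)))"
proof -
  let ?L1 = "ops_level k" and ?L2 = "trees_level k"
  let ?T = "map (apsnd (fmor (out (Sym_operad k))))" and ?t = "map (fobj (out (Sym_operad k)))"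
  have T: "functorial (Sr_fun (out (Sym_operad k))) (Sr ?L1) (Sr (discrete {1..k}))"
    using functorial_Sr_fun[OF Sym.functorial_out_1[of k]] by simp
  have qs: "i \<in> {1..k}" "qs \<noteq> []" "\<forall>q\<in>set qs. fst q \<noteq> [] \<and> set (fst q) \<subseteq> {1..k} \<and> snd q \<in> {1..k}"
    using assms by (auto simp: mem_Obj_level_2 tree_eq_iff)
  have "bij_betw (\<lambda>(ps, l). (Graft ps (?t ps, i), GraftM l (?T l, ())))
      (arrows_from (Sr ?L1) (map Oper qs)) (arrows_from ?L2 (tree i qs))"
  proof (rule bij_betw_byWitness[where f' = "\<lambda>(x, f). (fobj (branches (Sym_operad k)) x, fmor (branches (Sym_operad k)) f)"])
    show "\<forall>a\<in>arrows_from ?L2 (tree i qs). (\<lambda>(ps, l). (Graft ps (?t ps, i), GraftM l (?T l, ())))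
        ((\<lambda>(x, f). (fobj (branches (Sym_operad k)) x, fmor (branches (Sym_operad k)) f)) a) = a"
      by (auto simp: arrows_from_def level_2_sel tree_def discrete_def split: if_splits)
    show "(\<lambda>(ps, l). (Graft ps (?t ps, i), GraftM l (?T l, ()))) ` arrows_from (Sr ?L1) (map Oper qs)
        \<subseteq> arrows_from ?L2 (tree i qs)"
    proof (rule image_subsetI)
      fix a assume a: "a \<in> arrows_from (Sr ?L1) (map Oper qs)"
      obtain ps l where pl: "a = (ps, l)" by (cases a)
      have ps: "ps \<in> Obj (Sr ?L1)" and l: "l \<in> Hom (Sr ?L1) (map Oper qs) ps"
        using a by (auto simp: pl arrows_from_def)
      have "fobj (out (Sym_operad k)) x \<in> {1..k}" if "x \<in> set ps" for x
      proof -
        have "x \<in> Obj ?L1" using ps that by (auto simp: Obj_Sr)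
        then show ?thesis by (auto simp: mem_Obj_level_1)
      qed
      then have "?t ps \<noteq> [] \<and> set (?t ps) \<subseteq> {1..k}"
        using ps by (auto simp: Obj_Sr)
      moreover have "?T l \<in> Hom (Sr (discrete {1..k})) (map snd qs) (?t ps)"
        using functorial_hom[OF T l] by (simp add: comp_def)
      ultimately show "(\<lambda>(ps, l). (Graft ps (?t ps, i), GraftM l (?T l, ()))) a \<in> arrows_from ?L2 (tree i qs)"
        using ps l qs(1) by (simp add: pl arrows_from_def level_2_sel tree_def Obj_Sr discrete_def)
    qed
  qed (auto simp: arrows_from_def level_2_sel tree_def)
  then have "card (arrows_from ?L2 (tree i qs)) = card (arrows_from (Sr ?L1) (map Oper qs))"
    by (rule bij_betw_same_card[symmetric])
  also have "\<dots> = fact (length (map Oper qs :: (nat, nat list \<times> nat) ltree list)) *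
      (\<Prod>x\<leftarrow>map Oper qs. card (arrows_from ?L1 x))"
  proof (rule card_arrows_from_Sr)
    fix x :: "(nat, nat list \<times> nat) ltree" assume "x \<in> set (map Oper qs)"
    then obtain c j where "x = Oper (c, j)" "(c, j) \<in> set qs" by auto
    then have "card (arrows_from ?L1 x) = fact (length c)"
      using bspec[OF qs(3), of "(c, j)"] card_arrows_from_level_1_Sym[of c k j] by simp
    then show "finite (arrows_from ?L1 x)" by (intro card_ge_0_finite) simp
  qed (use qs in simp)
  also have "(\<Prod>x\<leftarrow>map Oper qs. card (arrows_from ?L1 x)) = (\<Prod>q\<leftarrow>qs. fact (length (fst q)))"
  proof -
    have "card (arrows_from ?L1 (Oper q)) = fact (length (fst q))" if "q \<in> set qs" for q
      using bspec[OF qs(3) that] card_arrows_from_level_1_Sym[of "fst q" k "snd q"] by simp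
    then show ?thesis by (simp add: comp_def cong: map_cong)
  qed
  finally show ?thesis by simp
qed

section \<open>Incidence coefficients\<close>

lemma prod_list_sum_lists:
  fixes g :: "'x \<Rightarrow> 'f \<Rightarrow> 'r::comm_semiring_1"
  assumes "finite S"
  shows "(\<Prod>f\<leftarrow>fs. \<Sum>x\<in>S. g x f) =
    (\<Sum>xs\<in>{xs. set xs \<subseteq> S \<and> length xs = length fs}. \<Prod>i<length fs. g (xs ! i) (fs ! i))"
proof (induction fs)
  case Nil
  have "{xs. set xs \<subseteq> S \<and> length xs = length ([] :: 'f list)} = {[]}" by auto
  then show ?case by simp
next
  case (Cons f fs)
  let ?L = "\<lambda>n. {xs. set xs \<subseteq> S \<and> length xs = n}"
  have "(\<Prod>f\<leftarrow>f # fs. \<Sum>x\<in>S. g x f) =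
      (\<Sum>p\<in>S \<times> ?L (length fs). g (fst p) f * (\<Prod>i<length fs. g (snd p ! i) (fs ! i)))"
    using Cons.IH by (simp add: sum_product sum.cartesian_product split_def)
  also have "\<dots> = (\<Sum>xs\<in>?L (length (f # fs)). \<Prod>i<length (f # fs). g (xs ! i) ((f # fs) ! i))"
  proof (rule sum.reindex_bij_witness[where i = "\<lambda>xs. (hd xs, tl xs)" and j = "\<lambda>p. fst p # snd p"])
    fix xs assume xs: "xs \<in> ?L (length (f # fs))"
    then obtain y ys where "xs = y # ys" by (cases xs) auto
    then show "fst (hd xs, tl xs) # snd (hd xs, tl xs) = xs" "(hd xs, tl xs) \<in> S \<times> ?L (length fs)"
      using xs by auto
  next
    fix p assume "p \<in> S \<times> ?L (length fs)"
    then show "(hd (fst p # snd p), tl (fst p # snd p)) = p" "fst p # snd p \<in> ?L (length (f # fs))"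
      "(\<Prod>i<length (f # fs). g ((fst p # snd p) ! i) ((f # fs) ! i)) =
        g (fst p) f * (\<Prod>i<length fs. g (snd p ! i) (fs ! i))"
      by (auto simp: prod.lessThan_Suc_shift simp del: prod.lessThan_Suc)
  qed
  finally show ?case .
qed

lemma prod_single:
  fixes n :: nat
  shows "(\<Prod>i<n. Poly_Mapping.single (M i) (c i)) =
    Poly_Mapping.single (\<Sum>i<n. M i :: 'a::comm_monoid_add) (\<Prod>i<n. c i :: 'r::comm_semiring_1)"
  by (induction n) (simp_all add: mult_single single_one)

text \<open>This definition and the next two are closed forms, on a single tree, of the inner face,
  the face keeping the root, and the face keeping the leaf operations.\<close>

definition composite :: "(nat, nat list \<times> nat) ltree \<Rightarrow> (nat, nat list \<times> nat) ltree" where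
  "composite t = (case t of Graft ps r \<Rightarrow> Oper (concat (map (\<lambda>p. case p of Oper q \<Rightarrow> fst q) ps), snd r))"

definition bottom_op :: "(nat, nat list \<times> nat) ltree \<Rightarrow> (nat, nat list \<times> nat) ltree" where
  "bottom_op t = (case t of Graft ps r \<Rightarrow> Oper r)"

definition leaf_ops :: "(nat, nat list \<times> nat) ltree \<Rightarrow> (nat, nat list \<times> nat) ltree list" where
  "leaf_ops t = (case t of Graft ps r \<Rightarrow> ps)"

lemma tree_sel [simp]:
  "composite (tree i qs) = Oper (concat (map fst qs), i)"
  "bottom_op (tree i qs) = Oper (map snd qs, i)"
  "leaf_ops (tree i qs) = map Oper qs"
  by (simp_all add: composite_def bottom_op_def leaf_ops_def tree_def comp_def)

lemma faces_tree:
  assumes "t \<in> Obj (trees_level k)"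
  shows "fobj (tree_face (Sym_operad k) (Suc (Suc 0)) (Suc 0)) t = composite t"
    "fobj (tree_face (Sym_operad k) (Suc (Suc 0)) 0) t = bottom_op t"
    "fobj (branches (Sym_operad k)) t = leaf_ops t"
  using assms by (auto simp: mem_Obj_level_2 tree_face_2_0)
    (auto simp: tree_def tree_face_2_1_Graft comp_def)

lemma tree_parts_mem:
  assumes "t \<in> Obj (trees_level k)"
  shows "composite t \<in> Obj (ops_level k)" "bottom_op t \<in> Obj (ops_level k)"
    "set (leaf_ops t) \<subseteq> Obj (ops_level k)" "leaf_ops t \<noteq> []"
proof -
  obtain i qs where t: "t = tree i qs" "i \<in> {1..k}" "qs \<noteq> []"
    "\<forall>q\<in>set qs. fst q \<noteq> [] \<and> set (fst q) \<subseteq> {1..k} \<and> snd q \<in> {1..k}"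
    using assms unfolding mem_Obj_level_2 by blast
  have "fst (hd qs) \<noteq> []" using bspec[OF t(4), of "hd qs"] t(3) by simp
  then have "concat (map fst qs) \<noteq> []" using t(3) by (cases qs) simp_all
  moreover have "set (concat (map fst qs)) \<subseteq> {1..k}" using t(4) by fastforce
  ultimately show "composite t \<in> Obj (ops_level k)" using t(2) by (simp add: t(1) mem_Obj_level_1)
  have "set (map snd qs) \<subseteq> {1..k}" using t(4) by auto
  then show "bottom_op t \<in> Obj (ops_level k)" using t(2,3) by (simp add: t(1) mem_Obj_level_1)
  have "Oper q \<in> Obj (ops_level k)" if "q \<in> set qs" for q
    using bspec[OF t(4) that] by (cases q) (simp add: mem_Obj_level_1)
  then show "set (leaf_ops t) \<subseteq> Obj (ops_level k)" by (auto simp: t(1))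
  show "leaf_ops t \<noteq> []" using t(3) by (simp add: t(1))
qed

definition monomial :: "('c, nat list \<times> nat) ltree list \<Rightarrow> (generator \<Rightarrow>\<^sub>0 nat)" where
  "monomial xs = content (map op_gen xs)"

text \<open>The leaf operations come first because \<open>Phi\<close> pairs the face discarding the
  root with the face discarding the leaf level, in this order.\<close>

definition tree_monomial :: "(nat, nat list \<times> nat) ltree \<Rightarrow> (generator \<Rightarrow>\<^sub>0 nat) \<times> (generator \<Rightarrow>\<^sub>0 nat)" where
  "tree_monomial t = (monomial (leaf_ops t), monomial [bottom_op t])"

text \<open>The term of \<open>t\<close> in the homotopy cardinality of the fibre of the composition
  over the single operation \<open>f\<close>.\<close>

definition tree_weight :: "nat \<Rightarrow> (nat, nat list \<times> nat) ltree \<Rightarrow> (nat, nat list \<times> nat) ltree \<Rightarrow> rat" where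
  "tree_weight k t f = of_nat (card (Hom (ops_level k) (composite t) f)) / of_nat (card (arrows_from (trees_level k) t))"

lemma sum_tree_monomial:
  "(\<Sum>t\<leftarrow>ts. tree_monomial t) = (monomial (concat (map leaf_ops ts)), monomial (map bottom_op ts))"
  by (induction ts) (simp_all add: tree_monomial_def monomial_def zero_prod_def)

lemma sum_list_map_mset_cong:
  fixes f :: "'a \<Rightarrow> 'b::comm_monoid_add"
  shows "mset xs = mset ys \<Longrightarrow> (\<Sum>x\<leftarrow>xs. f x) = (\<Sum>x\<leftarrow>ys. f x)"
  unfolding sum_mset_sum_list[symmetric] mset_map by simp

lemma prod_list_map_mset_cong:
  fixes f :: "'a \<Rightarrow> 'b::comm_monoid_mult"
  shows "mset xs = mset ys \<Longrightarrow> (\<Prod>x\<leftarrow>xs. f x) = (\<Prod>x\<leftarrow>ys. f x)"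
  unfolding prod_mset_prod_list[symmetric] mset_map by simp

lemma finite_arrows_from_tree:
  assumes "t \<in> Obj (trees_level k)"
  shows "finite (arrows_from (trees_level k) t)"
proof (rule card_ge_0_finite)
  obtain i qs where t: "t = tree i qs" using assms by (auto simp: mem_Obj_level_2)
  have "(\<Prod>q\<leftarrow>qs. fact (length (fst q))) \<noteq> (0 :: nat)" by (induction qs) simp_all
  then show "card (arrows_from (trees_level k) t) > 0"
    using card_arrows_from_tree[of i qs k] assms by (simp add: t)
qed

text \<open>The double fibre is a sum over tuples of trees of hom-set sizes divided by numbers of
  outgoing arrows. Morphisms to \<open>as\<close> and \<open>bs\<close> exist exactly when the
  monomials agree, and then contribute the orders of the automorphism groups; the permutations in
  the morphisms to \<open>fs\<close> cancel those among the trees.\<close>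

lemma hcard_Phi:
  assumes fs: "fs \<in> Obj (Sr (ops_level k))" and as: "as \<in> Obj (Sr (ops_level k))"
    and bs: "bs \<in> Obj (Sr (ops_level k))"
    and S: "finite S" "S \<subseteq> Obj (trees_level k)"
    and cover: "\<And>t f. t \<in> Obj (trees_level k) \<Longrightarrow> f \<in> set fs \<Longrightarrow>
      Hom (ops_level k) (composite t) f \<noteq> {} \<Longrightarrow> t \<in> S"
  shows "hcard (Phi (bar (Sym_operad k)) fs as bs) /
      (of_nat (card (Aut (Sr (ops_level k)) as)) * of_nat (card (Aut (Sr (ops_level k)) bs))) =
    (\<Sum>ts\<in>{ts. set ts \<subseteq> S \<and> length ts = length fs}. (\<Prod>i<length fs. tree_weight k (ts ! i) (fs ! i)) *
      (if (\<Sum>t\<leftarrow>ts. tree_monomial t) = (monomial as, monomial bs) then 1 else 0))"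
proof -
  let ?Q = "Sym_operad k" and ?n = "length fs"
  let ?L = "{ts. set ts \<subseteq> S \<and> length ts = ?n}"
  let ?X1 = "Sr (ops_level k)" and ?X2 = "Sr (trees_level k)"
  let ?d1 = "Sr_fun (tree_face ?Q (Suc (Suc 0)) (Suc 0))"
  let ?d02 = "gpair (mu \<circ>\<^sub>G Sr_fun (branches ?Q)) (Sr_fun (tree_face ?Q (Suc (Suc 0)) 0))"
  let ?A = "of_nat (card (Aut ?X1 as)) :: rat" and ?B = "of_nat (card (Aut ?X1 bs)) :: rat"
  \<comment> \<open>\<open>W\<close> gathers all factors that depend only on the multiset of trees;
    this symmetry is what \<open>sum_card_Hom_Sr\<close> asks for.\<close>
  define W where "W = (\<lambda>ts. (if (\<Sum>t\<leftarrow>ts. tree_monomial t) = (monomial as, monomial bs) then 1 else 0) /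
    (\<Prod>t\<leftarrow>ts. of_nat (card (arrows_from (trees_level k) t))) :: rat)"
  have gL1: "lf_groupoid (ops_level k)" by (rule Sym.lf_groupoid_level_1)
  interpret X1: lf_groupoid ?X1 by (rule lf_groupoid_Sr[OF gL1])
  have X1: "lf_groupoid ?X1" by (rule lf_groupoid_Sr[OF gL1])
  have X2: "lf_groupoid (guarded ?X2)"
    unfolding guarded_Sr[of "trees_level k"]
    by (intro lf_groupoid_guarded lf_groupoid_Sr Sym.lf_groupoid_level_2)
  have F1: "functorial ?d1 (guarded ?X2) ?X1"
    by (intro functorial_guarded functorial_Sr_fun Sym.functorial_tree_face_2_1)
  have F02: "functorial ?d02 (guarded ?X2) (gprod ?X1 ?X1)"
    by (intro functorial_guarded functorial_gpair functorial_gcomp[OF _ functorial_mu[OF gL1]]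
      functorial_Sr_fun Sym.functorial_tree_face_2_0 Sym.functorial_branches_2)
  have fs_ne: "fs \<noteq> []" using fs by (simp add: Obj_Sr)
  have mem: "t \<in> Obj (trees_level k)" if "ts \<in> ?L" "t \<in> set ts" for ts t
    using that S by auto
  have d1: "fobj ?d1 ts = map composite ts" if "set ts \<subseteq> Obj (trees_level k)" for ts
    unfolding Sr_fun_sel using that faces_tree(1) by (intro map_cong refl) blast
  have d2: "fobj (mu \<circ>\<^sub>G Sr_fun (branches ?Q)) ts = concat (map leaf_ops ts)"
    and d0: "fobj (Sr_fun (tree_face ?Q (Suc (Suc 0)) 0)) ts = map bottom_op ts"
    if "set ts \<subseteq> Obj (trees_level k)" for ts
  proof -
    have m: "map (fobj (branches ?Q)) ts = map leaf_ops ts"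
      using that faces_tree(3) by (intro map_cong refl) blast
    have "fobj (mu \<circ>\<^sub>G Sr_fun (branches ?Q)) ts = concat (map (fobj (branches ?Q)) ts)"
      by (simp add: gcomp_def mu_sel)
    then show "fobj (mu \<circ>\<^sub>G Sr_fun (branches ?Q)) ts = concat (map leaf_ops ts)"
      unfolding m .
    show "fobj (Sr_fun (tree_face ?Q (Suc (Suc 0)) 0)) ts = map bottom_op ts"
      unfolding Sr_fun_sel using that faces_tree(2) by (intro map_cong refl) blast
  qed
  have Phi: "Phi (bar ?Q) fs as bs = hofib (hofib ?X2 ?X1 ?d1 fs) (gprod ?X1 ?X1) (?d02 \<circ>\<^sub>G hofib_proj) (as, bs)"
    by (simp add: Phi_def bar_def Let_def numeral_2_eq_2)
  have finL: "finite ?L" using finite_lists_length_eq[OF S(1)] by simp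
  have "hcard (Phi (bar ?Q) fs as bs) =
      (\<Sum>ts\<in>?L. of_nat (card (Hom ?X1 (fobj ?d1 ts) fs) * card (Hom (gprod ?X1 ?X1) (fobj ?d02 ts) (as, bs))) /
        of_nat (card (arrows_from ?X2 ts)))"
    unfolding Phi
  proof (rule hcard_hofib_hofib[OF X2 X1 lf_groupoid_gprod[OF X1 X1] F1 F02 finL])
    show "?L \<subseteq> Obj ?X2"
    proof
      fix ts assume "ts \<in> ?L"
      then have "set ts \<subseteq> S" "ts \<noteq> []" using fs_ne by auto
      then show "ts \<in> Obj ?X2" using S(2) by (simp add: Obj_Sr)
    qed
    fix ts assume ts: "ts \<in> Obj ?X2" and "Hom ?X1 (fobj ?d1 ts) fs \<noteq> {}"
    then have sub: "set ts \<subseteq> Obj (trees_level k)" by (simp add: Obj_Sr)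
    obtain l where "l \<in> Hom ?X1 (fobj ?d1 ts) fs" using \<open>Hom ?X1 (fobj ?d1 ts) fs \<noteq> {}\<close> by blast
    then have l: "l \<in> Hom ?X1 (map composite ts) fs" unfolding d1[OF sub] .
    note h = Hom_SrD[OF l]
    have len: "length ts = ?n" using h(2) by simp
    \<comment> \<open>The permutation in \<open>l\<close> matches the composite of every tree with
      some entry of \<open>fs\<close>, and then \<open>cover\<close> applies to that tree.\<close>
    have "\<forall>j<length ts. ts ! j \<in> S"
    proof (intro allI impI)
      fix j assume j: "j < length ts"
      obtain i where i: "i < length ts" "map fst l ! i = j"
        using permutation_surj[OF h(3), of j] j by auto
      have "snd (l ! i) \<in> Hom (ops_level k) (composite (ts ! j)) (fs ! i)"
        using h(5)[of i] h(1) i j by simp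
      moreover have "ts ! j \<in> Obj (trees_level k)" "fs ! i \<in> set fs"
        using sub j i(1) len by auto
      ultimately show "ts ! j \<in> S" using cover by blast
    qed
    then have "\<forall>t\<in>set ts. t \<in> S" unfolding all_set_conv_all_nth .
    then show "ts \<in> ?L" using len by blast
  qed
  \<comment> \<open>The factors \<open>?A\<close> and \<open>?B\<close> come from the morphisms to
    \<open>as\<close> and \<open>bs\<close>, and \<open>1 / fact ?n\<close> from the reorderings
    among the arrows out of a tuple of trees.\<close>
  also have "\<dots> = (\<Sum>ts\<in>?L. (?A * ?B / fact ?n) * (of_nat (card (Hom ?X1 (map composite ts) fs)) * W ts))"
  proof (rule sum.cong[OF refl])
    fix ts assume ts: "ts \<in> ?L"
    have sub: "set ts \<subseteq> Obj (trees_level k)" using mem[OF ts] by blast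
    have ne: "ts \<noteq> []" using ts fs_ne by auto
    have d2m: "set (concat (map leaf_ops ts)) \<subseteq> Obj (ops_level k)"
      and d0m: "set (map bottom_op ts) \<subseteq> Obj (ops_level k)"
      using tree_parts_mem(2,3) sub by (auto dest!: subsetD)
    \<comment> \<open>A nonempty hom-set into \<open>as\<close> has as many elements as the
      automorphism group of \<open>as\<close>.\<close>
    have a: "of_nat (card (Hom ?X1 (concat (map leaf_ops ts)) as)) =
        (if monomial (concat (map leaf_ops ts)) = monomial as then ?A else 0)"
    proof (cases "Hom ?X1 (concat (map leaf_ops ts)) as = {}")
      case True
      then show ?thesis
        using Hom_Sr_level_1_nonempty_iff[OF d2m, of as] as by (simp add: Obj_Sr monomial_def)
    next
      case False
      then show ?thesis
        using Hom_Sr_level_1_nonempty_iff[OF d2m, of as] as X1.card_hom_cong_source[OF False, of as]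
        by (simp add: Obj_Sr monomial_def Aut_def)
    qed
    have b: "of_nat (card (Hom ?X1 (map bottom_op ts) bs)) =
        (if monomial (map bottom_op ts) = monomial bs then ?B else 0)"
    proof (cases "Hom ?X1 (map bottom_op ts) bs = {}")
      case True
      then show ?thesis
        using Hom_Sr_level_1_nonempty_iff[OF d0m, of bs] bs by (simp add: Obj_Sr monomial_def)
    next
      case False
      then show ?thesis
        using Hom_Sr_level_1_nonempty_iff[OF d0m, of bs] bs X1.card_hom_cong_source[OF False, of bs]
        by (simp add: Obj_Sr monomial_def Aut_def)
    qed
    have ar: "card (arrows_from ?X2 ts) = fact ?n * (\<Prod>t\<leftarrow>ts. card (arrows_from (trees_level k) t))"
      using card_arrows_from_Sr[of ts "trees_level k"] finite_arrows_from_tree mem[OF ts] ne ts by simp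
    have pr: "of_nat (\<Prod>t\<leftarrow>ts. card (arrows_from (trees_level k) t)) =
        (\<Prod>t\<leftarrow>ts. of_nat (card (arrows_from (trees_level k) t)) :: rat)"
      by (induction ts) simp_all
    have gp: "card (Hom (gprod ?X1 ?X1) (fobj ?d02 ts) (as, bs)) =
        card (Hom ?X1 (concat (map leaf_ops ts)) as) * card (Hom ?X1 (map bottom_op ts) bs)"
      unfolding Hom_gprod card_cartesian_product gpair_def gfun.simps fst_conv snd_conv d2[OF sub] d0[OF sub] ..
    show "of_nat (card (Hom ?X1 (fobj ?d1 ts) fs) * card (Hom (gprod ?X1 ?X1) (fobj ?d02 ts) (as, bs))) /
        of_nat (card (arrows_from ?X2 ts)) =
        (?A * ?B / fact ?n) * (of_nat (card (Hom ?X1 (map composite ts) fs)) * W ts)"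
      unfolding ar gp d1[OF sub] of_nat_mult a b pr of_nat_fact W_def sum_tree_monomial by simp
  qed
  also have "\<dots> = (?A * ?B / fact ?n) * (\<Sum>ts\<in>?L. of_nat (card (Hom ?X1 (map composite ts) fs)) * W ts)"
    by (rule sum_distrib_left[symmetric])
  also have "(\<Sum>ts\<in>?L. of_nat (card (Hom ?X1 (map composite ts) fs)) * W ts) =
      fact ?n * (\<Sum>ts\<in>?L. (\<Prod>i<?n. of_nat (card (Hom (ops_level k) (composite (ts ! i)) (fs ! i)))) * W ts)"
    by (rule sum_card_Hom_Sr[OF gL1])
      (simp add: W_def cong: sum_list_map_mset_cong prod_list_map_mset_cong)
  also have "(\<Sum>ts\<in>?L. (\<Prod>i<?n. of_nat (card (Hom (ops_level k) (composite (ts ! i)) (fs ! i)))) * W ts) =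
      (\<Sum>ts\<in>?L. (\<Prod>i<?n. tree_weight k (ts ! i) (fs ! i)) *
        (if (\<Sum>t\<leftarrow>ts. tree_monomial t) = (monomial as, monomial bs) then 1 else 0))"
  proof (rule sum.cong[OF refl])
    fix ts assume ts: "ts \<in> ?L"
    have "(\<Prod>t\<leftarrow>ts. of_nat (card (arrows_from (trees_level k) t))) =
        (\<Prod>i<?n. of_nat (card (arrows_from (trees_level k) (ts ! i))) :: rat)"
      using ts by (simp add: prod.list_conv_set_nth atLeast0LessThan)
    then show "(\<Prod>i<?n. of_nat (card (Hom (ops_level k) (composite (ts ! i)) (fs ! i)))) * W ts =
        (\<Prod>i<?n. tree_weight k (ts ! i) (fs ! i)) *
        (if (\<Sum>t\<leftarrow>ts. tree_monomial t) = (monomial as, monomial bs) then 1 else 0)"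
      by (simp add: W_def tree_weight_def prod_dividef)
  qed
  finally have "hcard (Phi (bar ?Q) fs as bs) = ?A * ?B *
      (\<Sum>ts\<in>?L. (\<Prod>i<?n. tree_weight k (ts ! i) (fs ! i)) *
        (if (\<Sum>t\<leftarrow>ts. tree_monomial t) = (monomial as, monomial bs) then 1 else 0))"
    by simp
  moreover have "?A \<noteq> 0" "?B \<noteq> 0"
    using X1.idn_hom[OF as] X1.idn_hom[OF bs] X1.finite_hom by (auto simp: Aut_def card_eq_0_iff)
  ultimately show ?thesis by simp
qed

lemma tree_weight_tree:
  assumes "tree j qs \<in> Obj (trees_level k)" "f \<in> Obj (ops_level k)"
  shows "tree_weight k (tree j qs) f = (if op_gen (composite (tree j qs)) = op_gen f
    then of_nat (exp_fact (snd (op_gen f))) * graft_weight qs else 0)"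
proof -
  have "of_nat (\<Prod>q\<leftarrow>qs. fact (length (fst q))) = (\<Prod>q\<leftarrow>qs. fact (length (fst q)) :: rat)"
    by (induction qs) simp_all
  then show ?thesis
    unfolding tree_weight_def card_Hom_level_1[OF tree_parts_mem(1)[OF assms(1)] assms(2)]
      card_arrows_from_tree[OF assms(1)] graft_weight_def
    by (simp del: tree_sel)
qed

definition trees_over :: "nat \<Rightarrow> (nat, nat list \<times> nat) ltree \<Rightarrow> (nat, nat list \<times> nat) ltree set" where
  "trees_over k f = tree (fst (op_gen f)) ` grafts k (snd (op_gen f))"

lemma mem_trees_over_iff:
  assumes "f \<in> Obj (ops_level k)"
  shows "t \<in> trees_over k f \<longleftrightarrow> t \<in> Obj (trees_level k) \<and> op_gen (composite t) = op_gen f"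
proof -
  obtain c i where f: "f = Oper (c, i)" "c \<noteq> []" "i \<in> {1..k}"
    using assms by (auto simp: mem_Obj_level_1)
  \<comment> \<open>An operation has at least one input, so its content is not 0. This excludes the
    empty graft, which is not a tree.\<close>
  have "qs \<noteq> []" if "qs \<in> grafts k (content c)" for qs
    using that f(2) by (auto simp: grafts_def dest!: sym[of 0])
  note ne = this
  show ?thesis
  proof
    assume "t \<in> trees_over k f"
    then obtain qs where qs: "qs \<in> grafts k (content c)" "t = tree i qs"
      by (auto simp: f(1) trees_over_def gen_def)
    have "\<forall>q\<in>set qs. fst q \<noteq> [] \<and> set (fst q) \<subseteq> {1..k} \<and> snd q \<in> {1..k}"
      using graftsD(3)[OF qs(1)] by blast
    then show "t \<in> Obj (trees_level k) \<and> op_gen (composite t) = op_gen f"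
      using ne[OF qs(1)] graftsD(4)[OF qs(1)] f(3) qs(2) unfolding mem_Obj_level_2
      by (auto simp: f(1) gen_def)
  next
    assume t: "t \<in> Obj (trees_level k) \<and> op_gen (composite t) = op_gen f"
    then obtain j qs where qs: "t = tree j qs"
        "\<forall>q\<in>set qs. fst q \<noteq> [] \<and> set (fst q) \<subseteq> {1..k} \<and> snd q \<in> {1..k}"
      unfolding mem_Obj_level_2 by blast
    then have "qs \<in> grafts k (content c)" "j = i"
      using t by (simp_all add: f(1) gen_def grafts_def)
    then show "t \<in> trees_over k f"
      by (simp add: f(1) trees_over_def gen_def qs(1))
  qed
qed

lemma finite_trees_over: "finite (trees_over k f)"
  by (simp add: trees_over_def finite_grafts)

text \<open>Trees whose composite is not isomorphic to \<open>f\<close> have weight 0. Enlarging the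
  index set to \<open>S\<close> is therefore harmless, and one \<open>S\<close> can serve all
  operations of a configuration.\<close>

lemma fdb_sum_eq_sum_trees:
  assumes f: "f \<in> Obj (ops_level k)" and S: "finite S" "trees_over k f \<subseteq> S" "S \<subseteq> Obj (trees_level k)"
  shows "fdb_sum k (op_gen f) = (\<Sum>t\<in>S. Poly_Mapping.single (tree_monomial t) (tree_weight k t f))"
proof -
  obtain i n where in_: "op_gen f = (i, n)" by (cases "op_gen f")
  have "(\<Sum>t\<in>S. Poly_Mapping.single (tree_monomial t) (tree_weight k t f)) =
      (\<Sum>t\<in>trees_over k f. Poly_Mapping.single (tree_monomial t) (tree_weight k t f))"
  proof (rule sum.mono_neutral_right[OF S(1,2)], rule ballI)
    fix t assume t: "t \<in> S - trees_over k f"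
    then have tO: "t \<in> Obj (trees_level k)" using S(3) by blast
    then obtain j qs where j: "t = tree j qs" by (auto simp: mem_Obj_level_2)
    have "op_gen (composite t) \<noteq> op_gen f" using t tO mem_trees_over_iff[OF f] by blast
    then show "Poly_Mapping.single (tree_monomial t) (tree_weight k t f) = 0"
      using tree_weight_tree[of j qs k f] tO f j by simp
  qed
  also have "\<dots> = (\<Sum>qs\<in>grafts k n. Poly_Mapping.single (tree_monomial (tree i qs)) (tree_weight k (tree i qs) f))"
    unfolding trees_over_def in_ by (subst sum.reindex) (auto simp: inj_on_def tree_eq_iff)
  also have "\<dots> = fdb_sum k (op_gen f)"
    unfolding in_ fdb_sum_def prod.case
  proof (rule sum.cong[OF refl])
    fix qs assume "qs \<in> grafts k n"
    then have "tree i qs \<in> trees_over k f" by (simp add: trees_over_def in_)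
    then have "tree i qs \<in> Obj (trees_level k)" "op_gen (composite (tree i qs)) = op_gen f"
      using mem_trees_over_iff[OF f] by blast+
    then have "tree_weight k (tree i qs) f = of_nat (exp_fact n) * graft_weight qs"
      using tree_weight_tree[OF _ f, of i qs] in_ by simp
    moreover have "map op_gen (map Oper qs) = map gen qs" by simp
    ultimately show "Poly_Mapping.single (tree_monomial (tree i qs)) (tree_weight k (tree i qs) f) =
        Poly_Mapping.single (content (map gen qs), content [(i, content (map snd qs))])
          (of_nat (exp_fact n) * graft_weight qs)"
      by (simp add: tree_monomial_def monomial_def gen_def comp_def)
  qed
  finally show ?thesis by simp
qed

text \<open>With a common finite set of trees for all factors, the expanded product is indexed by
  the tuples of trees that also index the homotopy cardinality of \<open>Phi\<close>.\<close>

lemma prod_fdb_sum: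
  assumes fs: "set fs \<subseteq> Obj (ops_level k)"
  obtains S where "finite S" "S \<subseteq> Obj (trees_level k)"
    "\<And>t f. t \<in> Obj (trees_level k) \<Longrightarrow> f \<in> set fs \<Longrightarrow>
      Hom (ops_level k) (composite t) f \<noteq> {} \<Longrightarrow> t \<in> S"
    "(\<Prod>f\<leftarrow>fs. fdb_sum k (op_gen f)) = (\<Sum>ts\<in>{ts. set ts \<subseteq> S \<and> length ts = length fs}.
      Poly_Mapping.single (\<Sum>t\<leftarrow>ts. tree_monomial t) (\<Prod>i<length fs. tree_weight k (ts ! i) (fs ! i)))"
proof -
  define S where "S = (\<Union>f\<in>set fs. trees_over k f)"
  have S: "finite S" "S \<subseteq> Obj (trees_level k)"
    using fs mem_trees_over_iff by (auto simp: S_def finite_trees_over)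
  have cover: "t \<in> S" if "t \<in> Obj (trees_level k)" "f \<in> set fs" "Hom (ops_level k) (composite t) f \<noteq> {}" for t f
  proof -
    have f: "f \<in> Obj (ops_level k)" using fs that by blast
    then have "op_gen (composite t) = op_gen f"
      using Hom_level_1_nonempty_iff[OF tree_parts_mem(1)[OF that(1)] f] that(3) by blast
    then show ?thesis using mem_trees_over_iff[OF f] that(1,2) by (auto simp: S_def)
  qed
  have "(\<Prod>f\<leftarrow>fs. fdb_sum k (op_gen f)) =
      (\<Prod>f\<leftarrow>fs. \<Sum>t\<in>S. Poly_Mapping.single (tree_monomial t) (tree_weight k t f))"
    using fs S by (intro arg_cong[of _ _ prod_list] map_cong refl fdb_sum_eq_sum_trees) (auto simp: S_def)
  also have "\<dots> = (\<Sum>ts\<in>{ts. set ts \<subseteq> S \<and> length ts = length fs}.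
      \<Prod>i<length fs. Poly_Mapping.single (tree_monomial (ts ! i)) (tree_weight k (ts ! i) (fs ! i)))"
    by (rule prod_list_sum_lists[OF S(1)])
  also have "\<dots> = (\<Sum>ts\<in>{ts. set ts \<subseteq> S \<and> length ts = length fs}.
      Poly_Mapping.single (\<Sum>t\<leftarrow>ts. tree_monomial t) (\<Prod>i<length fs. tree_weight k (ts ! i) (fs ! i)))"
    by (intro sum.cong refl) (auto simp: prod_single sum.list_conv_set_nth atLeast0LessThan)
  finally show thesis using that S cover by blast
qed

text \<open>Both sides sum the same product of weights over the same tuples of trees; the condition
  on the monomials selects the terms that \<open>lookup\<close> collects.\<close>

lemma incidence_coeff_eq_lookup:
  assumes fs: "fs \<in> Obj (Sr (ops_level k))" and as: "as \<in> Obj (Sr (ops_level k))"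
    and bs: "bs \<in> Obj (Sr (ops_level k))"
  shows "hcard (Phi (bar (Sym_operad k)) fs as bs) /
      (of_nat (card (Aut (Sr (ops_level k)) as)) * of_nat (card (Aut (Sr (ops_level k)) bs))) =
    Poly_Mapping.lookup (\<Prod>f\<leftarrow>fs. fdb_sum k (op_gen f)) (monomial as, monomial bs)"
proof -
  have "set fs \<subseteq> Obj (ops_level k)" using fs by (simp add: Obj_Sr)
  then obtain S where S: "finite S" "S \<subseteq> Obj (trees_level k)"
    "\<And>t f. t \<in> Obj (trees_level k) \<Longrightarrow> f \<in> set fs \<Longrightarrow>
      Hom (ops_level k) (composite t) f \<noteq> {} \<Longrightarrow> t \<in> S"
    and eq: "(\<Prod>f\<leftarrow>fs. fdb_sum k (op_gen f)) = (\<Sum>ts\<in>{ts. set ts \<subseteq> S \<and> length ts = length fs}.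
      Poly_Mapping.single (\<Sum>t\<leftarrow>ts. tree_monomial t) (\<Prod>i<length fs. tree_weight k (ts ! i) (fs ! i)))"
    by (rule prod_fdb_sum) (rule that)
  have "hcard (Phi (bar (Sym_operad k)) fs as bs) /
      (of_nat (card (Aut (Sr (ops_level k)) as)) * of_nat (card (Aut (Sr (ops_level k)) bs))) =
    (\<Sum>ts\<in>{ts. set ts \<subseteq> S \<and> length ts = length fs}. (\<Prod>i<length fs. tree_weight k (ts ! i) (fs ! i)) *
      (if (\<Sum>t\<leftarrow>ts. tree_monomial t) = (monomial as, monomial bs) then 1 else 0))"
    using S(3) by (intro hcard_Phi[OF fs as bs S(1,2)]) blast
  also have "\<dots> = Poly_Mapping.lookup (\<Prod>f\<leftarrow>fs. fdb_sum k (op_gen f)) (monomial as, monomial bs)"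
    unfolding eq lookup_sum lookup_single by (intro sum.cong refl) (simp add: when_def)
  finally show ?thesis .
qed

text \<open>Both components of a term come from nonempty configurations. The incidence
  comultiplication, which ranges over pairs of such classes, thus misses no term of the
  product.\<close>

lemma keys_prod_fdb_sum:
  assumes fs: "fs \<in> Obj (Sr (ops_level k))"
    and xy: "(x, y) \<in> Poly_Mapping.keys (\<Prod>f\<leftarrow>fs. fdb_sum k (op_gen f))"
  shows "\<exists>as\<in>Obj (Sr (ops_level k)). \<exists>bs\<in>Obj (Sr (ops_level k)). x = monomial as \<and> y = monomial bs"
proof -
  have ne: "fs \<noteq> []" and "set fs \<subseteq> Obj (ops_level k)" using fs by (simp_all add: Obj_Sr)
  from this(2) obtain S where S: "finite S" "S \<subseteq> Obj (trees_level k)"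
    "\<And>t f. t \<in> Obj (trees_level k) \<Longrightarrow> f \<in> set fs \<Longrightarrow>
      Hom (ops_level k) (composite t) f \<noteq> {} \<Longrightarrow> t \<in> S"
    and eq: "(\<Prod>f\<leftarrow>fs. fdb_sum k (op_gen f)) = (\<Sum>ts\<in>{ts. set ts \<subseteq> S \<and> length ts = length fs}.
      Poly_Mapping.single (\<Sum>t\<leftarrow>ts. tree_monomial t) (\<Prod>i<length fs. tree_weight k (ts ! i) (fs ! i)))"
    by (rule prod_fdb_sum) (rule that)
  obtain ts where ts: "set ts \<subseteq> S" "length ts = length fs" "(x, y) = (\<Sum>t\<leftarrow>ts. tree_monomial t)"
    using xy keys_sum_single_subset unfolding eq by fastforce
  have t: "t \<in> set ts \<Longrightarrow> t \<in> Obj (trees_level k)" for t using ts(1) S(2) by blast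
  have "ts \<noteq> []" using ts(2) ne by auto
  then have "concat (map leaf_ops ts) \<in> Obj (Sr (ops_level k))" "map bottom_op ts \<in> Obj (Sr (ops_level k))"
    using tree_parts_mem(2-4)[OF t] hd_in_set[of ts] by (auto simp: Obj_Sr)
  then show ?thesis using ts(3) unfolding sum_tree_monomial by blast
qed

text \<open>The argument for the comultiplication with colours in place of trees: the permutations
  cancel, and the fibre factors over the operations. An operation then counts 1 if it is a unit and
  0 otherwise, the value of its generator on the identity tuple.\<close>

lemma hcard_counit:
  assumes fs: "fs \<in> Obj (Sr (ops_level k))"
  shows "hcard (hofib (Sr (level (Sym_operad k) 0)) (Sr (ops_level k))
      (Sr_fun (tree_degen (Sym_operad k) 0 0)) fs) = (\<Prod>f\<leftarrow>fs. coord (op_gen f) variables)"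
proof -
  let ?n = "length fs" and ?S = "Colour ` {1..k} :: (nat, nat list \<times> nat) ltree set"
  let ?X0 = "Sr (level (Sym_operad k) 0)" and ?X1 = "Sr (ops_level k)"
  let ?s = "fobj (tree_degen (Sym_operad k) 0 0)"
  let ?L = "{xs. set xs \<subseteq> ?S \<and> length xs = ?n}"
  have gL1: "lf_groupoid (ops_level k)" by (rule Sym.lf_groupoid_level_1)
  have X0: "lf_groupoid (guarded ?X0)"
    by (intro lf_groupoid_guarded lf_groupoid_Sr Sym.lf_groupoid_level_0)
  have F: "functorial (Sr_fun (tree_degen (Sym_operad k) 0 0)) (guarded ?X0) ?X1"
    by (intro functorial_guarded functorial_Sr_fun Sym.functorial_tree_degen_0)
  have O: "Obj (level (Sym_operad k) 0) = ?S"
    by (auto simp: level_0_sel discrete_def)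
  have ne: "fs \<noteq> []" using fs by (simp add: Obj_Sr)
  have finL: "finite ?L" by (rule finite_lists_length_eq) simp
  have ar: "card (arrows_from ?X0 xs) = fact ?n" if xs: "xs \<in> ?L" for xs
  proof -
    have 1: "card (arrows_from (level (Sym_operad k) 0) x) = 1" if "x \<in> set xs" for x
    proof -
      have "x \<in> ?S" using xs that by blast
      then obtain c where "x = Colour c" "c \<in> {1..k}" by (rule imageE)
      then show ?thesis
        using card_arrows_from_discrete[of c "{1..k}"] by (simp add: card_arrows_from_level_0)
    qed
    then have "finite (arrows_from (level (Sym_operad k) 0) x)" if "x \<in> set xs" for x
      using that by (intro card_ge_0_finite) simp
    then have "card (arrows_from ?X0 xs) = fact (length xs) * (\<Prod>x\<leftarrow>xs. card (arrows_from (level (Sym_operad k) 0) x))"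
      using xs ne by (intro card_arrows_from_Sr) auto
    also have "map (\<lambda>x. card (arrows_from (level (Sym_operad k) 0) x)) xs = map (\<lambda>_. 1) xs"
      using 1 by simp
    also have "(\<Prod>x\<leftarrow>xs. 1) = (1 :: nat)" by (induction xs) simp_all
    finally show ?thesis using xs by simp
  qed
  have "hcard (hofib ?X0 ?X1 (Sr_fun (tree_degen (Sym_operad k) 0 0)) fs) =
      (\<Sum>xs\<in>?L. of_nat (card (Hom ?X1 (fobj (Sr_fun (tree_degen (Sym_operad k) 0 0)) xs) fs)) /
        of_nat (card (arrows_from ?X0 xs)))"
  proof (rule hcard_hofib[OF X0 lf_groupoid_Sr[OF gL1] F finL])
    show "?L \<subseteq> Obj ?X0" using ne by (auto simp: Obj_Sr O)
    fix xs assume xs: "xs \<in> Obj ?X0"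
      and "Hom ?X1 (fobj (Sr_fun (tree_degen (Sym_operad k) 0 0)) xs) fs \<noteq> {}"
    then obtain l where "l \<in> Hom ?X1 (fobj (Sr_fun (tree_degen (Sym_operad k) 0 0)) xs) fs" by blast
    then have "length xs = ?n" using Hom_SrD(2) by fastforce
    then show "xs \<in> ?L" using xs by (simp add: Obj_Sr O)
  qed
  \<comment> \<open>The trailing factor 1 takes the place of \<open>W\<close> in
    \<open>sum_card_Hom_Sr\<close>.\<close>
  also have "\<dots> = (\<Sum>xs\<in>?L. 1 / fact ?n * (of_nat (card (Hom ?X1 (map ?s xs) fs)) * 1))"
    by (intro sum.cong refl) (simp add: ar)
  also have "\<dots> = 1 / fact ?n * (\<Sum>xs\<in>?L. of_nat (card (Hom ?X1 (map ?s xs) fs)) * 1)"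
    by (rule sum_distrib_left[symmetric])
  also have "(\<Sum>xs\<in>?L. of_nat (card (Hom ?X1 (map ?s xs) fs)) * 1 :: rat) =
      fact ?n * (\<Sum>xs\<in>?L. (\<Prod>i<?n. of_nat (card (Hom (ops_level k) (?s (xs ! i)) (fs ! i)))) * 1)"
    by (rule sum_card_Hom_Sr[OF gL1]) simp
  also have "(\<Sum>xs\<in>?L. (\<Prod>i<?n. of_nat (card (Hom (ops_level k) (?s (xs ! i)) (fs ! i)))) * 1 :: rat) =
      (\<Prod>f\<leftarrow>fs. \<Sum>x\<in>?S. of_nat (card (Hom (ops_level k) (?s x) f)))"
    by (subst prod_list_sum_lists) simp_all
  also have "\<dots> = (\<Prod>f\<leftarrow>fs. coord (op_gen f) variables)"
  proof (intro arg_cong[of _ _ prod_list] map_cong refl)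
    fix f assume "f \<in> set fs"
    then have fO: "f \<in> Obj (ops_level k)" using fs by (auto simp: Obj_Sr)
    then obtain d i where f: "f = Oper (d, i)" "i \<in> {1..k}" by (auto simp: mem_Obj_level_1)
    have e1: "exp_fact (content [c]) = 1" for c :: nat
      by (simp add: exp_fact_def)
    have e2: "exp_fact (content d) = 1" if "content [i] = content d"
      using e1[of i] unfolding that .
    have "(\<Sum>x\<in>?S. of_nat (card (Hom (ops_level k) (?s x) f)) :: rat) =
        (\<Sum>c\<in>{1..k}. of_nat (card (Hom (ops_level k) (Oper ([c], c)) f)))"
      by (subst sum.reindex) (simp_all add: inj_on_def tree_degen.simps)
    \<comment> \<open>Only the unit of colour \<open>i\<close> can map to \<open>f\<close>, and only
      if the input word is \<open>[i]\<close>. There is then one morphism, because the exponent of a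
      single variable has factorial 1.\<close>
    also have "\<dots> = (\<Sum>c\<in>{1..k}. if c = i then (if content [i] = content d then 1 else 0) else 0)"
    proof (rule sum.cong[OF refl])
      fix c assume "c \<in> {1..k}"
      then have "Oper ([c], c) \<in> Obj (ops_level k)" by (simp add: mem_Obj_level_1)
      from card_Hom_level_1[OF this fO] show "of_nat (card (Hom (ops_level k) (Oper ([c], c)) f)) =
          (if c = i then (if content [i] = content d then 1 else 0) else 0 :: rat)"
        by (auto simp: f(1) gen_def e1 e2 simp del: content_simps(2))
    qed
    also have "\<dots> = coord (op_gen f) variables"
      using f(2) e1[of i]
      by (auto simp: f(1) gen_def coord_def variables_def Series_inverse)
    finally show "(\<Sum>x\<in>?S. of_nat (card (Hom (ops_level k) (?s x) f))) = coord (op_gen f) variables" .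
  qed
  finally show ?thesis by simp
qed

section \<open>The isomorphism\<close>

lemma lookup_scale: "Poly_Mapping.lookup (scale c p) x = c * Poly_Mapping.lookup p x"
  by (simp add: scale_def map.rep_eq when_def)

lemma scale_single [simp]: "scale c (Poly_Mapping.single x a) = Poly_Mapping.single x (c * a)"
  by (rule poly_mapping_eqI) (simp add: lookup_scale lookup_single when_def)

lemma scale_sum: "scale c (\<Sum>i\<in>I. p i) = (\<Sum>i\<in>I. scale c (p i))"
  by (rule poly_mapping_eqI) (simp add: lookup_scale lookup_sum sum_distrib_left)

lemma scale_add_left: "scale (a + b) p = scale a p + scale b p"
  by (rule poly_mapping_eqI) (simp add: lookup_scale lookup_add algebra_simps)

lemma scale_0_left [simp]: "scale 0 p = 0"
  by (rule poly_mapping_eqI) (simp add: lookup_scale)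

lemma scale_1 [simp]: "scale 1 p = p"
  by (rule poly_mapping_eqI) (simp add: lookup_scale)

lemma coeff_additive_scale: "coeff_additive (\<lambda>x c. scale c (h x))"
  by (simp add: coeff_additive_def scale_add_left)

lemma lin_ext_eq_coeff_sum: "lin_ext h = coeff_sum (\<lambda>x c. scale c (h x))"
  by (simp add: lin_ext_def coeff_sum_def fun_eq_iff)

lemma lin_ext_sum: "lin_ext h (\<Sum>i\<in>I. p i) = (\<Sum>i\<in>I. lin_ext h (p i))"
  unfolding lin_ext_eq_coeff_sum by (rule coeff_sum_sum[OF coeff_additive_scale])

lemma lin_ext_single: "lin_ext h (Poly_Mapping.single x c) = scale c (h x)"
  unfolding lin_ext_eq_coeff_sum by (rule coeff_sum_single[OF coeff_additive_scale])

lemma single_sum_keys: "p = (\<Sum>x\<in>Poly_Mapping.keys p. Poly_Mapping.single x (Poly_Mapping.lookup p x))"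
  by (rule sum_single_keys[symmetric])

lemma scale_scale: "scale a (scale b p) = scale (a * b) p"
  by (rule poly_mapping_eqI) (simp add: lookup_scale)

lemma lin_ext_scale: "lin_ext h (scale c p) = scale c (lin_ext h p)"
proof -
  have "scale c p = (\<Sum>x\<in>Poly_Mapping.keys p. Poly_Mapping.single x (c * Poly_Mapping.lookup p x))"
    by (subst single_sum_keys[of p]) (simp add: scale_sum)
  then show ?thesis
    by (simp add: lin_ext_sum lin_ext_single) (simp add: lin_ext_def scale_sum scale_scale)
qed

text \<open>The isomorphism has this form, carrying monomials to classes; its tensor square then
  relabels pairs in the same way.\<close>

definition lin_map :: "('a \<Rightarrow> 'b) \<Rightarrow> ('a \<Rightarrow>\<^sub>0 rat) \<Rightarrow> ('b \<Rightarrow>\<^sub>0 rat)" where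
  "lin_map \<beta> p = (\<Sum>x\<in>Poly_Mapping.keys p. Poly_Mapping.single (\<beta> x) (Poly_Mapping.lookup p x))"

lemma lin_map_eq_coeff_sum: "lin_map \<beta> = coeff_sum (\<lambda>x c. Poly_Mapping.single (\<beta> x) c)"
  by (simp add: lin_map_def coeff_sum_def fun_eq_iff)

lemma coeff_additive_single: "coeff_additive (\<lambda>x c. Poly_Mapping.single (\<beta> x) (c :: rat))"
  by (simp add: coeff_additive_def single_add)

lemma lin_map_add: "lin_map \<beta> (p + q) = lin_map \<beta> p + lin_map \<beta> q"
  unfolding lin_map_eq_coeff_sum by (rule coeff_sum_add[OF coeff_additive_single])

lemma lin_map_sum: "lin_map \<beta> (\<Sum>i\<in>I. p i) = (\<Sum>i\<in>I. lin_map \<beta> (p i))"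
  unfolding lin_map_eq_coeff_sum by (rule coeff_sum_sum[OF coeff_additive_single])

lemma lin_map_single [simp]: "lin_map \<beta> (Poly_Mapping.single x c) = Poly_Mapping.single (\<beta> x) c"
  unfolding lin_map_eq_coeff_sum by (rule coeff_sum_single[OF coeff_additive_single])

lemma lin_map_scale: "lin_map \<beta> (scale c p) = scale c (lin_map \<beta> p)"
proof -
  have "lin_map \<beta> = lin_ext (\<lambda>x. Poly_Mapping.single (\<beta> x) 1)"
    by (simp add: lin_map_def lin_ext_def fun_eq_iff)
  then show ?thesis by (simp add: lin_ext_scale)
qed

lemma lin_map_lin_map: "lin_map \<gamma> (lin_map \<beta> p) = lin_map (\<lambda>x. \<gamma> (\<beta> x)) p"
  unfolding lin_map_def[of \<beta>] by (simp add: lin_map_sum) (simp add: lin_map_def)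

lemma keys_lin_map: "Poly_Mapping.keys (lin_map \<beta> p) \<subseteq> \<beta> ` Poly_Mapping.keys p"
  unfolding lin_map_def by (rule keys_sum_single_subset)

lemma lin_map_id:
  assumes "\<And>x. x \<in> Poly_Mapping.keys p \<Longrightarrow> \<beta> x = x"
  shows "lin_map \<beta> p = p"
  unfolding lin_map_def using assms by (subst (3) single_sum_keys) (simp cong: sum.cong)

lemma bij_betw_lin_map:
  assumes \<beta>: "bij_betw \<beta> A B"
  shows "bij_betw (lin_map \<beta>) {p. Poly_Mapping.keys p \<subseteq> A} {q. Poly_Mapping.keys q \<subseteq> B}"
proof (rule bij_betw_byWitness[where f' = "lin_map (inv_into A \<beta>)"])
  have l: "inv_into A \<beta> (\<beta> x) = x" if "x \<in> A" for x
    using \<beta> that by (simp add: bij_betw_def)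
  have r: "inv_into A \<beta> y \<in> A" "\<beta> (inv_into A \<beta> y) = y" if "y \<in> B" for y
    using \<beta> that by (auto simp: bij_betw_def inv_into_into f_inv_into_f)
  show "\<forall>p\<in>{p. Poly_Mapping.keys p \<subseteq> A}. lin_map (inv_into A \<beta>) (lin_map \<beta> p) = p"
    using l by (auto simp: lin_map_lin_map intro!: lin_map_id)
  show "\<forall>q\<in>{q. Poly_Mapping.keys q \<subseteq> B}. lin_map \<beta> (lin_map (inv_into A \<beta>) q) = q"
    using r by (auto simp: lin_map_lin_map intro!: lin_map_id)
  show "lin_map \<beta> ` {p. Poly_Mapping.keys p \<subseteq> A} \<subseteq> {q. Poly_Mapping.keys q \<subseteq> B}"
    using keys_lin_map[of \<beta>] bij_betw_imp_surj_on[OF \<beta>] by fast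
  show "lin_map (inv_into A \<beta>) ` {q. Poly_Mapping.keys q \<subseteq> B} \<subseteq> {p. Poly_Mapping.keys p \<subseteq> A}"
    using keys_lin_map[of "inv_into A \<beta>"] r(1) by fast
qed

lemma tensor_eq_coeff_sum: "tensor p q = coeff_sum (\<lambda>x a. coeff_sum (\<lambda>y b. Poly_Mapping.single (x, y) (a * b)) q) p"
  by (simp add: tensor_def coeff_sum_def)

lemma coeff_additive_tensor_left: "coeff_additive (\<lambda>x a. coeff_sum (\<lambda>y b. Poly_Mapping.single (x, y) (a * b :: rat)) q)"
  by (simp add: coeff_additive_def coeff_sum_def single_add distrib_right sum.distrib)

lemma coeff_additive_tensor_right: "coeff_additive (\<lambda>y b. Poly_Mapping.single (x, y) (a * b :: rat))"
  by (simp add: coeff_additive_def single_add distrib_left)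

lemma tensor_lin_map_left: "tensor (lin_map \<beta> p) r = (\<Sum>x\<in>Poly_Mapping.keys p.
    coeff_sum (\<lambda>y b. Poly_Mapping.single (\<beta> x, y) (Poly_Mapping.lookup p x * b)) r)"
  unfolding tensor_eq_coeff_sum lin_map_def coeff_sum_sum[OF coeff_additive_tensor_left]
    coeff_sum_single[OF coeff_additive_tensor_left] ..

lemma tensor_lin_map: "tensor (lin_map \<beta> p) (lin_map \<gamma> q) =
  (\<Sum>x\<in>Poly_Mapping.keys p. \<Sum>y\<in>Poly_Mapping.keys q.
    Poly_Mapping.single (\<beta> x, \<gamma> y) (Poly_Mapping.lookup p x * Poly_Mapping.lookup q y))"
  unfolding tensor_lin_map_left
  unfolding lin_map_def coeff_sum_sum[OF coeff_additive_tensor_right]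
    coeff_sum_single[OF coeff_additive_tensor_right] ..

lemma tensor_single: "tensor (Poly_Mapping.single x a) (Poly_Mapping.single y b) = Poly_Mapping.single (x, y) (a * b)"
  using tensor_lin_map[of "\<lambda>x. x" "Poly_Mapping.single x a" "\<lambda>y. y" "Poly_Mapping.single y b"]
  by (simp split: if_splits)

lemma tensor_map_lin_map: "tensor_map (lin_map \<beta>) = lin_map (map_prod \<beta> \<beta>)"
  by (simp add: tensor_map_def lin_ext_def lin_map_def tensor_single fun_eq_iff split_def map_prod_def)

text \<open>The structure map of the tensor square as an algebra is
  \<open>Poly_Mapping.single 0\<close>. Multiplying by it is scaling, so \<open>alg_ext\<close>
  becomes a linear combination of products of generator values.\<close>

lemma single_0_times: "Poly_Mapping.single 0 c * p = scale c (p :: 'a::comm_monoid_add \<Rightarrow>\<^sub>0 rat)"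
proof -
  have "Poly_Mapping.single 0 c * (\<Sum>x\<in>Poly_Mapping.keys p. Poly_Mapping.single x (Poly_Mapping.lookup p x)) =
      scale c (\<Sum>x\<in>Poly_Mapping.keys p. Poly_Mapping.single x (Poly_Mapping.lookup p x))"
    by (simp add: sum_distrib_left mult_single scale_sum)
  then show ?thesis by (simp only: sum_single_keys)
qed

section \<open>Configurations up to isomorphism and monomials\<close>

definition configuration_class :: "nat \<Rightarrow> (generator \<Rightarrow>\<^sub>0 nat) \<Rightarrow> (nat, nat list \<times> nat) ltree list set" where
  "configuration_class k m = {xs \<in> Obj (Sr (ops_level k)). monomial xs = m}"

lemma iso_class_eq_configuration_class:
  assumes "xs \<in> Obj (Sr (ops_level k))"
  shows "iso_class (Sr (ops_level k)) xs = configuration_class k (monomial xs)"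
proof -
  have "ys \<in> iso_class (Sr (ops_level k)) xs \<longleftrightarrow> ys \<in> configuration_class k (monomial xs)" for ys
    using assms Hom_Sr_level_1_nonempty_iff[of xs k ys]
    by (auto simp: iso_class_def configuration_class_def monomial_def Obj_Sr)
  then show ?thesis by blast
qed

lemma monomial_append: "monomial (xs @ ys) = monomial xs + monomial ys"
  by (simp add: monomial_def)

lemma monomial_eq_0_iff: "monomial xs = 0 \<longleftrightarrow> xs = []"
  by (simp add: monomial_def)

lemma ops_level_gen:
  "op_gen ` Obj (ops_level k) = {1..k} \<times> (exponents k - {0})"
proof
  show "op_gen ` Obj (ops_level k) \<subseteq> {1..k} \<times> (exponents k - {0})"
  proof (rule image_subsetI)
    fix x assume "x \<in> Obj (ops_level k)"
    then obtain c i where "x = Oper (c, i)" "c \<noteq> []" "set c \<subseteq> {1..k}" "i \<in> {1..k}"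
      unfolding mem_Obj_level_1 by blast
    then show "op_gen x \<in> {1..k} \<times> (exponents k - {0})"
      using content_mem_exponents_iff[of c k] by (simp add: gen_def)
  qed
  show "{1..k} \<times> (exponents k - {0}) \<subseteq> op_gen ` Obj (ops_level k)"
  proof
    fix v assume v: "v \<in> {1..k} \<times> (exponents k - {0})"
    obtain c where c: "content c = snd v" using content_surj by blast
    have "c \<noteq> []" using v c by auto
    then have "Oper (c, fst v) \<in> Obj (ops_level k)"
      using v content_mem_exponents_iff[of c k] unfolding mem_Obj_level_1 by (auto simp: c mem_Times_iff)
    moreover have "op_gen (Oper (c, fst v)) = v" by (simp add: gen_def c)
    ultimately show "v \<in> op_gen ` Obj (ops_level k)" by (metis image_eqI)
  qed
qed

lemma monomial_mem_fdb_monomials: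
  "set xs \<subseteq> Obj (ops_level k) \<Longrightarrow> monomial xs \<in> fdb_monomials k"
  using ops_level_gen[of k] by (auto simp: fdb_monomials_def monomial_def image_subset_iff)

lemma fdb_monomials_cases:
  assumes "m \<in> fdb_monomials k" "m \<noteq> 0"
  obtains xs where "xs \<in> Obj (Sr (ops_level k))" "monomial xs = m"
proof -
  obtain vs where vs: "content vs = m" using content_surj by blast
  then have "set vs \<subseteq> op_gen ` Obj (ops_level k)"
    using assms(1) unfolding ops_level_gen by (auto simp: fdb_monomials_def)
  then obtain xs where xs: "vs = map op_gen xs" "set xs \<subseteq> Obj (ops_level k)"
  proof -
    assume a: "\<And>xs. vs = map op_gen xs \<Longrightarrow> set xs \<subseteq> Obj (ops_level k) \<Longrightarrow> thesis"
    assume sub: "set vs \<subseteq> op_gen ` Obj (ops_level k)"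
    let ?xs = "map (inv_into (Obj (ops_level k)) op_gen) vs"
    have "op_gen (inv_into (Obj (ops_level k)) op_gen v) = v" if "v \<in> set vs" for v
      using sub that by (intro f_inv_into_f) blast
    then have "vs = map op_gen ?xs" by (simp add: map_idI)
    moreover have "set ?xs \<subseteq> Obj (ops_level k)"
      using sub by (auto intro!: inv_into_into)
    ultimately show thesis by (rule a)
  qed
  then have "xs \<in> Obj (Sr (ops_level k))" "monomial xs = m"
    using vs assms(2) by (auto simp: Obj_Sr monomial_def)
  then show thesis by (rule that)
qed

lemma configuration_class_cases:
  assumes "m \<in> fdb_monomials k" "m \<noteq> 0"
  shows "configuration_class k m \<in> pi0 (Sr (ops_level k))"
    "rep (configuration_class k m) \<in> Obj (Sr (ops_level k))"
    "monomial (rep (configuration_class k m)) = m"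
proof -
  interpret lf_groupoid "Sr (ops_level k)"
    by (rule lf_groupoid_Sr[OF Sym.lf_groupoid_level_1])
  obtain xs where xs: "xs \<in> Obj (Sr (ops_level k))" "monomial xs = m"
    using fdb_monomials_cases[OF assms] .
  show p: "configuration_class k m \<in> pi0 (Sr (ops_level k))"
    using iso_class_eq_configuration_class[OF xs(1)] xs by (auto simp: pi0_def)
  show "rep (configuration_class k m) \<in> Obj (Sr (ops_level k))"
    "monomial (rep (configuration_class k m)) = m"
    using rep_mem(1)[OF p] by (simp_all add: configuration_class_def)
qed

lemma pi0_cases:
  assumes "A \<in> pi0 (Sr (ops_level k))"
  obtains m where "m \<in> fdb_monomials k" "m \<noteq> 0" "A = configuration_class k m"
proof -
  obtain xs where xs: "xs \<in> Obj (Sr (ops_level k))" "A = iso_class (Sr (ops_level k)) xs"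
    using assms by (auto simp: pi0_def)
  then have "monomial xs \<in> fdb_monomials k" "monomial xs \<noteq> 0"
    by (auto simp: Obj_Sr monomial_def intro!: monomial_mem_fdb_monomials[unfolded monomial_def])
  then show thesis using that xs iso_class_eq_configuration_class by blast
qed

text \<open>The monomial 1 belongs to no configuration, since tuples are nonempty; it goes to the
  adjoined unit.\<close>

definition class_of_monomial :: "nat \<Rightarrow> (generator \<Rightarrow>\<^sub>0 nat) \<Rightarrow> (nat, nat list \<times> nat) ltree list set option" where
  "class_of_monomial k m = (if m = 0 then None else Some (configuration_class k m))"

lemma bar_sel:
  "simp (bar Q) (Suc 0) = Sr (level Q (Suc 0))" "simp (bar Q) 0 = Sr (level Q 0)"
  "degen (bar Q) 0 0 = Sr_fun (tree_degen Q 0 0)"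
  by (simp_all add: bar_def)

lemma bij_betw_class_of_monomial:
  "bij_betw (class_of_monomial k) (fdb_monomials k)
    (basis (incidence_bialgebra (bar (Sym_operad k)) (@)))"
  unfolding bij_betw_def
proof
  show "inj_on (class_of_monomial k) (fdb_monomials k)"
  proof (rule inj_onI)
    fix m m' assume "m \<in> fdb_monomials k" "m' \<in> fdb_monomials k" "class_of_monomial k m = class_of_monomial k m'"
    then show "m = m'"
      using configuration_class_cases(3) by (metis class_of_monomial_def option.distinct(1) option.inject)
  qed
  show "class_of_monomial k ` fdb_monomials k = basis (incidence_bialgebra (bar (Sym_operad k)) (@))"
  proof
    show "class_of_monomial k ` fdb_monomials k \<subseteq> basis (incidence_bialgebra (bar (Sym_operad k)) (@))"
      using configuration_class_cases(1) by (auto simp: incidence_bialgebra_def class_of_monomial_def bar_sel)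
    show "basis (incidence_bialgebra (bar (Sym_operad k)) (@)) \<subseteq> class_of_monomial k ` fdb_monomials k"
    proof
      fix b assume "b \<in> basis (incidence_bialgebra (bar (Sym_operad k)) (@))"
      then consider "b = None" | A where "b = Some A" "A \<in> pi0 (Sr (ops_level k))"
        by (auto simp: incidence_bialgebra_def bar_sel)
      then show "b \<in> class_of_monomial k ` fdb_monomials k"
      proof cases
        case 1
        have "0 \<in> fdb_monomials k" by (simp add: fdb_monomials_def)
        then show ?thesis using 1 by (intro image_eqI[of _ _ 0]) (simp_all add: class_of_monomial_def)
      next
        case 2
        then obtain m where "m \<in> fdb_monomials k" "m \<noteq> 0" "A = configuration_class k m"
          using pi0_cases by blast
        then show ?thesis using 2 by (intro image_eqI[of _ _ m]) (simp_all add: class_of_monomial_def)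
      qed
    qed
  qed
qed

lemma basis_mult_class_of_monomial:
  assumes m: "m \<in> fdb_monomials k" and m': "m' \<in> fdb_monomials k"
  shows "basis_mult (bar (Sym_operad k)) (@) (class_of_monomial k m) (class_of_monomial k m') =
    class_of_monomial k (m + m')"
proof (cases "m = 0 \<or> m' = 0")
  case True
  then show ?thesis by (cases "m = 0") (simp_all add: class_of_monomial_def)
next
  case False
  let ?r = "\<lambda>m. rep (configuration_class k m)"
  note c = configuration_class_cases(2,3)[OF m] configuration_class_cases(2,3)[OF m']
  have r: "?r m @ ?r m' \<in> Obj (Sr (ops_level k))" "monomial (?r m @ ?r m') = m + m'"
    using c False by (simp_all add: Obj_Sr monomial_append)
  have "m + m' \<noteq> 0"
    using r(1) monomial_eq_0_iff[of "?r m @ ?r m'"] unfolding r(2) Obj_Sr by blast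
  then show ?thesis
    using False iso_class_eq_configuration_class[OF r(1)] r(2) by (simp add: class_of_monomial_def bar_sel)
qed

lemma prod_keys_eq_prod_list_gen:
  assumes "monomial xs = m"
  shows "(\<Prod>v\<in>Poly_Mapping.keys m. h v ^ Poly_Mapping.lookup m v) = (\<Prod>x\<leftarrow>xs. h (op_gen x))"
  using prod_power_content[of "set (map op_gen xs)" "map op_gen xs" h] assms
  by (auto simp: monomial_def comp_def)

text \<open>The coefficients of the product over the generators are the incidence coefficients. What
  remains is to exchange pairs of isomorphism classes with nonzero coefficient for pairs of
  monomials in the support.\<close>

lemma basis_comult_class_of_monomial:
  assumes m: "m \<in> fdb_monomials k"
  shows "basis_comult (bar (Sym_operad k)) (class_of_monomial k m) =
    lin_map (map_prod (class_of_monomial k) (class_of_monomial k))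
      (\<Prod>v\<in>Poly_Mapping.keys m. fdb_comult_gen k v ^ Poly_Mapping.lookup m v)"
proof (cases "m = 0")
  case True
  have "lin_map (map_prod (class_of_monomial k) (class_of_monomial k)) (Poly_Mapping.single 0 1) =
      Poly_Mapping.single (None, None) 1"
    unfolding lin_map_single by (simp add: zero_prod_def class_of_monomial_def)
  then show ?thesis using True by (simp add: class_of_monomial_def)
next
  case False
  let ?X = "bar (Sym_operad k)" and ?X1 = "Sr (ops_level k)"
  let ?A = "configuration_class k"
  define fs where "fs = rep (?A m)"
  have fs: "fs \<in> Obj ?X1" "monomial fs = m"
    using configuration_class_cases(2,3)[OF m False] by (simp_all add: fs_def)
  define T where "T = (\<Prod>f\<leftarrow>fs. fdb_sum k (op_gen f))"
  have "(\<Prod>v\<in>Poly_Mapping.keys m. fdb_comult_gen k v ^ Poly_Mapping.lookup m v) =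
      (\<Prod>f\<leftarrow>fs. fdb_comult_gen k (op_gen f))"
    by (rule prod_keys_eq_prod_list_gen[OF fs(2)])
  also have "\<dots> = T"
    unfolding T_def
  proof (intro arg_cong[of _ _ prod_list] map_cong refl)
    fix f assume "f \<in> set fs"
    then have "op_gen f \<in> {1..k} \<times> (exponents k - {0})"
      using fs(1) ops_level_gen[of k] by (auto simp: Obj_Sr)
    then show "fdb_comult_gen k (op_gen f) = fdb_sum k (op_gen f)"
      using fdb_comult_gen_eq[of "fst (op_gen f)" k "snd (op_gen f)"] by (auto simp: mem_Times_iff)
  qed
  finally have T: "(\<Prod>v\<in>Poly_Mapping.keys m. fdb_comult_gen k v ^ Poly_Mapping.lookup m v) = T" .
  have coeff: "incidence_coeff ?X (?A m) a b = Poly_Mapping.lookup T (monomial (rep a), monomial (rep b))"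
    if "rep a \<in> Obj ?X1" "rep b \<in> Obj ?X1" for a b
    unfolding T_def incidence_coeff_def fs_def[symmetric]
    using incidence_coeff_eq_lookup[OF fs(1) that] by (simp add: bar_sel)
  \<comment> \<open>Neither component is the monomial 1, so both labels have the form
    \<open>Some\<close> and both classes have representatives.\<close>
  have keys: "x \<in> fdb_monomials k \<and> x \<noteq> 0 \<and> y \<in> fdb_monomials k \<and> y \<noteq> 0"
    if xy: "(x, y) \<in> Poly_Mapping.keys T" for x y
  proof -
    have "z \<in> fdb_monomials k \<and> z \<noteq> 0" if "\<exists>as\<in>Obj ?X1. z = monomial as" for z
      using that monomial_mem_fdb_monomials by (auto simp: Obj_Sr monomial_def)
    then show ?thesis using keys_prod_fdb_sum[OF fs(1) xy[unfolded T_def]] by blast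
  qed
  have "basis_comult ?X (class_of_monomial k m) = (\<Sum>(a, b)\<in>{(a, b). a \<in> pi0 ?X1 \<and> b \<in> pi0 ?X1 \<and>
      incidence_coeff ?X (?A m) a b \<noteq> 0}. Poly_Mapping.single (Some a, Some b) (incidence_coeff ?X (?A m) a b))"
    using False by (simp add: class_of_monomial_def bar_sel)
  also have "\<dots> = (\<Sum>x\<in>Poly_Mapping.keys T.
      Poly_Mapping.single (map_prod (class_of_monomial k) (class_of_monomial k) x) (Poly_Mapping.lookup T x))"
  proof (rule sum.reindex_bij_witness[where i = "map_prod ?A ?A" and
        j = "map_prod (\<lambda>a. monomial (rep a)) (\<lambda>a. monomial (rep a))"])
    fix p assume p: "p \<in> {(a, b). a \<in> pi0 ?X1 \<and> b \<in> pi0 ?X1 \<and> incidence_coeff ?X (?A m) a b \<noteq> 0}"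
    then obtain a b where ab: "p = (a, b)" "a \<in> pi0 ?X1" "b \<in> pi0 ?X1" "incidence_coeff ?X (?A m) a b \<noteq> 0"
      by blast
    obtain x where x: "x \<in> fdb_monomials k" "x \<noteq> 0" "a = ?A x" using pi0_cases[OF ab(2)] .
    obtain y where y: "y \<in> fdb_monomials k" "y \<noteq> 0" "b = ?A y" using pi0_cases[OF ab(3)] .
    have r: "monomial (rep a) = x" "monomial (rep b) = y" "rep a \<in> Obj ?X1" "rep b \<in> Obj ?X1"
      using configuration_class_cases(2,3)[OF x(1,2)] configuration_class_cases(2,3)[OF y(1,2)]
      by (simp_all add: x(3) y(3))
    show "map_prod ?A ?A (map_prod (\<lambda>a. monomial (rep a)) (\<lambda>a. monomial (rep a)) p) = p"
      by (simp add: ab(1) r(1,2) flip: x(3) y(3))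
    show "map_prod (\<lambda>a. monomial (rep a)) (\<lambda>a. monomial (rep a)) p \<in> Poly_Mapping.keys T"
      using ab(4) coeff[OF r(3,4)] by (simp add: ab(1) in_keys_iff)
    show "Poly_Mapping.single (map_prod (class_of_monomial k) (class_of_monomial k)
          (map_prod (\<lambda>a. monomial (rep a)) (\<lambda>a. monomial (rep a)) p))
        (Poly_Mapping.lookup T (map_prod (\<lambda>a. monomial (rep a)) (\<lambda>a. monomial (rep a)) p)) =
      (case p of (a, b) \<Rightarrow> Poly_Mapping.single (Some a, Some b) (incidence_coeff ?X (?A m) a b))"
      using coeff[OF r(3,4)] x(2) y(2) by (simp add: ab(1) r(1,2) class_of_monomial_def flip: x(3) y(3))
  next
    fix p assume p: "p \<in> Poly_Mapping.keys T"
    obtain x y where xy: "p = (x, y)" by (cases p)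
    note k = keys[OF p[unfolded xy]]
    have cx: "?A x \<in> pi0 ?X1" "rep (?A x) \<in> Obj ?X1" "monomial (rep (?A x)) = x"
      and cy: "?A y \<in> pi0 ?X1" "rep (?A y) \<in> Obj ?X1" "monomial (rep (?A y)) = y"
      using configuration_class_cases k by blast+
    show "map_prod (\<lambda>a. monomial (rep a)) (\<lambda>a. monomial (rep a)) (map_prod ?A ?A p) = p"
      by (simp add: xy cx(3) cy(3))
    show "map_prod ?A ?A p \<in> {(a, b). a \<in> pi0 ?X1 \<and> b \<in> pi0 ?X1 \<and> incidence_coeff ?X (?A m) a b \<noteq> 0}"
      using p coeff[OF cx(2) cy(2)] cx cy by (simp add: xy in_keys_iff)
  qed
  finally show ?thesis
    unfolding T lin_map_def .
qed

lemma basis_counit_class_of_monomial: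
  assumes m: "m \<in> fdb_monomials k"
  shows "basis_counit (bar (Sym_operad k)) (class_of_monomial k m) =
    (\<Prod>v\<in>Poly_Mapping.keys m. coord v variables ^ Poly_Mapping.lookup m v)"
proof (cases "m = 0")
  case False
  note c = configuration_class_cases(2,3)[OF m False]
  show ?thesis
    using False hcard_counit[OF c(1)] prod_keys_eq_prod_list_gen[OF c(2), of "\<lambda>v. coord v variables"]
    by (simp add: class_of_monomial_def bar_sel)
qed (simp add: class_of_monomial_def)

text \<open>Both structures are extended linearly or bilinearly from their bases, and relabelling a
  basis is linear, so each compatibility reduces to its counterpart for monomials.\<close>

lemma isomorphic_faa_di_bruno_incidence:
  "isomorphic_bialgebras (faa_di_bruno k) (incidence_bialgebra (bar (Sym_operad k)) (@))"
proof -
  let ?A = "faa_di_bruno k" and ?X = "bar (Sym_operad k)"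
  let ?B = "incidence_bialgebra ?X (@)"
  let ?\<beta> = "class_of_monomial k"
  let ?\<phi> = "lin_map ?\<beta>"
  have V: "vectors ?A = {p. Poly_Mapping.keys p \<subseteq> fdb_monomials k}"
    by (simp add: vectors_def faa_di_bruno_def)
  have "bij_betw ?\<phi> (vectors ?A) (vectors ?B)"
    unfolding V vectors_def[of ?B] by (rule bij_betw_lin_map[OF bij_betw_class_of_monomial])
  moreover have "?\<phi> (bialgebra.mult ?A p q) = bialgebra.mult ?B (?\<phi> p) (?\<phi> q)" if "p \<in> vectors ?A" "q \<in> vectors ?A" for p q
  proof -
    have mem: "x \<in> fdb_monomials k" if "x \<in> Poly_Mapping.keys p \<or> x \<in> Poly_Mapping.keys q" for x
      using that \<open>p \<in> vectors ?A\<close> \<open>q \<in> vectors ?A\<close> unfolding V by blast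
    have "p * q = (\<Sum>x\<in>Poly_Mapping.keys p. Poly_Mapping.single x (Poly_Mapping.lookup p x)) *
        (\<Sum>y\<in>Poly_Mapping.keys q. Poly_Mapping.single y (Poly_Mapping.lookup q y))"
      by (simp only: sum_single_keys)
    also have "\<dots> = (\<Sum>x\<in>Poly_Mapping.keys p. \<Sum>y\<in>Poly_Mapping.keys q.
        Poly_Mapping.single (x + y) (Poly_Mapping.lookup p x * Poly_Mapping.lookup q y))"
      by (simp add: sum_product mult_single)
    finally have "?\<phi> (p * q) = (\<Sum>x\<in>Poly_Mapping.keys p. \<Sum>y\<in>Poly_Mapping.keys q.
        Poly_Mapping.single (?\<beta> (x + y)) (Poly_Mapping.lookup p x * Poly_Mapping.lookup q y))"
      by (simp add: lin_map_sum)
    also have "\<dots> = (\<Sum>x\<in>Poly_Mapping.keys p. \<Sum>y\<in>Poly_Mapping.keys q.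
        Poly_Mapping.single (basis_mult ?X (@) (?\<beta> x) (?\<beta> y)) (Poly_Mapping.lookup p x * Poly_Mapping.lookup q y))"
      by (intro sum.cong refl) (simp add: basis_mult_class_of_monomial mem)
    also have "\<dots> = bialgebra.mult ?B (?\<phi> p) (?\<phi> q)"
      by (simp add: incidence_bialgebra_def tensor_lin_map lin_ext_sum lin_ext_single)
    finally show ?thesis by (simp add: faa_di_bruno_def)
  qed
  moreover have "?\<phi> (unit ?A) = unit ?B"
    using lin_map_single[of ?\<beta> 0 1]
    by (simp add: faa_di_bruno_def incidence_bialgebra_def class_of_monomial_def)
  moreover have "comult ?B (?\<phi> p) = tensor_map ?\<phi> (comult ?A p)" if p: "p \<in> vectors ?A" for p
  proof -
    let ?D = "\<lambda>m. \<Prod>v\<in>Poly_Mapping.keys m. fdb_comult_gen k v ^ Poly_Mapping.lookup m v"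
    have "comult ?B (?\<phi> p) = (\<Sum>m\<in>Poly_Mapping.keys p.
        scale (Poly_Mapping.lookup p m) (basis_comult ?X (?\<beta> m)))"
      by (simp add: incidence_bialgebra_def lin_map_def lin_ext_sum lin_ext_single)
    also have "\<dots> = (\<Sum>m\<in>Poly_Mapping.keys p.
        scale (Poly_Mapping.lookup p m) (lin_map (map_prod ?\<beta> ?\<beta>) (?D m)))"
      using p unfolding V by (intro sum.cong refl) (auto simp: basis_comult_class_of_monomial)
    also have "\<dots> = tensor_map ?\<phi> (comult ?A p)"
      by (simp add: faa_di_bruno_def alg_ext_def tensor_map_lin_map lin_map_sum single_0_times lin_map_scale)
    finally show ?thesis .
  qed
  moreover have "counit ?B (?\<phi> p) = counit ?A p" if p: "p \<in> vectors ?A" for p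
  proof -
    have ca: "coeff_additive (\<lambda>b c. c * basis_counit ?X b)"
      by (simp add: coeff_additive_def distrib_right)
    have "counit ?B (?\<phi> p) = coeff_sum (\<lambda>b c. c * basis_counit ?X b) (?\<phi> p)"
      by (simp add: incidence_bialgebra_def coeff_sum_def)
    also have "\<dots> = (\<Sum>m\<in>Poly_Mapping.keys p. Poly_Mapping.lookup p m * basis_counit ?X (?\<beta> m))"
      unfolding lin_map_def coeff_sum_sum[OF ca] coeff_sum_single[OF ca] ..
    also have "\<dots> = counit ?A p"
      using p unfolding V
      by (auto simp: faa_di_bruno_def alg_ext_def basis_counit_class_of_monomial intro!: sum.cong)
    finally show ?thesis .
  qed
  ultimately show ?thesis
    unfolding isomorphic_bialgebras_def
    by (intro exI[of _ ?\<phi>]) (simp add: lin_map_add lin_map_scale)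
qed

theorem theorem5p7:
  shows "isomorphic_bialgebras (faa_di_bruno 2) (incidence_bialgebra (bar (Sym_operad 2)) (@)) \<and>
    (\<forall>k\<ge>1. isomorphic_bialgebras (faa_di_bruno k) (incidence_bialgebra (bar (Sym_operad k)) (@)))"
  by (simp add: isomorphic_faa_di_bruno_incidence)

end
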